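(* Let $0<q<1$. A $\mathrm U(1)$-coinvariant invertible contraction $\Gamma$ on the left-invariant 1-forms of the $4D_+$ calculus on $\mathrm{SU}_q(2)$, with matrix in the ordered basis $(\omega_-,\omega_+,\omega_0,\omega_z)$ $$\Gamma_{ab}=\begin{pmatrix}\alpha&0&0&0\\0&\beta&0&0\\0&0&\nu&\epsilon\\0&0&\xi&\gamma\end{pmatrix},$$ is real and maximally hermitian with respect to the Hodge operator $\mathfrak T^+$ if and only if $\alpha,\beta,\nu,\gamma,\epsilon,\xi$ are real, $\alpha\ne0$, $\gamma\neq0$, $\epsilon\neq0$, and $$\beta=q^2\alpha,\qquad \nu=0,\qquad \xi=\epsilon,\qquad \epsilon^2=(q-q^{-1})^2\alpha\beta,\qquad (q+q^{-1})\,\epsilon+(q-q^{-1})\,\gamma=0 .$$ For all these contractions $\det_q\Gamma=-q^2(1-q^2)^2\alpha^4$, so that $\mathrm{sgn}\,\Gamma=-1$.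
   Context: **Setting.** $V=\mathrm{span}_{\mathbb C}\{\omega_-,\omega_+,\omega_0,\omega_z\}$ is the space of left-invariant 1-forms of Woronowicz's $4D_+$ bicovariant calculus on $\mathrm{SU}_q(2)$, with antilinear involution $\omega_-^*=-\omega_+$, $\omega_+^*=-\omega_-$, $\omega_0^*=-\omega_0$, $\omega_z^*=-\omega_z$. Write $ab$ for $\omega_a\otimes\omega_b$. The canonical braiding $\sigma:V\otimes V\to V\otimes V$ is: $\sigma(--)=--$, $\sigma(++)=++$, $\sigma(00)=00$; $\sigma(-0)=(1-q^2)(-0)+(0-)$, $\sigma(0-)=q^2(-0)$, $\sigma(-z)=(1+q^2)(-0)+(z-)$, $\sigma(z-)=-(1+q^{-2})(-0)+q^{-2}(-z)+(1-q^{-2})(z-)$; $\sigma(+0)=(1-q^{-2})(+0)+(0+)$, $\sigma(0+)=q^{-2}(+0)$, $\sigma(+z)=-(1+q^{-2})(+0)+(z+)$, $\sigma(z+)=(1+q^2)(+0)+q^2(+z)+(1-q^2)(z+)$; $\sigma(z0)=(0z)-(q-q^{-1})^2[(z0)+(-+)-(+-)]$, $\sigma(0z)=(z0)$, $\sigma(zz)=(zz)+(q^2-q^{-2})[(z0)+(-+)-(+-)]$, $\sigma(-+)=-(z0)+(+-)$, $\sigma(+-)=(z0)+(-+)$. It satisfies the braid equation. $\sigma_j$ is $\sigma$ acting on tensor factors $j,j+1$. **Antisymmetrisers and forms.** For a permutation $p$ with reduced word $\tau_{j_1}\cdots\tau_{j_r}$ in nearest-neighbour transpositions put $\mathfrak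 P(p)=\sigma_{j_1}\cdots\sigma_{j_r}$, and $A^{(k)}=\sum_{p\in P(k)}\mathrm{sign}(p)\,\mathfrak P(p)$ on $V^{\otimes k}$ ($A^{(0)}=A^{(1)}=1$). Left-invariant $k$-forms are $\Omega^k_{\mathrm{inv}}=A^{(k)}(V^{\otimes k})\subset V^{\otimes k}$ (zero for $k>4$, one dimensional for $k=4$), on which $A^{(k)}$ acts diagonalizably. On $V^{\otimes k}$ let $(v_1\otimes\dots\otimes v_k)^\dagger=(-1)^{k(k-1)/2}v_k^*\otimes\dots\otimes v_1^*$ (antilinear); the conjugation on $\Omega^k_{\mathrm{inv}}$ is the well-defined antilinear map $(A^{(k)}x)^*=A^{(k)}(x^\dagger)$; it maps eigenspaces of $A^{(k)}$ to eigenspaces. If $A^{(k)}\eta=\lambda_\eta\eta$, $\lambda_{\eta^*}$ denotes the eigenvalue on $\eta^*$. **Contractions.** A contraction is a sesquilinear map $\Gamma:V\times V\to\mathbb C$ (antilinear in the first, linear in the second argument), with $\Gamma_{ab}=\Gamma(\omega_a,\omega_b)$, extended for $k\le s$ by $\Gamma(\omega_{a_1}\otimes\dots\otimes\omega_{a_k},\omega_{b_1}\otimes\dots\otimes\omega_{b_s})=\big(\prod_{i=1}^k\Gamma_{a_ib_i}\big)\,\omega_{b_{k+1}}\otimes\dots\otimes\omega_{b_s}$. $\mathrm U(1)$-coinvariance means precisely that the matrix has the block form displayed in the claim, with complex entries. **Hodge operator.** Fix $m\in\mathbb R\setminus\{0\}$, $\vartheta=im\,\omega_-\otimes\omega_+\otimes\omega_0\otimes\omega_z$,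 $\mu=A^{(4)}(\vartheta)=\mu^*$. $B_{k,4-k}=\sum_p\mathrm{sign}(p)\mathfrak P(p)$ is the sum over the minimal-length representatives of the cosets $(P(k)\times P(4-k))\backslash P(4)$, so that $A^{(4)}=(A^{(k)}\otimes A^{(4-k)})B_{k,4-k}$. On eigenforms $A^{(k)}\eta=\lambda_\eta\eta$ in $\Omega^k_{\mathrm{inv}}$, $$\mathfrak T^+(\eta)=\frac{\lambda_{\eta^*}}{\lambda_\eta}\Big(A^{(4-k)}\big(\Gamma(\eta,B_{k,4-k}\vartheta)\big)\Big)^*,$$ extended linearly to $\mathfrak T^+:\Omega^k_{\mathrm{inv}}\to\Omega^{4-k}_{\mathrm{inv}}$. $\Gamma$ is *invertible* if $\mathfrak T^+(\mu)\neq0$. **Real / (maximally) hermitian.** $\Gamma$ is *real* if $\mathfrak T^+(\omega_a^* )=(\mathfrak T^+(\omega_a))^*$ for all $a$; *hermitian* if $(\mathfrak T^+)^2(\omega_a)=-(\mathfrak T^+)^2(1)\,\omega_a$ for all $a$; *real and maximally hermitian* if it is real, hermitian, and for every $k$ the operator $(\mathfrak T^+)^2$ is a constant multiple of the identity on each eigenspace of $A^{(k)}$ in $\Omega^k_{\mathrm{inv}}$. (These conditions do not depend on $m$.) **Determinant.** $\det_q\Gamma=\Gamma\big(i\,\omega_-\otimes\omega_+\otimes\omega_0\otimes\omega_z,\;i\,A^{(4)}(\omega_-\otimes\omega_+\otimes\omega_0\otimes\omega_z)\big)$ and $\mathrm{sgn}\,\Gamma=\det_q\Gamma/|\det_q\Gamma|$.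 *)

theory Defs
  imports Complex_Main "HOL-Library.Function_Algebras" "HOL-Combinatorics.Permutations"
begin

section \<open>Tensors over the left-invariant 1-forms\<close>

datatype idx = Om | Op | O0 | Oz

instance idx :: finite
proof
  have "(UNIV :: idx set) \<subseteq> {Om, Op, O0, Oz}"
    using idx.exhaust by auto
  then show "finite (UNIV :: idx set)"
    by (rule finite_subset) simp
qed

text \<open>The constructors stand for the basis vectors \<open>\<omega>\<^sub>-\<close>, \<open>\<omega>\<^sub>+\<close>, \<open>\<omega>\<^sub>0\<close>, \<open>\<omega>\<^sub>z\<close> of \<open>V\<close>, in this order.
  A tensor is its family of coefficients with respect to the words in these basis vectors;
  addition and zero are the pointwise ones, and \<open>V\<close> to the tensor power \<open>k\<close> is \<open>tpow k\<close>.\<close>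

type_synonym tensor = "idx list \<Rightarrow> complex"

definition words :: "nat \<Rightarrow> idx list set" where
  "words k = {w. length w = k}"

definition tpow :: "nat \<Rightarrow> tensor set" where
  "tpow k = {t. \<forall>w. w \<notin> words k \<longrightarrow> t w = 0}"

definition tscale :: "complex \<Rightarrow> tensor \<Rightarrow> tensor" (infixr "*\<^sub>T" 75) where
  "c *\<^sub>T t = (\<lambda>w. c * t w)"

definition bas :: "idx list \<Rightarrow> tensor" where
  "bas u = (\<lambda>w. if w = u then 1 else 0)"

abbreviation \<omega> :: "idx \<Rightarrow> tensor" where
  "\<omega> a \<equiv> bas [a]"

text \<open>The identification of \<open>tpow 0\<close> with the complex numbers.\<close>

definition scalar :: "tensor \<Rightarrow> complex" where
  "scalar t = t []"


section \<open>The braiding\<close>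

fun sigma :: "real \<Rightarrow> idx \<Rightarrow> idx \<Rightarrow> tensor" where
  "sigma q Om Om = bas [Om, Om]"
| "sigma q Op Op = bas [Op, Op]"
| "sigma q O0 O0 = bas [O0, O0]"
| "sigma q Om O0 = of_real (1 - q^2) *\<^sub>T bas [Om, O0] + bas [O0, Om]"
| "sigma q O0 Om = of_real (q^2) *\<^sub>T bas [Om, O0]"
| "sigma q Om Oz = of_real (1 + q^2) *\<^sub>T bas [Om, O0] + bas [Oz, Om]"
| "sigma q Oz Om = of_real (- (1 + 1 / q^2)) *\<^sub>T bas [Om, O0]
      + of_real (1 / q^2) *\<^sub>T bas [Om, Oz] + of_real (1 - 1 / q^2) *\<^sub>T bas [Oz, Om]"
| "sigma q Op O0 = of_real (1 - 1 / q^2) *\<^sub>T bas [Op, O0] + bas [O0, Op]"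
| "sigma q O0 Op = of_real (1 / q^2) *\<^sub>T bas [Op, O0]"
| "sigma q Op Oz = of_real (- (1 + 1 / q^2)) *\<^sub>T bas [Op, O0] + bas [Oz, Op]"
| "sigma q Oz Op = of_real (1 + q^2) *\<^sub>T bas [Op, O0]
      + of_real (q^2) *\<^sub>T bas [Op, Oz] + of_real (1 - q^2) *\<^sub>T bas [Oz, Op]"
| "sigma q Oz O0 = bas [O0, Oz]
      - of_real ((q - 1 / q)^2) *\<^sub>T (bas [Oz, O0] + bas [Om, Op] - bas [Op, Om])"
| "sigma q O0 Oz = bas [Oz, O0]"
| "sigma q Oz Oz = bas [Oz, Oz]
      + of_real (q^2 - 1 / q^2) *\<^sub>T (bas [Oz, O0] + bas [Om, Op] - bas [Op, Om])"
| "sigma q Om Op = - bas [Oz, O0] + bas [Op, Om]"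
| "sigma q Op Om = bas [Oz, O0] + bas [Om, Op]"

text \<open>The braiding acting on the tensor factors at positions \<open>j\<close> and \<open>j + 1\<close>, counted from \<open>0\<close>.\<close>

definition braid :: "real \<Rightarrow> nat \<Rightarrow> tensor \<Rightarrow> tensor" where
  "braid q j t = (\<lambda>w. \<Sum>a\<in>UNIV. \<Sum>b\<in>UNIV.
     t (w[j := a, Suc j := b]) * sigma q a b [w ! j, w ! Suc j])"


section \<open>Antisymmetrisers\<close>

definition word_perm :: "nat list \<Rightarrow> nat \<Rightarrow> nat" where
  "word_perm js = foldr (\<lambda>j p. transpose j (Suc j) \<circ> p) js id"

definition word_braid :: "real \<Rightarrow> nat list \<Rightarrow> tensor \<Rightarrow> tensor" where
  "word_braid q js = foldr (\<lambda>j f. braid q j \<circ> f) js id"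

definition perm_word :: "nat \<Rightarrow> (nat \<Rightarrow> nat) \<Rightarrow> nat list \<Rightarrow> bool" where
  "perm_word k p js \<longleftrightarrow> (\<forall>j\<in>set js. Suc j < k) \<and> word_perm js = p"

definition perm_length :: "nat \<Rightarrow> (nat \<Rightarrow> nat) \<Rightarrow> nat" where
  "perm_length k p = (LEAST n. \<exists>js. perm_word k p js \<and> length js = n)"

definition reduced_word :: "nat \<Rightarrow> (nat \<Rightarrow> nat) \<Rightarrow> nat list \<Rightarrow> bool" where
  "reduced_word k p js \<longleftrightarrow> perm_word k p js \<and> length js = perm_length k p"

text \<open>By the braid equation the choice of the reduced word is immaterial on \<open>tpow k\<close>.\<close>

definition braid_perm :: "real \<Rightarrow> nat \<Rightarrow> (nat \<Rightarrow> nat) \<Rightarrow> tensor \<Rightarrow> tensor" where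
  "braid_perm q k p = word_braid q (SOME js. reduced_word k p js)"

definition asym :: "real \<Rightarrow> nat \<Rightarrow> tensor \<Rightarrow> tensor" where
  "asym q k t = (\<Sum>p\<in>{p. p permutes {..<k}}. of_int (sign p) *\<^sub>T braid_perm q k p t)"

definition young :: "nat \<Rightarrow> nat \<Rightarrow> (nat \<Rightarrow> nat) set" where
  "young k n = {h. h permutes {..<n} \<and> h ` {..<k} = {..<k}}"

text \<open>Every coset \<open>young k n \<circ> p\<close> has exactly one element of minimal length.\<close>

definition coset_reps :: "nat \<Rightarrow> nat \<Rightarrow> (nat \<Rightarrow> nat) set" where
  "coset_reps k n = {p. p permutes {..<n} \<and>
     (\<forall>h\<in>young k n. perm_length n p \<le> perm_length n (h \<circ> p))}"

definition asym_reps :: "real \<Rightarrow> nat \<Rightarrow> nat \<Rightarrow> tensor \<Rightarrow> tensor" where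
  "asym_reps q k n t = (\<Sum>p\<in>coset_reps k n. of_int (sign p) *\<^sub>T braid_perm q n p t)"


section \<open>Left-invariant forms and their conjugation\<close>

definition inv_forms :: "real \<Rightarrow> nat \<Rightarrow> tensor set" where
  "inv_forms q k = asym q k ` tpow k"

fun star :: "idx \<Rightarrow> tensor" where
  "star Om = - \<omega> Op"
| "star Op = - \<omega> Om"
| "star O0 = - \<omega> O0"
| "star Oz = - \<omega> Oz"

text \<open>Factor \<open>i\<close> of the image of the basis tensor \<open>u\<close> is the star of factor \<open>k - 1 - i\<close> of \<open>u\<close>.\<close>

definition dagger :: "nat \<Rightarrow> tensor \<Rightarrow> tensor" where
  "dagger k x = (\<lambda>w. if w \<in> words k
     then (-1) ^ (k * (k - 1) div 2) *
       (\<Sum>u\<in>words k. cnj (x u) * (\<Prod>i<k. star (u ! (k - 1 - i)) [w ! i]))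
     else 0)"

text \<open>\<open>asym q k x\<close> is sent to \<open>asym q k (dagger k x)\<close>; on \<open>inv_forms q k\<close> this does not depend
  on the preimage \<open>x\<close>.\<close>

definition form_conj :: "real \<Rightarrow> nat \<Rightarrow> tensor \<Rightarrow> tensor" where
  "form_conj q k y = asym q k (dagger k (inv_into (tpow k) (asym q k) y))"


section \<open>Contractions\<close>

definition contraction :: "(tensor \<Rightarrow> tensor \<Rightarrow> complex) \<Rightarrow> bool" where
  "contraction \<Gamma> \<longleftrightarrow>
     (\<forall>x\<in>tpow 1. \<forall>y\<in>tpow 1. \<forall>z\<in>tpow 1.
        \<Gamma> (x + y) z = \<Gamma> x z + \<Gamma> y z \<and> \<Gamma> z (x + y) = \<Gamma> z x + \<Gamma> z y) \<and>
     (\<forall>c. \<forall>x\<in>tpow 1. \<forall>y\<in>tpow 1.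
        \<Gamma> (c *\<^sub>T x) y = cnj c * \<Gamma> x y \<and> \<Gamma> x (c *\<^sub>T y) = c * \<Gamma> x y)"

text \<open>The extension of \<open>\<Gamma>\<close> to \<open>tpow k\<close> and \<open>tpow s\<close> for \<open>k \<le> s\<close>, with values in \<open>tpow (s - k)\<close>.\<close>

definition contract ::
    "(tensor \<Rightarrow> tensor \<Rightarrow> complex) \<Rightarrow> nat \<Rightarrow> nat \<Rightarrow> tensor \<Rightarrow> tensor \<Rightarrow> tensor" where
  "contract \<Gamma> k s x y = (\<lambda>w. if w \<in> words (s - k)
     then \<Sum>u\<in>words k. \<Sum>v\<in>words k.
       cnj (x u) * y (v @ w) * (\<Prod>i<k. \<Gamma> (\<omega> (u ! i)) (\<omega> (v ! i)))
     else 0)"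

text \<open>The matrices of the \<open>U(1)\<close>-coinvariant contractions.\<close>

fun u1_matrix :: "complex \<Rightarrow> complex \<Rightarrow> complex \<Rightarrow> complex \<Rightarrow> complex \<Rightarrow> complex
    \<Rightarrow> idx \<Rightarrow> idx \<Rightarrow> complex" where
  "u1_matrix \<alpha> \<beta> \<nu> \<epsilon> \<xi> \<gamma> Om Om = \<alpha>"
| "u1_matrix \<alpha> \<beta> \<nu> \<epsilon> \<xi> \<gamma> Op Op = \<beta>"
| "u1_matrix \<alpha> \<beta> \<nu> \<epsilon> \<xi> \<gamma> O0 O0 = \<nu>"
| "u1_matrix \<alpha> \<beta> \<nu> \<epsilon> \<xi> \<gamma> O0 Oz = \<epsilon>"
| "u1_matrix \<alpha> \<beta> \<nu> \<epsilon> \<xi> \<gamma> Oz O0 = \<xi>"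
| "u1_matrix \<alpha> \<beta> \<nu> \<epsilon> \<xi> \<gamma> Oz Oz = \<gamma>"
| "u1_matrix \<alpha> \<beta> \<nu> \<epsilon> \<xi> \<gamma> _ _ = 0"


section \<open>The Hodge operator\<close>

definition theta :: "real \<Rightarrow> tensor" where
  "theta m = (\<i> * of_real m) *\<^sub>T bas [Om, Op, O0, Oz]"

definition mu :: "real \<Rightarrow> real \<Rightarrow> tensor" where
  "mu q m = asym q 4 (theta m)"

text \<open>The eigenvalue of the antisymmetriser on a nonzero eigenform.\<close>

definition eigval :: "real \<Rightarrow> nat \<Rightarrow> tensor \<Rightarrow> complex" where
  "eigval q k \<eta> = (THE l. asym q k \<eta> = l *\<^sub>T \<eta>)"

text \<open>The Hodge operator on \<open>k\<close>-forms is the linear map on \<open>inv_forms q k\<close> with the prescribed values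
  on eigenforms. These span \<open>inv_forms q k\<close>, so the map is determined there; its values elsewhere
  are irrelevant.\<close>

definition is_hodge :: "real \<Rightarrow> real \<Rightarrow> (tensor \<Rightarrow> tensor \<Rightarrow> complex) \<Rightarrow> nat
    \<Rightarrow> (tensor \<Rightarrow> tensor) \<Rightarrow> bool" where
  "is_hodge q m \<Gamma> k T \<longleftrightarrow>
     (\<forall>x\<in>inv_forms q k. \<forall>y\<in>inv_forms q k. T (x + y) = T x + T y) \<and>
     (\<forall>c. \<forall>x\<in>inv_forms q k. T (c *\<^sub>T x) = c *\<^sub>T T x) \<and>
     (\<forall>\<eta>\<in>inv_forms q k. \<forall>l. \<eta> \<noteq> 0 \<and> asym q k \<eta> = l *\<^sub>T \<eta> \<longrightarrow>
        T \<eta> = (eigval q k (form_conj q k \<eta>) / l) *\<^sub>T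
          form_conj q (4 - k) (asym q (4 - k) (contract \<Gamma> k 4 \<eta> (asym_reps q k 4 (theta m)))))"

definition hodge :: "real \<Rightarrow> real \<Rightarrow> (tensor \<Rightarrow> tensor \<Rightarrow> complex) \<Rightarrow> nat
    \<Rightarrow> tensor \<Rightarrow> tensor" where
  "hodge q m \<Gamma> k = (SOME T. is_hodge q m \<Gamma> k T)"

definition hodge_sq :: "real \<Rightarrow> real \<Rightarrow> (tensor \<Rightarrow> tensor \<Rightarrow> complex) \<Rightarrow> nat
    \<Rightarrow> tensor \<Rightarrow> tensor" where
  "hodge_sq q m \<Gamma> k x = hodge q m \<Gamma> (4 - k) (hodge q m \<Gamma> k x)"

definition invertible_contraction :: "real \<Rightarrow> real \<Rightarrow> (tensor \<Rightarrow> tensor \<Rightarrow> complex) \<Rightarrow> bool" where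
  "invertible_contraction q m \<Gamma> \<longleftrightarrow> hodge q m \<Gamma> 4 (mu q m) \<noteq> 0"

definition real_contraction :: "real \<Rightarrow> real \<Rightarrow> (tensor \<Rightarrow> tensor \<Rightarrow> complex) \<Rightarrow> bool" where
  "real_contraction q m \<Gamma> \<longleftrightarrow>
     (\<forall>a. hodge q m \<Gamma> 1 (form_conj q 1 (\<omega> a)) = form_conj q 3 (hodge q m \<Gamma> 1 (\<omega> a)))"

definition hermitian_contraction :: "real \<Rightarrow> real \<Rightarrow> (tensor \<Rightarrow> tensor \<Rightarrow> complex) \<Rightarrow> bool" where
  "hermitian_contraction q m \<Gamma> \<longleftrightarrow>
     (\<forall>a. hodge_sq q m \<Gamma> 1 (\<omega> a) = (- scalar (hodge_sq q m \<Gamma> 0 (bas []))) *\<^sub>T \<omega> a)"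

text \<open>Since \<open>inv_forms q k\<close> is zero for \<open>k > 4\<close>, only \<open>k \<le> 4\<close> matters in the last condition.\<close>

definition real_max_hermitian :: "real \<Rightarrow> real \<Rightarrow> (tensor \<Rightarrow> tensor \<Rightarrow> complex) \<Rightarrow> bool" where
  "real_max_hermitian q m \<Gamma> \<longleftrightarrow>
     real_contraction q m \<Gamma> \<and> hermitian_contraction q m \<Gamma> \<and>
     (\<forall>k\<le>4. \<forall>l. \<exists>c. \<forall>\<eta>\<in>inv_forms q k.
        asym q k \<eta> = l *\<^sub>T \<eta> \<longrightarrow> hodge_sq q m \<Gamma> k \<eta> = c *\<^sub>T \<eta>)"

definition qdet :: "real \<Rightarrow> (tensor \<Rightarrow> tensor \<Rightarrow> complex) \<Rightarrow> complex" where
  "qdet q \<Gamma> = scalar (contract \<Gamma> 4 4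
     (\<i> *\<^sub>T bas [Om, Op, O0, Oz]) (\<i> *\<^sub>T asym q 4 (bas [Om, Op, O0, Oz])))"

definition qsgn :: "real \<Rightarrow> (tensor \<Rightarrow> tensor \<Rightarrow> complex) \<Rightarrow> complex" where
  "qsgn q \<Gamma> = qdet q \<Gamma> / of_real (cmod (qdet q \<Gamma>))"

end

theory Submission imports Defs begin

text \<open>
  The braid equation makes the antisymmetriser vanish on every tensor that is fixed by one of the
  braidings. It therefore factors through the algebra with the quadratic relations
  \<open>ker (1 - \<sigma>)\<close>, in which every word straightens to a combination of the words that increase
  in the order of \<open>\<omega>\<^sub>-, \<omega>\<^sub>+, \<omega>\<^sub>0, \<omega>\<^sub>z\<close>. The antisymmetrisers of these words form a basis of the
  invariant forms; the conjugation, being compatible with the relations, is well defined, and in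
  this basis the Hodge operator is an explicit matrix.

  The antisymmetriser is scalar on \<open>k\<close>-forms for \<open>k \<noteq> 2\<close> and has the eigenvalues \<open>1 + q\<^sup>2\<close> and
  \<open>1 + q\<^sup>-\<^sup>2\<close> on 2-forms, which the conjugation exchanges. Reality and hermiticity on 1-forms give
  \<open>\<beta> = q\<^sup>2\<alpha>\<close> and \<open>\<xi> = \<epsilon>\<close>; that the square of the Hodge operator preserves the lines spanned by
  the eigenforms \<open>\<omega>\<^sub>-\<and>\<omega>\<^sub>0\<close> and \<open>\<omega>\<^sub>+\<and>\<omega>\<^sub>0\<close> gives \<open>\<nu> = 0\<close>. The hermiticity conditions for \<open>\<omega>\<^sub>0\<close> and
  \<open>\<omega>\<^sub>z\<close> then become the two remaining equations.
\<close>
section \<open>Reduced words\<close>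

text \<open>\<open>braid_perm\<close> uses an arbitrary reduced word, and the braiding is not an
  involution: on \<open>tpow 2\<close> its eigenvalues are 1, \<open>- q^2\<close> and
  \<open>- 1 / q^2\<close>. Independence of the word is therefore Matsumoto's theorem and has to be
  proved. It comes from rewriting words to a normal form, done once for an abstract action of the
  braid relations. Transpositions, whose letters may also cancel, give permutations, lengths and
  signs; braidings are only allowed the length-increasing steps of the same rewriting.

  The choices in \<open>form_conj\<close> (a preimage) and \<open>hodge\<close> (some operator) are
  controlled by one fact: in degree at most 4 a tensor killed by the antisymmetriser is killed by
  every linear map that respects the quadratic relations. The quotient algebra is never formed; its
  elements are handled through all such maps at once. The ratio of eigenvalues in the Hodge operator
  becomes a polynomial in the antisymmetriser, so no explicit eigenbasis of the 2-forms is
  needed.\<close>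

locale braid_action =
  fixes n :: nat and f :: "nat \<Rightarrow> 'a \<Rightarrow> 'a" and D :: "'a set"
  assumes maps: "Suc j < n \<Longrightarrow> x \<in> D \<Longrightarrow> f j x \<in> D"
    and braid_rel: "Suc (Suc j) < n \<Longrightarrow> x \<in> D \<Longrightarrow>
      f j (f (Suc j) (f j x)) = f (Suc j) (f j (f (Suc j) x))"
    and far: "Suc i < j \<Longrightarrow> Suc j < n \<Longrightarrow> x \<in> D \<Longrightarrow> f i (f j x) = f j (f i x)"
begin

definition act :: "nat list \<Rightarrow> 'a \<Rightarrow> 'a" where
  "act js = foldr (\<lambda>j p. f j \<circ> p) js id"

lemma act_simps [simp]:
  "act [] x = x" "act (j # js) x = f j (act js x)" "act (js @ ks) x = act js (act ks x)"
  by (induction js) (simp_all add: act_def)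

lemma act_maps: "\<forall>j\<in>set js. Suc j < n \<Longrightarrow> x \<in> D \<Longrightarrow> act js x \<in> D"
  by (induction js) (simp_all add: maps)

lemma act_commute:
  assumes "\<forall>l\<in>set ls. Suc l < n \<and> (Suc l < j \<or> Suc j < l)" "Suc j < n" "x \<in> D"
  shows "f j (act ls x) = act ls (f j x)"
  using assms(1)
proof (induction ls)
  case (Cons l ls)
  have "act ls x \<in> D"
    using Cons.prems assms(3) by (intro act_maps) auto
  then have "f j (f l (act ls x)) = f l (f j (act ls x))"
    using Cons.prems assms(2) far[of l j] far[of j l] by auto
  then show ?case
    using Cons by simp
qed simp

text \<open>With l = j - 1 the run splits into [i..<l], l, j and [Suc j..<m]. The letter j passes
  the first block, the braid relation turns j l j into l j l, and the last l passes the final block: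
  a letter that crosses a run drops by one.\<close>

lemma act_upt_shift:
  assumes "i < j" "j < m" "m < n" "x \<in> D"
  shows "f j (act [i..<m] x) = act [i..<m] (f (j - 1) x)"
proof -
  obtain l where l: "j = Suc l" "i \<le> l"
    using assms(1) by (cases j) auto
  have split: "[i..<m] = [i..<l] @ [l, j] @ [Suc j..<m]"
    using l assms(2) upt_add_eq_append[of i l "m - l"] by (simp add: upt_conv_Cons)
  have D: "act [Suc j..<m] x \<in> D" "act [l, j] (act [Suc j..<m] x) \<in> D"
    using assms l by (auto intro!: act_maps maps)
  have "f j (act [i..<m] x) = act [i..<l] (f j (f l (f j (act [Suc j..<m] x))))"
    using act_commute[of "[i..<l]" j "act [l, j] (act [Suc j..<m] x)"] D l assms
    unfolding split by auto
  also have "\<dots> = act [i..<l] (f l (f j (f l (act [Suc j..<m] x))))"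
    using braid_rel[of l] D l assms by simp
  also have "f l (act [Suc j..<m] x) = act [Suc j..<m] (f l x)"
    using l assms by (intro act_commute) auto
  finally show ?thesis
    unfolding split using l by simp
qed

end

text \<open>The code \<open>i\<^sub>n, \<dots>, i\<^sub>1\<close> with \<open>i\<^sub>l < l\<close> stands for the product of the words
  \<open>[i\<^sub>l..<l - 1]\<close>; these are the normal forms for the cosets of the chain of symmetric groups.\<close>

fun codes :: "nat \<Rightarrow> nat list list" where
  "codes 0 = [[]]"
| "codes (Suc n) = concat (map (\<lambda>i. map ((#) i) (codes n)) [0..<Suc n])"

fun code_word :: "nat list \<Rightarrow> nat list" where
  "code_word [] = []"
| "code_word (i # c) = [i..<length c] @ code_word c"

text \<open>Left multiplication of a normal form by the letter j. At the head run the letter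
  prolongs it (\<open>Suc j = i\<close>), cancels its first letter (j = i, valid only for
  involutions), or crosses it into the tail, unchanged if it lies below the run and as j - 1
  otherwise.\<close>

fun code_step :: "nat \<Rightarrow> nat list \<Rightarrow> nat list" where
  "code_step j [] = []"
| "code_step j (i # c) =
     (if Suc j = i then j # c else if j = i then Suc j # c
      else if j < i then i # code_step j c else i # code_step (j - 1) c)"

lemma length_codes: "c \<in> set (codes n) \<Longrightarrow> length c = n"
  by (induction n arbitrary: c) auto

lemma codes_Suc: "i # c \<in> set (codes (Suc n)) \<longleftrightarrow> i \<le> n \<and> c \<in> set (codes n)"
  by (auto simp del: upt_Suc)

declare codes.simps(2) [simp del]

lemma codes_SucE:
  assumes "c \<in> set (codes (Suc n))"
  obtains i c' where "c = i # c'" "i \<le> n" "c' \<in> set (codes n)"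
  using assms by (auto simp: codes.simps(2))

lemma set_code_word: "c \<in> set (codes n) \<Longrightarrow> j \<in> set (code_word c) \<Longrightarrow> Suc j < n"
proof (induction n arbitrary: c)
  case (Suc n)
  then show ?case
    by (elim codes_SucE) (fastforce simp: length_codes)
qed simp

lemma code_step_codes: "c \<in> set (codes n) \<Longrightarrow> Suc j < n \<Longrightarrow> code_step j c \<in> set (codes n)"
proof (induction n arbitrary: c j)
  case (Suc n)
  from Suc.prems(1) obtain i c' where "c = i # c'" "i \<le> n" "c' \<in> set (codes n)"
    by (rule codes_SucE)
  with Suc show ?case
    by (auto simp: codes_Suc)
qed simp

lemma length_code_step:
  "c \<in> set (codes n) \<Longrightarrow> Suc j < n \<Longrightarrow>
    length (code_word (code_step j c)) = Suc (length (code_word c)) \<or>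
    Suc (length (code_word (code_step j c))) = length (code_word c)"
proof (induction n arbitrary: c j)
  case (Suc n)
  from Suc.prems(1) obtain i c' where c: "c = i # c'" "i \<le> n" "c' \<in> set (codes n)"
    by (rule codes_SucE)
  have len: "length (code_step l c') = length c'" if "Suc l < n" for l
    using code_step_codes[OF c(3) that] c(3) by (simp add: length_codes)
  consider "Suc j = i" | "j = i" | "Suc j < i" | "i < j" by linarith
  then show ?case
  proof cases
    case 3
    then have "Suc j < n" using c(2) by simp
    then show ?thesis using 3 Suc.IH[OF c(3), of j] len[of j] c by auto
  next
    case 4
    then have "Suc (j - 1) < n" using Suc.prems by simp
    then show ?thesis using 4 Suc.IH[OF c(3), of "j - 1"] len[of "j - 1"] c by auto
  qed (use c Suc.prems in \<open>auto simp: length_codes\<close>)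
qed simp

context braid_action
begin

text \<open>A step that lengthens the code uses only the braid and commutation relations;
  cancellation happens exactly in the steps that shorten it. The last hypothesis thus covers
  braidings (first alternative) and transpositions (second) in one proof.\<close>

lemma act_code_step:
  assumes "c \<in> set (codes m)" "Suc j < m" "m \<le> n" "x \<in> D"
    and "length (code_word (code_step j c)) = Suc (length (code_word c))
      \<or> (\<forall>j x. Suc j < n \<longrightarrow> x \<in> D \<longrightarrow> f j (f j x) = x)"
  shows "act (j # code_word c) x = act (code_word (code_step j c)) x"
  using assms
proof (induction m arbitrary: c j)
  case (Suc m)
  from Suc.prems(1) obtain i c' where c: "c = i # c'" "i \<le> m" "c' \<in> set (codes m)"
    by (rule codes_SucE)
  have D: "act (code_word c') x \<in> D"
    using set_code_word[OF c(3)] Suc.prems(3,4)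
    by (intro act_maps) force+
  have len: "length (code_step l c') = length c'" if "Suc l < m" for l
    using code_step_codes[OF c(3) that] c(3) by (simp add: length_codes)
  consider "Suc j = i" | "j = i" | "Suc j < i" | "i < j" by linarith
  then show ?case
  proof cases
    case 1
    then have "[j..<m] = j # [i..<m]" using Suc.prems c by (simp add: upt_conv_Cons)
    then show ?thesis using 1 c by (simp add: length_codes)
  next
    case 2
    then have "[j..<m] = j # [Suc i..<m]" using Suc.prems c by (simp add: upt_conv_Cons)
    \<comment> \<open>The code gets shorter here, so the first alternative of the last hypothesis
      fails and the letters are involutions.\<close>
    moreover from this have "f j (f j x) = x" if "x \<in> D" for x
      using 2 c Suc.prems that by (auto simp: length_codes)
    moreover have "act [Suc i..<m] (act (code_word c') x) \<in> D"
      using D Suc.prems by (auto intro: act_maps[of "[Suc i..<m]"])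
    ultimately show ?thesis using 2 c by (simp add: length_codes)
  next
    case 3
    then have j: "Suc j < m" using c(2) by simp
    have "f j (act [i..<m] (act (code_word c') x)) = act [i..<m] (f j (act (code_word c') x))"
      using 3 D Suc.prems by (intro act_commute) auto
    moreover have "length (code_word (code_step j c')) = Suc (length (code_word c')) \<or> (\<forall>j x. Suc j < n \<longrightarrow> x \<in> D \<longrightarrow> f j (f j x) = x)"
      using 3 Suc.prems(5) len[OF j] c by (auto simp: length_codes)
    ultimately show ?thesis using 3 Suc.IH[OF c(3) j] len[OF j] c Suc.prems
      by (simp add: length_codes)
  next
    case 4
    then have j: "Suc (j - 1) < m" using Suc.prems by simp
    have "f j (act [i..<m] (act (code_word c') x)) = act [i..<m] (f (j - 1) (act (code_word c') x))"
      using 4 D Suc.prems by (intro act_upt_shift) auto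
    moreover have "length (code_word (code_step (j - 1) c')) = Suc (length (code_word c')) \<or> (\<forall>j x. Suc j < n \<longrightarrow> x \<in> D \<longrightarrow> f j (f j x) = x)"
      using 4 Suc.prems(5) len[OF j] c by (auto simp: length_codes)
    ultimately show ?thesis using 4 Suc.IH[OF c(3) j] len[OF j] c Suc.prems
      by (simp add: length_codes)
  qed
qed simp

end

text \<open>\<open>rev [0..<n]\<close> is the code of the identity, all of whose runs are empty. The
  letters of the word are multiplied onto it from the left, the last letter first.\<close>

definition code_of :: "nat \<Rightarrow> nat list \<Rightarrow> nat list" where
  "code_of n js = foldr code_step js (rev [0..<n])"

lemma rev_upt_codes: "rev [0..<n] \<in> set (codes n)" "code_word (rev [0..<n]) = []"
  by (induction n) (simp_all add: codes_Suc)

lemma code_of_codes: "\<forall>j\<in>set js. Suc j < n \<Longrightarrow> code_of n js \<in> set (codes n)"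
  by (induction js) (auto simp: code_of_def rev_upt_codes code_step_codes)

lemma length_code_of: "\<forall>j\<in>set js. Suc j < n \<Longrightarrow> length (code_word (code_of n js)) \<le> length js"
proof (induction js)
  case (Cons j js)
  then show ?case
    using length_code_step[OF code_of_codes, of js n j] by (auto simp: code_of_def)
qed (simp add: code_of_def rev_upt_codes)

text \<open>If the code is as long as the word, no step can have shortened it, since every step
  changes the length by one. This is the form of Matsumoto's theorem used for braidings: reduced
  words of one permutation share a code and hence act equally.\<close>

lemma (in braid_action) act_code_of:
  assumes "\<forall>j\<in>set js. Suc j < n" "x \<in> D"
    and "length (code_word (code_of n js)) = length js
      \<or> (\<forall>j x. Suc j < n \<longrightarrow> x \<in> D \<longrightarrow> f j (f j x) = x)"
  shows "act js x = act (code_word (code_of n js)) x"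
  using assms
proof (induction js)
  case Nil
  then show ?case by (simp add: code_of_def rev_upt_codes)
next
  case (Cons j js)
  have c: "code_of n js \<in> set (codes n)" "code_of n (j # js) = code_step j (code_of n js)"
    using Cons.prems code_of_codes by (auto simp: code_of_def)
  have "length (code_word (code_of n js)) \<le> length js"
    using Cons.prems by (intro length_code_of) auto
  then show ?case
    using Cons length_code_step[OF c(1), of j] act_code_step[OF c(1), of j x] c(2) by auto
qed

section \<open>Permutations, their codes and their Coxeter length\<close>

interpretation transp: braid_action n "\<lambda>j. transpose j (Suc j)" UNIV for n
  by unfold_locales (auto simp: transpose_def)

lemma act_transp: "transp.act js = word_perm js"
  by (simp add: transp.act_def word_perm_def)

lemma word_perm_simps [simp]:
  "word_perm [] = id" "word_perm (j # js) = transpose j (Suc j) \<circ> word_perm js"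
  "word_perm (js @ ks) = word_perm js \<circ> word_perm ks"
  by (induction js) (simp_all add: word_perm_def o_assoc)

lemma word_perm_code_of:
  "\<forall>j\<in>set js. Suc j < n \<Longrightarrow> word_perm (code_word (code_of n js)) = word_perm js"
  using transp.act_code_of[of js n] by (simp add: act_transp fun_eq_iff)

lemma word_perm_permutes: "\<forall>j\<in>set js. Suc j < n \<Longrightarrow> word_perm js permutes {..<n}"
  by (induction js) (auto intro!: permutes_compose permutes_swap_id simp: permutes_id)

lemma sign_word_perm: "sign (word_perm js) = (- 1) ^ length js"
proof (induction js)
  case (Cons j js)
  have "permutation (word_perm js)"
    using word_perm_permutes[of js "Suc (Suc (Max (set js)))"] permutes_imp_permutation
    by (metis Max_ge finite_lessThan finite_set less_Suc_eq_le not_less_eq)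
  then show ?case
    using Cons by (simp add: sign_compose sign_swap_id permutation_swap_id del: comp_apply)
qed simp

text \<open>The tail of the code fixes n and the run [i..<n] carries n to i. So the permutation
  determines the head of its code, and stripping heads gives injectivity.\<close>

lemma word_perm_code_head:
  assumes "i # c \<in> set (codes (Suc n))"
  shows "word_perm (code_word (i # c)) n = i"
proof -
  have c: "i \<le> n" "c \<in> set (codes n)"
    using assms by (simp_all add: codes_Suc)
  have "word_perm (code_word c) permutes {..<n}"
    using set_code_word[OF c(2)] by (intro word_perm_permutes) auto
  then have "word_perm (code_word c) n = n"
    by (simp add: permutes_not_in)
  moreover have "word_perm [i..<n] n = i"
    using c(1) by (induction "n - i" arbitrary: i) (auto simp: upt_conv_Cons)
  ultimately show ?thesis
    using c by (simp add: length_codes)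
qed

lemma word_perm_code_inj:
  "inj_on (\<lambda>c. word_perm (code_word c)) (set (codes n))"
proof (induction n)
  case (Suc n)
  show ?case
  proof (rule inj_onI)
    fix c d assume *: "c \<in> set (codes (Suc n))" "d \<in> set (codes (Suc n))"
      and eq: "word_perm (code_word c) = word_perm (code_word d)"
    obtain i c' j d' where cd: "c = i # c'" "c' \<in> set (codes n)" "d = j # d'" "d' \<in> set (codes n)"
      using * by (elim codes_SucE)
    have ij: "i = j"
      using word_perm_code_head[of i c' n] word_perm_code_head[of j d' n] * eq cd by metis
    have "inj (word_perm [i..<n])"
      using word_perm_permutes[of "[i..<n]" "Suc n"] permutes_inj by force
    then have "word_perm (code_word c') = word_perm (code_word d')"
      using eq cd ij by (simp add: length_codes fun_eq_iff inj_eq)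
    then show "c = d"
      using Suc cd ij by (metis inj_onD)
  qed
qed simp

lemma card_codes: "card (set (codes n)) = fact n"
proof (induction n)
  case (Suc n)
  have "set (codes (Suc n)) = (\<lambda>(i, c). i # c) ` ({..n} \<times> set (codes n))"
    by (auto simp: codes_Suc elim!: codes_SucE)
  moreover have "inj_on (\<lambda>(i :: nat, c). i # c) ({..n} \<times> set (codes n))"
    by (auto simp: inj_on_def)
  ultimately show ?case
    using Suc by (simp add: card_image card_cartesian_product)
qed simp

text \<open>Codes yield permutations injectively and there are n! of both, so counting replaces the
  construction of a code for a given permutation.\<close>

lemma permutes_eq_codes:
  "{p. p permutes {..<n}} = (\<lambda>c. word_perm (code_word c)) ` set (codes n)"
proof -
  have "(\<lambda>c. word_perm (code_word c)) ` set (codes n) \<subseteq> {p. p permutes {..<n}}"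
    using set_code_word by (auto intro!: word_perm_permutes)
  moreover have "card {p. p permutes {..<n}} = card ((\<lambda>c. word_perm (code_word c)) ` set (codes n))"
    by (simp add: card_image word_perm_code_inj card_codes card_permutations)
  ultimately show ?thesis
    by (metis card_subset_eq finite_lessThan finite_permutations)
qed

lemma code_of_code_word: "c \<in> set (codes n) \<Longrightarrow> code_of n (code_word c) = c"
  using word_perm_code_of[of "code_word c" n] code_of_codes[of "code_word c" n]
    set_code_word[of c n] word_perm_code_inj[of n] by (auto simp: inj_on_def)

text \<open>Words of the same permutation have the same code by injectivity, and a code is never
  longer than a word that reduces to it. Hence the code computes the Coxeter length that
  \<open>reduced_word\<close> asks for.\<close>

lemma perm_length_word_perm:
  assumes "\<forall>j\<in>set js. Suc j < n"
  shows "perm_length n (word_perm js) = length (code_word (code_of n js))"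
  unfolding perm_length_def
proof (rule Least_equality)
  show "\<exists>ks. perm_word n (word_perm js) ks \<and> length ks = length (code_word (code_of n js))"
    using assms word_perm_code_of[OF assms] set_code_word[OF code_of_codes[OF assms]]
    by (intro exI[of _ "code_word (code_of n js)"]) (auto simp: perm_word_def)
next
  fix l assume "\<exists>ks. perm_word n (word_perm js) ks \<and> length ks = l"
  then obtain ks where ks: "\<forall>j\<in>set ks. Suc j < n" "word_perm ks = word_perm js" "length ks = l"
    by (auto simp: perm_word_def)
  have "code_of n ks = code_of n js"
    using word_perm_code_of[OF ks(1)] word_perm_code_of[OF assms] ks(2)
      code_of_codes[OF ks(1)] code_of_codes[OF assms] word_perm_code_inj[of n]
    by (metis inj_onD)
  then show "length (code_word (code_of n js)) \<le> l"
    using length_code_of[OF ks(1)] ks(3) by simp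
qed

lemma reduced_word_code_of:
  assumes "reduced_word n (word_perm ks) js" "\<forall>j\<in>set ks. Suc j < n"
  shows "\<forall>j\<in>set js. Suc j < n" "code_of n js = code_of n ks"
    "length (code_word (code_of n js)) = length js"
proof -
  show js: "\<forall>j\<in>set js. Suc j < n"
    using assms by (auto simp: reduced_word_def perm_word_def)
  have "word_perm js = word_perm ks"
    using assms by (auto simp: reduced_word_def perm_word_def)
  then show eq: "code_of n js = code_of n ks"
    using word_perm_code_of[OF js] word_perm_code_of[OF assms(2)]
      code_of_codes[OF js] code_of_codes[OF assms(2)] word_perm_code_inj[of n]
    by (metis inj_onD)
  show "length (code_word (code_of n js)) = length js"
    using assms eq by (simp add: reduced_word_def perm_length_word_perm)
qed

section \<open>Linear maps of tensors\<close>

lemma tscale_apply [simp]: "(c *\<^sub>T t) w = c * t w"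
  by (simp add: tscale_def)

lemma sum_tensor_apply [simp]: "(\<Sum>i\<in>I. t i) w = (\<Sum>i\<in>I. t i w)" for t :: "'i \<Rightarrow> tensor"
  by (induction I rule: infinite_finite_induct) simp_all

interpretation tensor: vector_space tscale
  by unfold_locales (simp_all add: fun_eq_iff algebra_simps)

interpretation tensors: vector_space_pair tscale tscale ..

abbreviation tlinear :: "(tensor \<Rightarrow> tensor) \<Rightarrow> bool" where
  "tlinear \<equiv> Vector_Spaces.linear tscale tscale"

lemma tlinearI:
  "(\<And>x y. f (x + y) = f x + f y) \<Longrightarrow> (\<And>c x. f (c *\<^sub>T x) = c *\<^sub>T f x) \<Longrightarrow> tlinear f"
  by (simp add: Vector_Spaces.linear_iff tensor.vector_space_axioms)

lemmas tlinear_simps = tensors.linear_add tensors.linear_scale tensors.linear_neg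
  tensors.linear_diff tensors.linear_0 tensors.linear_sum

lemma tlinear_comp: "tlinear f \<Longrightarrow> tlinear g \<Longrightarrow> tlinear (\<lambda>x. f (g x))"
  using Vector_Spaces.linear_compose[of tscale tscale g tscale f] by (simp add: comp_def)

lemma finite_words [simp]: "finite (words k)"
  using finite_lists_length_eq[of "UNIV :: idx set" k] by (simp add: words_def)

lemma in_words [simp]: "w \<in> words k \<longleftrightarrow> length w = k"
  by (simp add: words_def)

lemma tpow_subspace: "tensor.subspace (tpow k)"
  by (rule tensor.subspaceI) (simp_all add: tpow_def)

lemma bas_tpow [simp]: "length w = k \<Longrightarrow> bas w \<in> tpow k"
  by (simp add: tpow_def bas_def)

lemma tpow_expand: "t \<in> tpow k \<Longrightarrow> t = (\<Sum>u\<in>words k. t u *\<^sub>T bas u)"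
  by (auto simp: fun_eq_iff tpow_def bas_def if_distrib[of "(*) _"] cong: if_cong)

lemma tlinear_eq_on_tpow:
  assumes "tlinear f" "tlinear g" "\<And>w. length w = k \<Longrightarrow> f (bas w) = g (bas w)" "t \<in> tpow k"
  shows "f t = g t"
proof -
  have "f (\<Sum>u\<in>words k. t u *\<^sub>T bas u) = g (\<Sum>u\<in>words k. t u *\<^sub>T bas u)"
    using assms(3) by (simp add: tlinear_simps[OF assms(1)] tlinear_simps[OF assms(2)])
  then show ?thesis
    using tpow_expand[OF assms(4)] by simp
qed

section \<open>The braiding on basis tensors and the braid equation\<close>

definition lcons :: "idx \<Rightarrow> tensor \<Rightarrow> tensor" where
  "lcons a t = (\<lambda>w. case w of [] \<Rightarrow> 0 | x # w' \<Rightarrow> if x = a then t w' else 0)"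

text \<open>Right multiplication of a 2-tensor by the word s. Together with \<open>lcons\<close> it
  lets the simplifier evaluate a braiding on a basis word by peeling letters down to position
  0.\<close>

definition rapp :: "tensor \<Rightarrow> idx list \<Rightarrow> tensor" where
  "rapp t s = (\<lambda>w. if length w \<ge> 2 \<and> drop 2 w = s then t (take 2 w) else 0)"

lemma tlinear_lcons: "tlinear (lcons a)"
  by (rule tlinearI) (auto simp: lcons_def fun_eq_iff split: list.split)

lemma tlinear_rapp: "tlinear (\<lambda>t. rapp t s)"
  by (rule tlinearI) (auto simp: rapp_def fun_eq_iff)

lemmas lcons_linear [simp] = tlinear_simps[OF tlinear_lcons]
lemmas rapp_linear [simp] = tlinear_simps[OF tlinear_rapp]

lemma lcons_bas [simp]: "lcons a (bas u) = bas (a # u)"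
  by (auto simp: lcons_def bas_def fun_eq_iff split: list.split)

lemma rapp_bas [simp]: "rapp (bas [a, b]) s = bas (a # b # s)"
proof
  fix w
  show "rapp (bas [a, b]) s w = bas (a # b # s) w"
    by (cases w; cases "tl w") (auto simp: rapp_def bas_def)
qed

lemma tlinear_braid: "tlinear (braid q j)"
  by (rule tlinearI)
    (simp_all add: braid_def fun_eq_iff algebra_simps sum.distrib sum_distrib_left)

lemmas braid_linear [simp] = tlinear_simps[OF tlinear_braid]

lemma sum_idx: "(\<Sum>a\<in>UNIV. g a) = g Om + g Op + g O0 + g Oz"
  for g :: "idx \<Rightarrow> 'b :: comm_monoid_add"
proof -
  have U: "(UNIV :: idx set) = {Om, Op, O0, Oz}"
    using idx.exhaust by auto
  show ?thesis unfolding U by (simp add: add.assoc)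
qed

lemma sigma_tpow: "sigma q a b \<in> tpow 2"
  using tensor.subspace_add[OF tpow_subspace] tensor.subspace_diff[OF tpow_subspace]
    tensor.subspace_neg[OF tpow_subspace] tensor.subspace_scale[OF tpow_subspace]
  by (cases a; cases b) simp_all

lemma braid_0_bas [simp]: "braid q 0 (bas (a # b # s)) = rapp (sigma q a b) s"
proof
  fix w :: "idx list"
  consider "w = []" | c where "w = [c]" | c d w' where "w = c # d # w'"
    by (cases w; cases "tl w") auto
  then show "braid q 0 (bas (a # b # s)) w = rapp (sigma q a b) s w"
  proof cases
    case 3
    have "braid q 0 (bas (a # b # s)) w =
        (\<Sum>x\<in>UNIV. \<Sum>y\<in>UNIV. if y = b then if x = a \<and> w' = s then sigma q x y [c, d] else 0 else 0)"
      unfolding braid_def 3 by (intro sum.cong) (auto simp: bas_def)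
    also have "\<dots> = (if w' = s then sigma q a b [c, d] else 0)"
      by (cases "w' = s") (simp_all add: sum.delta)
    finally show ?thesis
      by (simp add: 3 rapp_def)
  qed (auto simp: braid_def bas_def rapp_def intro!: sum.neutral)
qed

lemma braid_Suc_bas [simp]: "braid q (Suc j) (bas (a # u)) = lcons a (braid q j (bas u))"
  by (auto simp: braid_def lcons_def bas_def fun_eq_iff sum_distrib_right if_distrib
      split: list.split intro!: sum.neutral sum.cong)

lemma braid_Suc_Cons: "braid q (Suc j) t (a # w) = braid q j (\<lambda>v. t (a # v)) w"
  by (simp add: braid_def)

lemma braid_tpow: "t \<in> tpow k \<Longrightarrow> braid q j t \<in> tpow k"
  by (auto simp: tpow_def braid_def intro!: sum.neutral)

lemma tpow_eqI:
  assumes "s \<in> tpow (Suc k)" "t \<in> tpow (Suc k)" "\<And>a w. s (a # w) = t (a # w)"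
  shows "s = t"
proof
  fix w
  show "s w = t w"
    using assms by (cases w) (auto simp: tpow_def)
qed

lemma slice_tpow: "t \<in> tpow (Suc k) \<Longrightarrow> (\<lambda>v. t (a # v)) \<in> tpow k"
  by (auto simp: tpow_def)

lemma braid_Suc_slice:
  "(\<lambda>v. braid q (Suc j) t (a # v)) = braid q j (\<lambda>v. t (a # v))"
  by (simp add: braid_Suc_Cons fun_eq_iff)

text \<open>\<open>braid q 0\<close> only forms linear combinations of the slices of t behind the
  first two letters, and the other braiding acts linearly on these slices.\<close>

lemma braid_far_0:
  assumes "t \<in> tpow k" "2 \<le> k"
  shows "braid q 0 (braid q (Suc (Suc j)) t) = braid q (Suc (Suc j)) (braid q 0 t)"
proof
  fix w :: "idx list"
  consider "length w < 2" | c d w' where "w = c # d # w'"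
    by (cases w; cases "tl w") auto
  then show "braid q 0 (braid q (Suc (Suc j)) t) w = braid q (Suc (Suc j)) (braid q 0 t) w"
  proof cases
    case 1
    then have "w \<notin> words k" using assms(2) by auto
    then show ?thesis
      using braid_tpow[OF braid_tpow[OF assms(1)]] unfolding tpow_def mem_Collect_eq by metis
  next
    case 2
    have "braid q 0 (braid q (Suc (Suc j)) t) w =
       braid q j (\<Sum>a\<in>UNIV. \<Sum>b\<in>UNIV. sigma q a b [c, d] *\<^sub>T (\<lambda>v. t (a # b # v))) w'"
      by (simp add: 2 braid_def[of q 0] braid_Suc_Cons mult.commute)
    also have "(\<Sum>a\<in>UNIV. \<Sum>b\<in>UNIV. sigma q a b [c, d] *\<^sub>T (\<lambda>v. t (a # b # v))) =
       (\<lambda>v. braid q 0 t (c # d # v))"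
      by (simp add: fun_eq_iff braid_def mult.commute)
    finally show ?thesis
      by (simp add: 2 braid_Suc_Cons)
  qed
qed

text \<open>All coefficients are Laurent polynomials in \<open>q\<^sup>2\<close>. With separate letters for \<open>q\<^sup>2\<close> and its inverse
  they are normalised by the distributive laws and \<open>P * R = 1\<close>, without clearing denominators.\<close>

locale qparam =
  fixes q :: real and P R :: complex
  assumes q: "0 < q" "q < 1" and P: "of_real (q^2) = P" and R: "of_real (1 / q^2) = R"
begin

lemma PR [simp]: "P * R = 1" "R * P = 1" "P * (R * x) = x" "R * (P * x) = x"
proof -
  have "P * R = of_real (q^2 * (1 / q^2))"
    unfolding P[symmetric] R[symmetric] by (simp only: of_real_mult)
  then show "P * R = 1" using q by simp
  then show "R * P = 1" "P * (R * x) = x" "R * (P * x) = x"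
    by (simp_all add: mult.assoc[symmetric] mult.commute[of R])
qed

lemma coeffs:
  "of_real (1 - q^2) = 1 - P" "of_real (1 + q^2) = 1 + P" "of_real (- (1 + 1 / q^2)) = - (1 + R)"
  "of_real (1 - 1 / q^2) = 1 - R" "of_real (q^2 - 1 / q^2) = P - R"
  "of_real ((q - 1 / q)^2) = P - 2 + R"
proof -
  have "(q - 1 / q)^2 = q^2 - 2 + 1 / q^2"
    using q by (simp add: power2_diff power_divide)
  then show "of_real ((q - 1 / q)^2) = P - 2 + R"
    unfolding P[symmetric] R[symmetric] by (simp only: of_real_add of_real_diff of_real_numeral)
qed (simp_all only: P[symmetric] R[symmetric] of_real_add of_real_diff of_real_minus of_real_1)

lemmas sigma_PR [simp] = sigma.simps[of q, unfolded coeffs P R]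

declare sigma.simps [simp del]

text \<open>Only the three leading letters interact, which leaves 64 identities between polynomials
  in \<open>P\<close> and \<open>R\<close>. Other positions follow by stripping leading
  letters.\<close>

lemma braid_eq_bas:
  "braid q 0 (braid q (Suc 0) (braid q 0 (bas (a # b # c # s)))) =
   braid q (Suc 0) (braid q 0 (braid q (Suc 0) (bas (a # b # c # s))))"
  by (rule ext, cases a; cases b; cases c; simp; simp add: algebra_simps)

lemma braid_eq:
  "Suc (Suc j) < k \<Longrightarrow> t \<in> tpow k \<Longrightarrow>
    braid q j (braid q (Suc j) (braid q j t)) = braid q (Suc j) (braid q j (braid q (Suc j) t))"
proof (induction j arbitrary: k t)
  case 0
  have "braid q 0 (braid q (Suc 0) (braid q 0 (bas w))) =
      braid q (Suc 0) (braid q 0 (braid q (Suc 0) (bas w)))" if w: "length w = k" for w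
  proof -
    obtain a b c s where "w = a # b # c # s"
      using w 0 by (cases w; cases "tl w"; cases "tl (tl w)") auto
    then show ?thesis by (simp only: braid_eq_bas)
  qed
  then show ?case
    using 0(2) by (intro tlinear_eq_on_tpow[of
      "\<lambda>x. braid q 0 (braid q (Suc 0) (braid q 0 x))"
      "\<lambda>x. braid q (Suc 0) (braid q 0 (braid q (Suc 0) x))" k t]) (rule tlinearI; simp)+
next
  case (Suc j)
  obtain k' where k: "k = Suc k'" using Suc.prems by (cases k) auto
  show ?case
    using Suc.prems(2) unfolding k
  proof (rule tpow_eqI[OF braid_tpow[OF braid_tpow[OF braid_tpow]] braid_tpow[OF braid_tpow[OF braid_tpow]]])
    fix a w
    have "(\<lambda>v. t (a # v)) \<in> tpow k'" using Suc.prems k by (auto intro: slice_tpow)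
    then show "braid q (Suc j) (braid q (Suc (Suc j)) (braid q (Suc j) t)) (a # w) =
        braid q (Suc (Suc j)) (braid q (Suc j) (braid q (Suc (Suc j)) t)) (a # w)"
      using Suc.IH[of k'] Suc.prems k by (simp add: braid_Suc_Cons braid_Suc_slice)
  qed (use Suc.prems k in simp)
qed

lemma braid_far:
  "Suc i < j \<Longrightarrow> Suc j < k \<Longrightarrow> t \<in> tpow k \<Longrightarrow>
    braid q i (braid q j t) = braid q j (braid q i t)"
proof (induction i arbitrary: j k t)
  case 0
  then obtain j' where "j = Suc (Suc j')" by (metis less_imp_Suc_add add_Suc)
  then show ?case using 0 by (simp add: braid_far_0)
next
  case (Suc i)
  obtain k' j' where k: "k = Suc k'" "j = Suc j'" using Suc.prems by (cases k; cases j) auto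
  show ?case
    using Suc.prems(3) unfolding k
  proof (rule tpow_eqI[OF braid_tpow[OF braid_tpow] braid_tpow[OF braid_tpow]])
    fix a w
    have "(\<lambda>v. t (a # v)) \<in> tpow k'" using Suc.prems k by (auto intro: slice_tpow)
    then show "braid q (Suc i) (braid q (Suc j') t) (a # w) =
        braid q (Suc j') (braid q (Suc i) t) (a # w)"
      using Suc.IH[of j' k'] Suc.prems k by (simp add: braid_Suc_Cons braid_Suc_slice)
  qed (use Suc.prems k in simp)
qed

section \<open>Antisymmetrisers\<close>

lemma braid_action: "braid_action k (braid q) (tpow k)"
  by unfold_locales (assumption | rule braid_tpow braid_eq braid_far)+

lemma word_braid_act: "braid_action.act (braid q) js = word_braid q js"
  using braid_action.act_def[OF braid_action] by (simp add: word_braid_def)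

lemma word_braid_eq:
  assumes "\<forall>j\<in>set js. Suc j < k" "\<forall>j\<in>set ks. Suc j < k" "t \<in> tpow k"
    and "code_of k js = code_of k ks"
    and "length js = length (code_word (code_of k js))" "length ks = length (code_word (code_of k ks))"
  shows "word_braid q js t = word_braid q ks t"
  using braid_action.act_code_of[OF braid_action, of js k t]
    braid_action.act_code_of[OF braid_action, of ks k t] assms by (simp add: word_braid_act)

text \<open>Removes the choice in \<open>braid_perm\<close>: any word as long as its code may serve
  as the reduced word.\<close>

lemma braid_perm_word_perm:
  assumes "\<forall>j\<in>set ks. Suc j < k" "length ks = length (code_word (code_of k ks))" "t \<in> tpow k"
  shows "braid_perm q k (word_perm ks) t = word_braid q ks t"
proof -
  have "reduced_word k (word_perm ks) ks"
    using assms by (simp add: reduced_word_def perm_word_def perm_length_word_perm)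
  then have *: "reduced_word k (word_perm ks) (SOME js. reduced_word k (word_perm ks) js)"
    by (rule someI)
  show ?thesis
    unfolding braid_perm_def
    using reduced_word_code_of[OF * assms(1)] assms by (intro word_braid_eq) auto
qed

lemma word_braid_simps [simp]:
  "word_braid q [] t = t" "word_braid q (j # js) t = braid q j (word_braid q js t)"
  "word_braid q (js @ ks) t = word_braid q js (word_braid q ks t)"
  by (induction js) (simp_all add: word_braid_def)

lemma tlinear_word_braid: "tlinear (word_braid q js)"
  by (rule tlinearI; induction js) simp_all

lemma word_braid_tpow: "t \<in> tpow k \<Longrightarrow> word_braid q js t \<in> tpow k"
  by (induction js) (simp_all add: braid_tpow)

lemma tlinear_braid_perm: "tlinear (braid_perm q k p)"
  by (simp add: braid_perm_def tlinear_word_braid)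

lemma tlinear_sum: "(\<And>i. i \<in> I \<Longrightarrow> tlinear (f i)) \<Longrightarrow> tlinear (\<lambda>x. \<Sum>i\<in>I. f i x)"
  by (rule tensors.linear_compose_sum) simp

lemma tlinear_asym: "tlinear (asym q k)"
  unfolding asym_def[abs_def]
  by (intro tlinear_sum tensors.linear_compose_scale_right tlinear_braid_perm)

lemma tlinear_asym_reps: "tlinear (asym_reps q j k)"
  unfolding asym_reps_def[abs_def]
  by (intro tlinear_sum tensors.linear_compose_scale_right tlinear_braid_perm)

lemmas asym_linear [simp] = tlinear_simps[OF tlinear_asym]

lemma braid_perm_tpow: "t \<in> tpow k \<Longrightarrow> braid_perm q k p t \<in> tpow k"
  by (simp add: braid_perm_def word_braid_tpow)

lemma asym_tpow: "t \<in> tpow k \<Longrightarrow> asym q k t \<in> tpow k"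
  unfolding asym_def
  by (intro tensor.subspace_sum[OF tpow_subspace] tensor.subspace_scale[OF tpow_subspace] braid_perm_tpow)

lemma code_word_reduced:
  "c \<in> set (codes k) \<Longrightarrow> length (code_word c) = length (code_word (code_of k (code_word c)))"
  by (simp add: code_of_code_word)

lemma sum_codes:
  assumes "C \<subseteq> set (codes k)" "t \<in> tpow k"
  shows "(\<Sum>p\<in>(\<lambda>c. word_perm (code_word c)) ` C. of_int (sign p) *\<^sub>T braid_perm q k p t) =
    (\<Sum>c\<in>C. (- 1) ^ length (code_word c) *\<^sub>T word_braid q (code_word c) t)"
proof -
  have "inj_on (\<lambda>c. word_perm (code_word c)) C"
    using word_perm_code_inj assms(1) by (rule inj_on_subset)
  moreover have "braid_perm q k (word_perm (code_word c)) t = word_braid q (code_word c) t"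
    if "c \<in> C" for c
    using that assms set_code_word[of c k] code_word_reduced[of c k]
    by (intro braid_perm_word_perm) auto
  ultimately show ?thesis
    by (simp add: sum.reindex sign_word_perm)
qed

lemma asym_codes:
  "t \<in> tpow k \<Longrightarrow>
    asym q k t = (\<Sum>c\<in>set (codes k). (- 1) ^ length (code_word c) *\<^sub>T word_braid q (code_word c) t)"
  unfolding asym_def permutes_eq_codes by (rule sum_codes) auto

text \<open>Multiplication of the permutations by a transposition on the right reverses all signs and,
  on tensors fixed by the corresponding braiding, preserves the summands.\<close>

lemma asym_eq_0:
  assumes "t \<in> tpow k" "Suc j < k" "braid q j t = t"
  shows "asym q k t = 0"
proof -
  let ?\<tau> = "transpose j (Suc j)" and ?S = "{p. p permutes {..<k}}"
  have \<tau>: "?\<tau> permutes {..<k}"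
    using assms(2) by (intro permutes_swap_id) auto
  have step: "braid_perm q k (p \<circ> ?\<tau>) t = braid_perm q k p t"
    if p_S: "p \<in> ?S" and le: "perm_length k p \<le> perm_length k (p \<circ> ?\<tau>)" for p
  proof -
    obtain c where c: "c \<in> set (codes k)" "p = word_perm (code_word c)"
      using p_S unfolding permutes_eq_codes by auto
    define ks where "ks = code_word c @ [j]"
    have ks: "\<forall>j\<in>set ks. Suc j < k" "p \<circ> ?\<tau> = word_perm ks"
      using assms(2) set_code_word[OF c(1)] c(2) by (auto simp: ks_def)
    have p: "perm_length k p = length (code_word c)" "perm_length k (p \<circ> ?\<tau>) = length (code_word (code_of k ks))"
      using c ks perm_length_word_perm[OF ks(1)] perm_length_word_perm[of "code_word c" k]
        set_code_word[OF c(1)] by (simp_all add: code_of_code_word)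
    have "word_perm (code_word (code_of k ks)) = word_perm ks"
      using ks by (intro word_perm_code_of)
    \<comment> \<open>Appending a letter reverses the sign, so the length of the product differs in
      parity from that of p. Being at least that length and at most one more, it is one more, and
      \<open>ks\<close> is reduced.\<close>
    then have "(- 1 :: int) ^ length (code_word (code_of k ks)) = (- 1) ^ length ks"
      by (metis sign_word_perm)
    moreover have "length (code_word (code_of k ks)) \<le> length ks"
      using length_code_of[OF ks(1)] .
    ultimately have "length (code_word (code_of k ks)) = length ks"
      using le p by (auto simp: ks_def le_Suc_eq)
    then have "braid_perm q k (p \<circ> ?\<tau>) t = word_braid q ks t"
      using ks assms by (simp add: braid_perm_word_perm)
    also have "\<dots> = braid_perm q k p t"
      using assms c set_code_word[OF c(1)] code_word_reduced[OF c(1)]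
      by (simp add: ks_def braid_perm_word_perm)
    finally show ?thesis .
  qed
  have inv: "p \<circ> ?\<tau> \<circ> ?\<tau> = p" for p :: "nat \<Rightarrow> nat"
    by (simp add: o_assoc[symmetric])
  have S: "p \<circ> ?\<tau> \<in> ?S" if "p \<in> ?S" for p
    using that \<tau> by (auto intro: permutes_compose)
  \<comment> \<open>One of p and p \<circ> ?\<tau> is not longer than the other, and
    \<open>step\<close> applies to that one.\<close>
  have eq: "braid_perm q k (p \<circ> ?\<tau>) t = braid_perm q k p t" if "p \<in> ?S" for p
    using step[OF that] step[OF S[OF that]] by (metis inv le_cases)
  have sgn: "sign (p \<circ> ?\<tau>) = - sign p" if "p \<in> ?S" for p
    using that by (simp add: sign_compose sign_swap_id permutation_swap_id permutes_imp_permutation[of "{..<k}"])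
  have "asym q k t = (\<Sum>p\<in>?S. of_int (sign (p \<circ> ?\<tau>)) *\<^sub>T braid_perm q k (p \<circ> ?\<tau>) t)"
    unfolding asym_def
    by (rule sum.reindex_bij_witness[of _ "\<lambda>p. p \<circ> ?\<tau>" "\<lambda>p. p \<circ> ?\<tau>"]) (use inv S in auto)
  also have "\<dots> = - asym q k t"
    unfolding asym_def sum_negf[symmetric] using eq sgn by (intro sum.cong) auto
  finally show ?thesis
    by (simp add: fun_eq_iff eq_neg_iff_add_eq_0 flip: mult_2)
qed

end

section \<open>The quadratic algebra\<close>

text \<open>The tensor product of the words u and v around a 2-tensor r. When r runs through the
  relations, these tensors span the ideal of the quadratic algebra in each degree.\<close>

definition place :: "idx list \<Rightarrow> idx list \<Rightarrow> tensor \<Rightarrow> tensor" where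
  "place u v r = (\<Sum>a\<in>UNIV. \<Sum>b\<in>UNIV. r [a, b] *\<^sub>T bas (u @ a # b # v))"

lemma tlinear_place: "tlinear (place u v)"
  by (rule tlinearI)
    (simp_all add: place_def tensor.scale_left_distrib sum.distrib tensor.scale_sum_right)

lemmas place_linear [simp] = tlinear_simps[OF tlinear_place]

lemma place_bas [simp]: "place u v (bas [a, b]) = bas (u @ a # b # v)"
proof -
  have "place u v (bas [a, b]) =
      (\<Sum>x\<in>UNIV. \<Sum>y\<in>UNIV. if y = b then if x = a then bas (u @ x # y # v) else 0 else 0)"
    unfolding place_def by (intro sum.cong) (auto simp: bas_def fun_eq_iff)
  then show ?thesis by simp
qed

lemma place_tpow: "place u v r \<in> tpow (length u + 2 + length v)"
  unfolding place_def
  by (intro tensor.subspace_sum[OF tpow_subspace] tensor.subspace_scale[OF tpow_subspace]) simp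

lemma words_2_cases: "length w = 2 \<Longrightarrow> (\<And>a b. w = [a, b] \<Longrightarrow> thesis) \<Longrightarrow> thesis"
  by (metis One_nat_def Suc_1 length_0_conv length_Suc_conv)

lemma rapp_Nil: "s \<in> tpow 2 \<Longrightarrow> rapp s [] = s"
  by (auto simp: rapp_def tpow_def fun_eq_iff)

lemma braid_place:
  assumes "r \<in> tpow 2"
  shows "braid q (length u) (place u v r) = place u v (braid q 0 r)"
proof -
  have 1: "place u v s = foldr lcons u (rapp s v)" if "s \<in> tpow 2" for s
  proof (rule tlinear_eq_on_tpow[where f = "place u v" and g = "\<lambda>s. foldr lcons u (rapp s v)", OF _ _ _ that])
    show "tlinear (\<lambda>s. foldr lcons u (rapp s v))"
      by (rule tlinearI; induction u; simp)
    show "place u v (bas w) = foldr lcons u (rapp (bas w) v)" if "length w = 2" for w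
    proof -
      have "foldr lcons u (bas (x @ y)) = bas (u @ x @ y)" for x y by (induction u) simp_all
      from this[of _ v] show ?thesis using that by (elim words_2_cases) (metis append_Cons append_Nil place_bas rapp_bas)
    qed
  qed (rule tlinear_place)
  show ?thesis
  proof (rule tlinear_eq_on_tpow[where f = "\<lambda>r. braid q (length u) (place u v r)"
        and g = "\<lambda>r. place u v (braid q 0 r)", OF _ _ _ assms])
    fix w :: "idx list" assume "length w = 2"
    then obtain a b where w: "w = [a, b]" by (rule words_2_cases)
    have "braid q (length u) (bas (u @ a # b # v)) = foldr lcons u (rapp (sigma q a b) v)"
      by (induction u) (simp_all add: tlinear_simps)
    then show "braid q (length u) (place u v (bas w)) = place u v (braid q 0 (bas w))"
      using 1[OF sigma_tpow] rapp_Nil[OF sigma_tpow] by (simp add: w)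
  qed (rule tlinearI; simp)+
qed

text \<open>The maps that factor through the quadratic algebra, in degree \<open>k\<close>.\<close>

definition ext_map :: "real \<Rightarrow> nat \<Rightarrow> (tensor \<Rightarrow> tensor) \<Rightarrow> bool" where
  "ext_map q k f \<longleftrightarrow> tlinear f \<and>
    (\<forall>u v r. length u + 2 + length v = k \<longrightarrow> r \<in> tpow 2 \<longrightarrow> braid q 0 r = r \<longrightarrow> f (place u v r) = 0)"

fun rank :: "idx \<Rightarrow> nat" where
  "rank Om = 0" | "rank Op = 1" | "rank O0 = 2" | "rank Oz = 3"

text \<open>The word read as a number in base 4, so that among words of equal length smaller means
  lexicographically smaller. It is the termination measure of straightening.\<close>

fun word_rank :: "idx list \<Rightarrow> nat" where
  "word_rank [] = 0"
| "word_rank (a # w) = 4 ^ length w * rank a + word_rank w"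

lemma word_rank_append_less:
  "length x = length y \<Longrightarrow> word_rank x < word_rank y \<Longrightarrow> word_rank (u @ x) < word_rank (u @ y)"
  by (induction u) simp_all

definition monomials :: "nat \<Rightarrow> idx list set" where
  "monomials k = {w. length w = k \<and> sorted_wrt (\<lambda>a b. rank a < rank b) w}"

lemma finite_monomials [simp]: "finite (monomials k)"
  by (rule finite_subset[OF _ finite_words[of k]]) (auto simp: monomials_def)

fun bar :: "idx \<Rightarrow> idx" where
  "bar Om = Op" | "bar Op = Om" | "bar O0 = O0" | "bar Oz = Oz"

lemma bar_bar [simp]: "bar (bar a) = a"
  by (cases a) simp_all

definition mirror :: "tensor \<Rightarrow> tensor" where
  "mirror t = (\<lambda>w. t (rev (map bar w)))"

definition conj_coeffs :: "tensor \<Rightarrow> tensor" where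
  "conj_coeffs t = (\<lambda>w. cnj (t w))"

lemma tlinear_mirror: "tlinear mirror"
  by (rule tlinearI) (simp_all add: mirror_def fun_eq_iff)

lemmas mirror_linear [simp] = tlinear_simps[OF tlinear_mirror]

lemma mirror_bas [simp]: "mirror (bas w) = bas (rev (map bar w))"
proof -
  have "rev (map bar v) = w \<longleftrightarrow> v = rev (map bar w)" for v
    by (auto simp: rev_map comp_def)
  then show ?thesis by (simp add: mirror_def bas_def)
qed

lemma mirror_tpow: "t \<in> tpow k \<Longrightarrow> mirror t \<in> tpow k"
  by (simp add: tpow_def mirror_def)

lemma conj_coeffs_tpow: "t \<in> tpow k \<Longrightarrow> conj_coeffs t \<in> tpow k"
  by (simp add: tpow_def conj_coeffs_def)

lemma conj_coeffs_simps [simp]: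
  "conj_coeffs (x + y) = conj_coeffs x + conj_coeffs y" "conj_coeffs 0 = 0"
  "conj_coeffs (- x) = - conj_coeffs x" "conj_coeffs (x - y) = conj_coeffs x - conj_coeffs y"
  "conj_coeffs (c *\<^sub>T x) = cnj c *\<^sub>T conj_coeffs x" "conj_coeffs (bas w) = bas w"
  "conj_coeffs (conj_coeffs x) = x" "conj_coeffs (sum t I) = (\<Sum>i\<in>I. conj_coeffs (t i))"
  by (simp_all add: conj_coeffs_def bas_def fun_eq_iff)

lemma star_bar: "star a = - bas [bar a]"
  by (cases a) simp_all

text \<open>The k stars contribute the extra sign (-1)^k. What remains is conjugation of the
  coefficients followed by the linear \<open>mirror\<close>, and each of these is matched with the
  relations separately.\<close>

lemma dagger_eq:
  assumes "x \<in> tpow k"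
  shows "dagger k x = (- 1) ^ (k * (k - 1) div 2 + k) *\<^sub>T mirror (conj_coeffs x)"
proof
  fix w
  show "dagger k x w = ((- 1) ^ (k * (k - 1) div 2 + k) *\<^sub>T mirror (conj_coeffs x)) w"
  proof (cases "length w = k")
    case True
    have "(\<Prod>i<k. star (u ! (k - 1 - i)) [w ! i]) = (if u = rev (map bar w) then (- 1) ^ k else 0)"
      if "length u = k" for u
    proof (cases "u = rev (map bar w)")
      case u: True
      have "star (u ! (k - 1 - i)) [w ! i] = - 1" if "i < k" for i
        using that True by (simp add: u rev_nth star_bar bas_def)
      then show ?thesis using u by simp
    next
      case False
      \<comment> \<open>The words differ at i. The factor comparing these letters has index k - 1 -
        i, because the stars are taken in reverse order.\<close>
      then obtain i where i: "i < k" "u ! i \<noteq> rev (map bar w) ! i"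
        using True \<open>length u = k\<close> by (metis length_map length_rev nth_equalityI)
      then have "star (u ! (k - 1 - (k - 1 - i))) [w ! (k - 1 - i)] = 0"
        using True by (auto simp: rev_nth star_bar bas_def)
      moreover have "k - 1 - i \<in> {..<k}" using i by auto
      ultimately have "(\<Prod>i<k. star (u ! (k - 1 - i)) [w ! i]) = 0"
        by (metis (no_types, lifting) finite_lessThan prod_zero)
      then show ?thesis using False by simp
    qed
    then have "(\<Sum>u\<in>words k. cnj (x u) * (\<Prod>i<k. star (u ! (k - 1 - i)) [w ! i])) =
        (\<Sum>u\<in>words k. if u = rev (map bar w) then cnj (x u) * (- 1) ^ k else 0)"
      by (intro sum.cong) auto
    then show ?thesis
      using True by (simp add: dagger_def mirror_def conj_coeffs_def power_add)
  next
    case False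
    then show ?thesis
      using assms by (auto simp: dagger_def mirror_def conj_coeffs_def tpow_def)
  qed
qed

context qparam
begin

lemma ext_map_linear: "ext_map q k f \<Longrightarrow> tlinear f"
  by (simp add: ext_map_def)

lemma ext_map_asym: "ext_map q k (asym q k)"
  unfolding ext_map_def
proof (intro conjI allI impI)
  fix u v :: "idx list" and r assume *: "length u + 2 + length v = k" "r \<in> tpow 2" "braid q 0 r = r"
  show "asym q k (place u v r) = 0"
    using * place_tpow[of u v r] braid_place[OF *(2), of q u v]
    by (intro asym_eq_0[of _ _ "length u"]) auto
qed (rule tlinear_asym)

text \<open>For each of the ten pairs that do not increase, one vector of ker (1 - \<sigma>) with
  that leading word, solved for the word. The empty list is a vanishing product, as for the squares
  of \<open>Om\<close>, \<open>Op\<close> and \<open>O0\<close>; the square of \<open>Oz\<close>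
  does not vanish. Increasing pairs also get the empty list, but are excluded wherever the function
  is applied.\<close>

fun straighten :: "idx \<Rightarrow> idx \<Rightarrow> (complex \<times> idx \<times> idx) list" where
  "straighten Op Om = [(- 1, Om, Op)]"
| "straighten O0 Om = [(- 1, Om, O0)]"
| "straighten O0 Op = [(- 1, Op, O0)]"
| "straighten Oz Om = [(- R, Om, Oz)]"
| "straighten Oz Op = [(- P, Op, Oz)]"
| "straighten Oz O0 = [(P - 2 + R, Om, Op), (- 1, O0, Oz)]"
| "straighten Oz Oz = [(R - P, Om, Op)]"
| "straighten _ _ = []"

lemma straighten_relation:
  assumes "\<not> rank a < rank b" "r = bas [a, b] - (\<Sum>(c, a', b')\<leftarrow>straighten a b. c *\<^sub>T bas [a', b'])"
  shows "r \<in> tpow 2" "braid q 0 r = r"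
proof -
  show "r \<in> tpow 2"
    using assms tensor.subspace_diff[OF tpow_subspace] tensor.subspace_add[OF tpow_subspace]
      tensor.subspace_scale[OF tpow_subspace] tensor.subspace_0[OF tpow_subspace]
      tensor.subspace_neg[OF tpow_subspace]
    by (cases a; cases b) simp_all
  show "braid q 0 r = r"
    using assms by (cases a; cases b; simp; simp add: fun_eq_iff algebra_simps)
qed

lemma ext_map_straighten:
  assumes "ext_map q k f" "\<not> rank a < rank b" "length u + 2 + length v = k"
  shows "f (bas (u @ a # b # v)) = (\<Sum>(c, a', b')\<leftarrow>straighten a b. c *\<^sub>T f (bas (u @ a' # b' # v)))"
proof -
  have lin: "tlinear f" using assms(1) by (simp add: ext_map_def)
  define r where "r = bas [a, b] - (\<Sum>(c, a', b')\<leftarrow>straighten a b. c *\<^sub>T bas [a', b'])"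
  have "f (place u v r) = 0"
    using straighten_relation[OF assms(2) r_def] assms by (auto simp: ext_map_def)
  moreover have "f (place u v (\<Sum>(c, a', b')\<leftarrow>xs. c *\<^sub>T bas [a', b'])) =
      (\<Sum>(c, a', b')\<leftarrow>xs. c *\<^sub>T f (bas (u @ a' # b' # v)))" for xs
    by (induction xs)
      (simp_all only: list.map sum_list.Nil sum_list.Cons split_beta place_linear place_bas tlinear_simps[OF lin])
  ultimately show ?thesis
    by (simp add: r_def tlinear_simps[OF lin])
qed

lemma straighten_rank:
  "\<not> rank a < rank b \<Longrightarrow> (c, a', b') \<in> set (straighten a b) \<Longrightarrow> 4 * rank a' + rank b' < 4 * rank a + rank b"
  by (cases a; cases b) auto

text \<open>Congruence of t to a combination of increasing words modulo the relations, without
  forming the quotient: the coefficients are chosen before f and serve all maps that respect the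
  relations.\<close>

definition spanned :: "nat \<Rightarrow> tensor \<Rightarrow> bool" where
  "spanned k t \<longleftrightarrow> (\<exists>c. \<forall>f. ext_map q k f \<longrightarrow> f t = (\<Sum>S\<in>monomials k. c S *\<^sub>T f (bas S)))"

lemma spanned_subspace: "tensor.subspace {t. spanned k t}"
proof (rule tensor.subspaceI)
  have "f 0 = (\<Sum>S\<in>monomials k. 0 *\<^sub>T f (bas S))" if "ext_map q k f" for f
    using tlinear_simps(5)[OF ext_map_linear[OF that]] by simp
  then show "0 \<in> {t. spanned k t}"
    unfolding spanned_def mem_Collect_eq by (intro exI[of _ "\<lambda>_. 0"] allI impI)
next
  fix x y assume "x \<in> {t. spanned k t}" "y \<in> {t. spanned k t}"
  then obtain c d where cd: "\<forall>f. ext_map q k f \<longrightarrow> f x = (\<Sum>S\<in>monomials k. c S *\<^sub>T f (bas S))"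
    "\<forall>f. ext_map q k f \<longrightarrow> f y = (\<Sum>S\<in>monomials k. d S *\<^sub>T f (bas S))"
    unfolding spanned_def mem_Collect_eq by (elim exE)
  have "f (x + y) = (\<Sum>S\<in>monomials k. (c S + d S) *\<^sub>T f (bas S))" if "ext_map q k f" for f
    by (simp add: cd[rule_format, OF that] tlinear_simps[OF ext_map_linear[OF that]] tensor.scale_left_distrib sum.distrib)
  then show "x + y \<in> {t. spanned k t}"
    unfolding spanned_def mem_Collect_eq by (intro exI[of _ "\<lambda>S. c S + d S"] allI impI)
next
  fix x b assume "x \<in> {t. spanned k t}"
  then obtain c where c: "\<forall>f. ext_map q k f \<longrightarrow> f x = (\<Sum>S\<in>monomials k. c S *\<^sub>T f (bas S))"
    unfolding spanned_def mem_Collect_eq by (elim exE)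
  have "f (b *\<^sub>T x) = (\<Sum>S\<in>monomials k. (b * c S) *\<^sub>T f (bas S))" if "ext_map q k f" for f
    by (simp add: c[rule_format, OF that] tlinear_simps[OF ext_map_linear[OF that]] tensor.scale_sum_right)
  then show "b *\<^sub>T x \<in> {t. spanned k t}"
    unfolding spanned_def mem_Collect_eq by (intro exI[of _ "\<lambda>S. b * c S"] allI impI)
qed

text \<open>Induction on the base 4 value: straightening an adjacent pair that does not increase
  yields only words of smaller value.\<close>

lemma spanned_bas: "length w = k \<Longrightarrow> spanned k (bas w)"
proof (induction "word_rank w" arbitrary: w rule: less_induct)
  case less
  show ?case
  proof (cases "sorted_wrt (\<lambda>a b. rank a < rank b) w")
    case True
    then have "w \<in> monomials k" using less.prems by (simp add: monomials_def)
    then have "(\<Sum>S\<in>monomials k. (if S = w then 1 else 0) *\<^sub>T f (bas S)) = f (bas w)" for f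
      by (subst sum.remove[of _ w]) simp_all
    then show ?thesis
      unfolding spanned_def by (intro exI[of _ "\<lambda>S. if S = w then 1 else 0"]) metis
  next
    case False
    then obtain i where i: "Suc i < length w" "\<not> rank (w ! i) < rank (w ! Suc i)"
      by (auto simp: sorted_wrt_iff_nth_Suc_transp transp_def)
    define u v a b where uv: "u = take i w" "v = drop (Suc (Suc i)) w" "a = w ! i" "b = w ! Suc i"
    have w: "w = u @ a # b # v"
      using i(1) by (simp add: uv Cons_nth_drop_Suc)
    have ab: "\<not> rank a < rank b" using i by (simp add: uv)
    \<comment> \<open>Stated for every list with entries from \<open>straighten a b\<close>, so that
      the list induction keeps the bound on the ranks.\<close>
    have "spanned k (\<Sum>(c, a', b')\<leftarrow>xs. c *\<^sub>T bas (u @ a' # b' # v))"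
      if "set xs \<subseteq> set (straighten a b)" for xs
      using that
    proof (induction xs)
      case Nil
      then show ?case using tensor.subspace_0[OF spanned_subspace]
        by (simp only: list.map sum_list.Nil mem_Collect_eq)
    next
      case (Cons x xs)
      obtain c a' b' where x: "x = (c, a', b')" by (cases x)
      have "(4 * rank a' + rank b') * 4 ^ length v < (4 * rank a + rank b) * 4 ^ length v"
        using straighten_rank[OF ab, of c a' b'] Cons.prems x by simp
      then have "word_rank (a' # b' # v) < word_rank (a # b # v)"
        by (simp add: algebra_simps)
      then have "spanned k (bas (u @ a' # b' # v))"
        using less.prems unfolding w by (intro less.hyps) (simp_all add: w word_rank_append_less)
      moreover have "spanned k (\<Sum>(c, a', b')\<leftarrow>xs. c *\<^sub>T bas (u @ a' # b' # v))"
        using Cons.IH Cons.prems by (meson order_trans set_subset_Cons)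
      ultimately show ?case
        using tensor.subspace_add[OF spanned_subspace] tensor.subspace_scale[OF spanned_subspace]
        by (simp only: x list.map sum_list.Cons prod.case mem_Collect_eq)
    qed
    then have "spanned k (\<Sum>(c, a', b')\<leftarrow>straighten a b. c *\<^sub>T bas (u @ a' # b' # v))"
      by simp
    moreover have "f (bas w) = f (\<Sum>(c, a', b')\<leftarrow>straighten a b. c *\<^sub>T bas (u @ a' # b' # v))"
      if "ext_map q k f" for f
    proof -
      have "f (\<Sum>(c, a', b')\<leftarrow>xs. c *\<^sub>T bas (u @ a' # b' # v)) =
          (\<Sum>(c, a', b')\<leftarrow>xs. c *\<^sub>T f (bas (u @ a' # b' # v)))" for xs
        by (induction xs) (simp_all only: list.map sum_list.Nil sum_list.Cons split_beta
          tlinear_simps[OF ext_map_linear[OF that]])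
      then show ?thesis
        using ext_map_straighten[OF that ab, of u v] less.prems by (simp add: w)
    qed
    ultimately show ?thesis
      by (simp add: spanned_def)
  qed
qed

lemma spanned_tpow: "t \<in> tpow k \<Longrightarrow> spanned k t"
  using tensor.subspace_sum[OF spanned_subspace, of "words k" "\<lambda>u. t u *\<^sub>T bas u" k]
    tensor.subspace_scale[OF spanned_subspace] spanned_bas tpow_expand[of t k]
  by (metis in_words mem_Collect_eq)

lemma braid_conj_coeffs:
  assumes "r \<in> tpow 2"
  shows "braid q 0 (conj_coeffs r) = conj_coeffs (braid q 0 r)"
proof -
  have "cnj (sigma q a b w) = sigma q a b w" for a b w
    using P R by (cases a; cases b) (auto simp: bas_def P[symmetric] R[symmetric])
  then show ?thesis
    by (simp add: braid_def conj_coeffs_def fun_eq_iff)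
qed

lemma ext_map_conj:
  assumes "ext_map q k f"
  shows "ext_map q k (\<lambda>x. conj_coeffs (f (conj_coeffs x)))"
proof -
  have "conj_coeffs (place u v r) = place u v (conj_coeffs r)" for u v r
    by (simp add: place_def) (simp add: conj_coeffs_def)
  moreover have "tlinear (\<lambda>x. conj_coeffs (f (conj_coeffs x)))"
    by (rule tlinearI) (simp_all add: tlinear_simps[OF ext_map_linear[OF assms]])
  ultimately show ?thesis
    using assms by (simp add: ext_map_def braid_conj_coeffs conj_coeffs_tpow)
qed

text \<open>Conjugating \<sigma> with \<open>mirror\<close> gives its inverse, as the sixteen basis
  pairs show, and an operator has the same fixed vectors as its inverse.\<close>

lemma braid_mirror:
  assumes "r \<in> tpow 2" "braid q 0 r = r"
  shows "braid q 0 (mirror r) = mirror r"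
proof -
  have "braid q 0 (mirror (braid q 0 (bas w))) = mirror (bas w)" if "length w = 2" for w
  proof -
    from that obtain a b where "w = [a, b]" by (rule words_2_cases)
    then show ?thesis
      by (cases a; cases b; simp; simp add: fun_eq_iff algebra_simps)
  qed
  then have "braid q 0 (mirror (braid q 0 r)) = mirror r"
    using assms(1) by (intro tlinear_eq_on_tpow[of "\<lambda>r. braid q 0 (mirror (braid q 0 r))"
      "\<lambda>r. mirror r" 2 r]) (rule tlinearI; simp)+
  then show ?thesis by (simp add: assms(2))
qed

lemma ext_map_mirror:
  assumes "ext_map q k f"
  shows "ext_map q k (\<lambda>x. f (mirror x))"
proof -
  have "mirror (place u v r) = place (rev (map bar v)) (rev (map bar u)) (mirror r)" for u v r
    by (simp add: place_def sum_idx) (simp add: mirror_def)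
  moreover have "tlinear (\<lambda>x. f (mirror x))"
    by (rule tlinearI) (simp_all add: tlinear_simps[OF ext_map_linear[OF assms]])
  ultimately show ?thesis
    using assms by (simp add: ext_map_def braid_mirror mirror_tpow)
qed

end

section \<open>Explicit antisymmetrisers\<close>

lemma distinct_codes: "distinct (codes n)"
proof (rule card_distinct)
  have "length (codes n) = fact n"
    by (induction n) (simp_all add: codes.simps(2) length_concat comp_def sum_list_triv del: upt_Suc)
  then show "card (set (codes n)) = length (codes n)"
    by (simp add: card_codes)
qed

text \<open>Executable counterpart of \<open>coset_reps\<close>: permutations become codes and the
  Young subgroup becomes a filtered list of codes, so that the representatives can be
  computed.\<close>

definition rep_codes :: "nat \<Rightarrow> nat \<Rightarrow> nat list list" where
  "rep_codes k n = filter (\<lambda>c. \<forall>d\<in>set (codes n). (\<forall>x\<in>set [0..<k]. word_perm (code_word d) x < k) \<longrightarrow>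
     length (code_word c) \<le> length (code_word (code_of n (code_word d @ code_word c)))) (codes n)"

lemma young_codes:
  assumes "k \<le> n"
  shows "young k n = (\<lambda>d. word_perm (code_word d)) `
    {d \<in> set (codes n). \<forall>x\<in>set [0..<k]. word_perm (code_word d) x < k}"
proof -
  have "h ` {..<k} = {..<k} \<longleftrightarrow> (\<forall>x\<in>set [0..<k]. h x < k)" if "h permutes {..<n}" for h
  proof
    assume "\<forall>x\<in>set [0..<k]. h x < k"
    then have "h ` {..<k} \<subseteq> {..<k}" by auto
    then show "h ` {..<k} = {..<k}"
      using permutes_inj_on[OF that] by (intro endo_inj_surj) auto
  qed auto
  then have "young k n = {h \<in> {p. p permutes {..<n}}. \<forall>x\<in>set [0..<k]. h x < k}"
    by (auto simp: young_def)
  then show ?thesis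
    unfolding permutes_eq_codes by auto
qed

lemma coset_reps_codes:
  assumes "k \<le> n"
  shows "coset_reps k n = (\<lambda>c. word_perm (code_word c)) ` set (rep_codes k n)"
proof -
  have len: "perm_length n (word_perm (code_word d) \<circ> word_perm (code_word c)) =
      length (code_word (code_of n (code_word d @ code_word c)))"
    if "c \<in> set (codes n)" "d \<in> set (codes n)" for c d
    using that perm_length_word_perm[of "code_word d @ code_word c" n] set_code_word by auto
  have len1: "perm_length n (word_perm (code_word c)) = length (code_word c)"
    if "c \<in> set (codes n)" for c
    using that perm_length_word_perm[of "code_word c" n] set_code_word[OF that] by (simp add: code_of_code_word)
  have "coset_reps k n = {p \<in> {p. p permutes {..<n}}. \<forall>h\<in>young k n. perm_length n p \<le> perm_length n (h \<circ> p)}"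
    by (auto simp: coset_reps_def)
  also have "\<dots> = (\<lambda>c. word_perm (code_word c)) ` set (rep_codes k n)"
    unfolding permutes_eq_codes young_codes[OF assms] rep_codes_def
    using len len1 by (auto 0 3 simp del: word_perm_simps)
  finally show ?thesis .
qed

lemma code_words:
  "map code_word (codes 0) = [[]]"
  "map code_word (codes 1) = [[]]"
  "map code_word (codes 2) = [[0], []]"
  "map code_word (codes 3) = [[0, 1, 0], [0, 1], [1, 0], [1], [0], []]"
  "map code_word (codes 4) = [[0, 1, 2, 0, 1, 0], [0, 1, 2, 0, 1], [0, 1, 2, 1, 0], [0, 1, 2, 1], [0, 1, 2, 0], [0, 1,
     2], [1, 2, 0, 1, 0], [1, 2, 0, 1], [1, 2, 1, 0], [1, 2, 1], [1, 2, 0], [1, 2], [2, 0, 1, 0], [2, 0, 1], [2, 1, 0],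
     [2, 1], [2, 0], [2], [0, 1, 0], [0, 1], [1, 0], [1], [0], []]"
  by code_simp+

lemma rep_words:
  "map code_word (rep_codes 0 4) = [[]]"
  "map code_word (rep_codes 1 4) = [[0, 1, 2], [0, 1], [0], []]"
  "map code_word (rep_codes 2 4) = [[1, 2, 0, 1], [1, 2, 0], [1, 2], [1, 0], [1], []]"
  "map code_word (rep_codes 3 4) = [[2, 1, 0], [2, 1], [2], []]"
  "map code_word (rep_codes 4 4) = [[]]"
  by code_simp+

context qparam
begin

lemma asym_list:
  assumes "t \<in> tpow k"
  shows "asym q k t = (\<Sum>js\<leftarrow>map code_word (codes k). (- 1) ^ length js *\<^sub>T word_braid q js t)"
  using asym_codes[OF assms] sum.distinct_set_conv_list[OF distinct_codes, of _ k]
  by (simp add: comp_def)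

lemma asym_reps_list:
  assumes "k \<le> n" "t \<in> tpow n"
  shows "asym_reps q k n t =
    (\<Sum>js\<leftarrow>map code_word (rep_codes k n). (- 1) ^ length js *\<^sub>T word_braid q js t)"
proof -
  have "distinct (rep_codes k n)" "set (rep_codes k n) \<subseteq> set (codes n)"
    using distinct_codes by (auto simp: rep_codes_def)
  then show ?thesis
    unfolding asym_reps_def coset_reps_codes[OF assms(1)]
    using assms(2) by (simp add: sum_codes sum.distinct_set_conv_list comp_def)
qed

end

lemma length_Suc_words: "length w = Suc k \<longleftrightarrow> (\<exists>a v. w = a # v \<and> length v = k)"
  by (cases w) auto

lemma idx_ex: "(\<exists>a. Q a) \<longleftrightarrow> Q Om \<or> Q Op \<or> Q O0 \<or> Q Oz"
  by (metis idx.exhaust)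

lemma monomials_eq:
  "monomials 0 = {[]}"
  "monomials 1 = {[Om], [Op], [O0], [Oz]}"
  "monomials 2 = {[Om, Op], [Om, O0], [Om, Oz], [Op, O0], [Op, Oz], [O0, Oz]}"
  "monomials 3 = {[Om, Op, O0], [Om, Op, Oz], [Om, O0, Oz], [Op, O0, Oz]}"
  "monomials 4 = {[Om, Op, O0, Oz]}"
  unfolding monomials_def
  by (simp_all add: set_eq_iff numeral_eq_Suc length_Suc_words ex_simps[symmetric] del: ex_simps)
    (simp_all add: idx_ex conj_disj_distribL conj_disj_distribR cong: conj_cong)

lemma bas_apply: "bas u w = (if w = u then 1 else 0)"
  by (simp add: bas_def)

context qparam
begin

lemma asym_2: "t \<in> tpow 2 \<Longrightarrow> asym q 2 t = t - braid q 0 t"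
  by (simp add: asym_list code_words)

lemma asym_monomials_2:
  "asym q 2 (bas [Om, Op]) = bas [Om, Op] - bas [Op, Om] + bas [Oz, O0]"
  "asym q 2 (bas [Om, O0]) = (P) *\<^sub>T bas [Om, O0] - bas [O0, Om]"
  "asym q 2 (bas [Om, Oz]) = (- P - 1) *\<^sub>T bas [Om, O0] + bas [Om, Oz] - bas [Oz, Om]"
  "asym q 2 (bas [Op, O0]) = (R) *\<^sub>T bas [Op, O0] - bas [O0, Op]"
  "asym q 2 (bas [Op, Oz]) = (1 + R) *\<^sub>T bas [Op, O0] + bas [Op, Oz] - bas [Oz, Op]"
  "asym q 2 (bas [O0, Oz]) = bas [O0, Oz] - bas [Oz, O0]"
  by (subst asym_list, simp, simp only: code_words, rule ext, (simp add: numeral_2_eq_2; simp add: algebra_simps))+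

lemma asym_monomials_3:
  "asym q 3 (bas [Om, Op, O0]) = bas [Om, Op, O0] + (- P) *\<^sub>T bas [Om, O0, Op] - bas [Op, Om, O0] + (R) *\<^sub>T
     bas [Op, O0, Om] + bas [O0, Om, Op] - bas [O0, Op, Om] + bas [O0, Oz, O0]"
  "asym q 3 (bas [Om, Op, Oz]) = bas [Om, Op, Oz] + (P + 1) *\<^sub>T bas [Om, O0, Op] - bas [Om, Oz, Op] - bas [Op, Om,
     Oz] + (1 + R) *\<^sub>T bas [Op, O0, Om] + bas [Op, Oz, Om] + bas [Oz, Om, Op] - bas [Oz, Op, Om] + bas [Oz, O0,
     Oz]"
  "asym q 3 (bas [Om, O0, Oz]) = (P) *\<^sub>T bas [Om, O0, Oz] + (- P) *\<^sub>T bas [Om, Oz, O0] + (P + 1) *\<^sub>T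
     bas [O0, Om, O0] - bas [O0, Om, Oz] + bas [O0, Oz, Om] + (P) *\<^sub>T bas [Oz, Om, O0] - bas [Oz, O0, Om]"
  "asym q 3 (bas [Op, O0, Oz]) = (R) *\<^sub>T bas [Op, O0, Oz] + (- R) *\<^sub>T bas [Op, Oz, O0] + (- 1 - R) *\<^sub>T
     bas [O0, Op, O0] - bas [O0, Op, Oz] + bas [O0, Oz, Op] + (R) *\<^sub>T bas [Oz, Op, O0] - bas [Oz, O0, Op]"
  by (subst asym_list, simp, simp only: code_words, rule ext, (simp add: numeral_2_eq_2; simp add: algebra_simps))+

lemma asym_monomials_4:
  "asym q 4 (bas [Om, Op, O0, Oz]) = bas [Om, Op, O0, Oz] - bas [Om, Op, Oz, O0] + (- P - 1) *\<^sub>T bas [Om, O0, Op,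
     O0] + (- P) *\<^sub>T bas [Om, O0, Op, Oz] + (P) *\<^sub>T bas [Om, O0, Oz, Op] + bas [Om, Oz, Op, O0] + (- P)
     *\<^sub>T bas [Om, Oz, O0, Op] - bas [Op, Om, O0, Oz] + bas [Op, Om, Oz, O0] + (- 1 - R) *\<^sub>T bas [Op, O0, Om,
     O0] + (R) *\<^sub>T bas [Op, O0, Om, Oz] + (- R) *\<^sub>T bas [Op, O0, Oz, Om] - bas [Op, Oz, Om, O0] + (R)
     *\<^sub>T bas [Op, Oz, O0, Om] + bas [O0, Om, Op, Oz] + (P + 1) *\<^sub>T bas [O0, Om, O0, Op] - bas [O0, Om, Oz,
     Op] - bas [O0, Op, Om, Oz] + (1 + R) *\<^sub>T bas [O0, Op, O0, Om] + bas [O0, Op, Oz, Om] + bas [O0, Oz, Om, Op] -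
     bas [O0, Oz, Op, Om] + bas [O0, Oz, O0, Oz] - bas [Oz, Om, Op, O0] + (P) *\<^sub>T bas [Oz, Om, O0, Op] + bas [Oz,
     Op, Om, O0] + (- R) *\<^sub>T bas [Oz, Op, O0, Om] - bas [Oz, O0, Om, Op] + bas [Oz, O0, Op, Om] - bas [Oz, O0, Oz,
     O0]"
  by (subst asym_list, simp, simp only: code_words, rule ext, (simp add: numeral_2_eq_2; simp add: algebra_simps))+

lemmas straighten_simps = ext_map_straighten[where u = "[]", simplified append_Nil]
  ext_map_straighten[where u = "[c]" for c, simplified append_Cons append_Nil]
  ext_map_straighten[where u = "[c, d]" for c d, simplified append_Cons append_Nil]

text \<open>Straightening the expansions gives the matrix of 1 - \<sigma> on the six increasing
  words. It leaves three pairs invariant, and \<open>[Om, O0]\<close> and \<open>[Op, O0]\<close>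
  give eigenvectors.\<close>

lemma ext_map_asym_monomials_2:
  assumes "ext_map q 2 f"
  shows
  "f (asym q 2 (bas [Om, Op])) = (P + R) *\<^sub>T f (bas [Om, Op]) - f (bas [O0, Oz])"
  "f (asym q 2 (bas [Om, O0])) = (P + 1) *\<^sub>T f (bas [Om, O0])"
  "f (asym q 2 (bas [Om, Oz])) = (- P - 1) *\<^sub>T f (bas [Om, O0]) + (1 + R) *\<^sub>T f (bas [Om, Oz])"
  "f (asym q 2 (bas [Op, O0])) = (1 + R) *\<^sub>T f (bas [Op, O0])"
  "f (asym q 2 (bas [Op, Oz])) = (1 + R) *\<^sub>T f (bas [Op, O0]) + (P + 1) *\<^sub>T f (bas [Op, Oz])"
  "f (asym q 2 (bas [O0, Oz])) = (- P + 2 - R) *\<^sub>T f (bas [Om, Op]) + (2) *\<^sub>T f (bas [O0, Oz])"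
  unfolding asym_monomials_2
  by (rule ext, simp add: straighten_simps[OF assms] tlinear_simps[OF ext_map_linear[OF assms]], simp add: algebra_simps)+

text \<open>All four increasing words receive the same factor, so the antisymmetriser is scalar on
  3-forms. At q = 1 the factor would be 3!, and that of degree 4 would be 4!.\<close>

lemma ext_map_asym_monomials_3:
  assumes "ext_map q 3 f"
  shows
  "f (asym q 3 (bas [Om, Op, O0])) = (2 * P + 2 + 2 * R) *\<^sub>T f (bas [Om, Op, O0])"
  "f (asym q 3 (bas [Om, Op, Oz])) = (2 * P + 2 + 2 * R) *\<^sub>T f (bas [Om, Op, Oz])"
  "f (asym q 3 (bas [Om, O0, Oz])) = (2 * P + 2 + 2 * R) *\<^sub>T f (bas [Om, O0, Oz])"
  "f (asym q 3 (bas [Op, O0, Oz])) = (2 * P + 2 + 2 * R) *\<^sub>T f (bas [Op, O0, Oz])"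
  unfolding asym_monomials_3
  by (rule ext, simp add: straighten_simps[OF assms] tlinear_simps[OF ext_map_linear[OF assms]], simp add: algebra_simps)+

lemma ext_map_asym_monomials_4:
  assumes "ext_map q 4 f"
  shows
  "f (asym q 4 (bas [Om, Op, O0, Oz])) = (2 * P * P + 6 * P + 8 + 6 * R + 2 * R * R) *\<^sub>T f (bas [Om, Op, O0, Oz])"
  unfolding asym_monomials_4
  by (rule ext, simp add: straighten_simps[OF assms] tlinear_simps[OF ext_map_linear[OF assms]], simp add: algebra_simps)+

lemma asym_reps_theta:
  "asym_reps q 0 4 (bas [Om, Op, O0, Oz]) = bas [Om, Op, O0, Oz]"
  "asym_reps q 1 4 (bas [Om, Op, O0, Oz]) = bas [Om, Op, O0, Oz] + (- P - 1) *\<^sub>T bas [Om, O0, Op, O0] + (- P + 1)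
     *\<^sub>T bas [Om, O0, Op, Oz] + (1 + R) *\<^sub>T bas [Op, Om, O0, O0] + (- R) *\<^sub>T bas [Op, Om, O0, Oz] +
     bas [O0, Om, Op, Oz] - bas [Oz, Om, Op, O0] + (- 1 - R) *\<^sub>T bas [Oz, O0, O0, O0] + (R) *\<^sub>T bas [Oz, O0,
     O0, Oz]"
  "asym_reps q 2 4 (bas [Om, Op, O0, Oz]) = (- R - R * R) *\<^sub>T bas [Om, Op, O0, O0] + (R) *\<^sub>T bas [Om, Op,
     O0, Oz] - bas [Om, O0, Op, Oz] + bas [Om, Oz, Op, O0] + (- P + 1) *\<^sub>T bas [Om, Oz, O0, Op] + (- 1 - R)
     *\<^sub>T bas [Op, Om, O0, O0] + (- P + 1) *\<^sub>T bas [Op, Om, O0, Oz] + bas [Op, O0, Om, Oz] + (- R) *\<^sub>T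
     bas [Op, Oz, Om, O0] + (P + 1) *\<^sub>T bas [O0, Om, O0, Op] + (- 1 - R) *\<^sub>T bas [O0, Op, Om, O0] + bas [O0,
     Oz, Om, Op] + (1 + R) *\<^sub>T bas [O0, Oz, O0, O0] - bas [Oz, O0, O0, Oz] + (R) *\<^sub>T bas [Oz, Oz, O0, O0]"
  "asym_reps q 3 4 (bas [Om, Op, O0, Oz]) = bas [Om, Op, O0, Oz] + (- R) *\<^sub>T bas [Om, Op, Oz, O0] + (- 1 - R)
     *\<^sub>T bas [Om, O0, Op, O0] + bas [Om, O0, Oz, Op] + (P - 1) *\<^sub>T bas [Op, Om, Oz, O0] + (- P - 1)
     *\<^sub>T bas [Op, O0, Om, O0] - bas [Op, O0, Oz, Om] + bas [Oz, O0, Oz, O0]"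
  "asym_reps q 4 4 (bas [Om, Op, O0, Oz]) = bas [Om, Op, O0, Oz]"
  by (subst asym_reps_list, simp, simp, simp only: rep_words, rule ext, (simp add: numeral_2_eq_2; simp add: algebra_simps))+

section \<open>Increasing words as a basis, and the conjugation\<close>

definition lincomb :: "nat \<Rightarrow> (idx list \<Rightarrow> complex) \<Rightarrow> tensor" where
  "lincomb k c = (\<Sum>S\<in>monomials k. c S *\<^sub>T bas S)"

lemma lincomb_tpow: "lincomb k c \<in> tpow k"
  unfolding lincomb_def
  by (intro tensor.subspace_sum[OF tpow_subspace] tensor.subspace_scale[OF tpow_subspace] bas_tpow)
    (simp add: monomials_def)

lemma ext_map_lincomb:
  assumes "ext_map q k f"
  shows "f (lincomb k c) = (\<Sum>S\<in>monomials k. c S *\<^sub>T f (bas S))"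
  by (simp add: lincomb_def tlinear_simps[OF ext_map_linear[OF assms]])

lemma ext_map_span:
  assumes "t \<in> tpow k"
  obtains c where "\<And>f. ext_map q k f \<Longrightarrow> f t = f (lincomb k c)"
proof -
  obtain c where "\<forall>f. ext_map q k f \<longrightarrow> f t = (\<Sum>S\<in>monomials k. c S *\<^sub>T f (bas S))"
    using spanned_tpow[OF assms] unfolding spanned_def by (elim exE)
  then have "f t = f (lincomb k c)" if "ext_map q k f" for f
    using that ext_map_lincomb[OF that] by metis
  then show thesis by (rule that)
qed

lemma P_neq_0 [simp]: "P \<noteq> 0" "R \<noteq> 0"
  using PR(1) by fastforce+

lemma asym_0: "t \<in> tpow 0 \<Longrightarrow> asym q 0 t = t"
  by (simp add: asym_list code_words)

lemma asym_1: "t \<in> tpow 1 \<Longrightarrow> asym q 1 t = t"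
  by (subst asym_list, simp, simp only: code_words, simp)

text \<open>Read only at increasing words, the expansions of the antisymmetrised increasing words
  are triangular, with diagonal entries 1, \<open>P\<close> or \<open>R\<close>.\<close>

lemma asym_lincomb_eq_0:
  assumes "k \<le> 4" "asym q k (lincomb k c) = 0" "S \<in> monomials k"
  shows "c S = 0"
proof -
  have eq: "asym q k (lincomb k c) w = 0" for w
    using assms(2) by simp
  consider "k = 0" | "k = 1" | "k = 2" | "k = 3" | "k = 4"
    using assms(1) by linarith
  then show ?thesis
  proof cases
    case 1
    have *: "asym q 0 (bas []) = bas []"
      by (rule asym_0) simp
    have "asym q 0 (bas []) [] = 1"
      unfolding * by (simp add: bas_apply)
    then show ?thesis
      using eq[of "[]"] assms(3) by (simp add: 1 lincomb_def monomials_eq)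
  next
    case 2
    show ?thesis
      using eq[of S] assms(3) unfolding 2 asym_1[OF lincomb_tpow] unfolding lincomb_def monomials_eq
      by (auto simp: bas_apply)
  next
    case 3
    show ?thesis
      using eq[of "[Om, Op]"] eq[of "[O0, Oz]"] eq[of "[Om, Oz]"] eq[of "[Op, Oz]"]
        eq[of "[Om, O0]"] eq[of "[Op, O0]"] assms(3)
      by (auto simp: 3 lincomb_def monomials_eq asym_monomials_2 bas_apply)
  next
    case 4
    show ?thesis
      using eq[of "[Om, Op, O0]"] eq[of "[Om, Op, Oz]"] eq[of "[Om, O0, Oz]"] eq[of "[Op, O0, Oz]"] assms(3)
      by (auto simp: 4 lincomb_def monomials_eq asym_monomials_3 bas_apply)
  next
    case 5
    show ?thesis
      using eq[of "[Om, Op, O0, Oz]"] assms(3)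
      by (auto simp: 5 lincomb_def monomials_eq asym_monomials_4 bas_apply)
  qed
qed

text \<open>By independence the combination of increasing words that represents x has zero
  coefficients, and these coefficients serve every f. So up to degree 4 the antisymmetriser kills
  nothing beyond the quadratic relations.\<close>

lemma ext_map_eq_0:
  assumes "k \<le> 4" "x \<in> tpow k" "asym q k x = 0" "ext_map q k f"
  shows "f x = 0"
proof -
  obtain c where c: "\<And>f. ext_map q k f \<Longrightarrow> f x = f (lincomb k c)"
    using ext_map_span[OF assms(2)] by blast
  have "c S = 0" if "S \<in> monomials k" for S
    using asym_lincomb_eq_0[OF assms(1) _ that, of c] c[OF ext_map_asym] assms(3) by simp
  then show ?thesis
    using c[OF assms(4)] ext_map_lincomb[OF assms(4), of c] by simp
qed

lemma dagger_tpow: "x \<in> tpow k \<Longrightarrow> dagger k x \<in> tpow k"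
  by (simp add: dagger_def tpow_def)

lemma dagger_simps:
  assumes "x \<in> tpow k" "y \<in> tpow k"
  shows "dagger k (x + y) = dagger k x + dagger k y" "dagger k (x - y) = dagger k x - dagger k y"
    "dagger k (c *\<^sub>T x) = cnj c *\<^sub>T dagger k x"
  using assms tensor.subspace_add[OF tpow_subspace, of x k y] tensor.subspace_diff[OF tpow_subspace, of x k y]
    tensor.subspace_scale[OF tpow_subspace, of x k c]
  by (simp_all add: dagger_eq tensor.scale_right_distrib tensor.scale_right_diff_distrib mult.commute)

lemma form_conj_asym:
  assumes "k \<le> 4" "x \<in> tpow k"
  shows "form_conj q k (asym q k x) = asym q k (dagger k x)"
proof -
  define y where "y = inv_into (tpow k) (asym q k) (asym q k x)"
  have y: "y \<in> tpow k" "asym q k y = asym q k x"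
    using assms(2) by (auto simp: y_def inv_into_into f_inv_into_f)
  have yx: "y - x \<in> tpow k" "asym q k (y - x) = 0"
    using y assms(2) tensor.subspace_diff[OF tpow_subspace] by auto
  have "conj_coeffs (asym q k (mirror (conj_coeffs (y - x)))) = 0"
    by (rule ext_map_eq_0[OF assms(1) yx ext_map_conj[OF ext_map_mirror[OF ext_map_asym]]])
  then have "asym q k (mirror (conj_coeffs (y - x))) = 0"
    by (metis conj_coeffs_simps(2,7))
  then have "asym q k (dagger k y) = asym q k (dagger k x)"
    using y(1) assms(2) by (simp add: dagger_eq)
  then show ?thesis
    by (simp add: form_conj_def y_def)
qed

end

section \<open>The Hodge operator\<close>

lemma contract_simps:
  "contract \<Gamma> k s (x + y) z = contract \<Gamma> k s x z + contract \<Gamma> k s y z"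
  "contract \<Gamma> k s (x - y) z = contract \<Gamma> k s x z - contract \<Gamma> k s y z"
  "contract \<Gamma> k s (- x) z = - contract \<Gamma> k s x z"
  "contract \<Gamma> k s (c *\<^sub>T x) z = cnj c *\<^sub>T contract \<Gamma> k s x z"
  "contract \<Gamma> k s x (y + z) = contract \<Gamma> k s x y + contract \<Gamma> k s x z"
  "contract \<Gamma> k s x (y - z) = contract \<Gamma> k s x y - contract \<Gamma> k s x z"
  "contract \<Gamma> k s x (- z) = - contract \<Gamma> k s x z"
  "contract \<Gamma> k s x (c *\<^sub>T z) = c *\<^sub>T contract \<Gamma> k s x z"
  by (simp_all add: contract_def fun_eq_iff algebra_simps sum.distrib sum_subtractf sum_negf sum_distrib_left)

text \<open>Recursive form of the product of matrix entries, for evaluation on concrete words.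
  Surplus letters of the second word are ignored, so it need not be truncated.\<close>

fun contract_words :: "(tensor \<Rightarrow> tensor \<Rightarrow> complex) \<Rightarrow> idx list \<Rightarrow> idx list \<Rightarrow> complex" where
  "contract_words \<Gamma> (a # u) (b # v) = \<Gamma> (\<omega> a) (\<omega> b) * contract_words \<Gamma> u v"
| "contract_words \<Gamma> _ _ = 1"

lemma contract_words_prod:
  "length u = k \<Longrightarrow> length v = k \<Longrightarrow> contract_words \<Gamma> u v = (\<Prod>i<k. \<Gamma> (\<omega> (u ! i)) (\<omega> (v ! i)))"
proof (induction u arbitrary: v k)
  case (Cons a u)
  then obtain b v' k' where "v = b # v'" "k = Suc k'" by (cases v; cases k) auto
  then show ?case using Cons by (simp add: prod.lessThan_Suc_shift del: prod.lessThan_Suc)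
qed simp

lemma contract_bas:
  assumes "length u = k" "length v = s" "k \<le> s"
  shows "contract \<Gamma> k s (bas u) (bas v) = contract_words \<Gamma> u v *\<^sub>T bas (drop k v)"
proof
  fix w
  have words: "contract_words \<Gamma> u v = contract_words \<Gamma> u (take k v)" if "length u = k" for u v k
    using that by (induction \<Gamma> u v arbitrary: k rule: contract_words.induct) auto
  show "contract \<Gamma> k s (bas u) (bas v) w = (contract_words \<Gamma> u v *\<^sub>T bas (drop k v)) w"
  proof (cases "length w = s - k")
    case True
    have "contract \<Gamma> k s (bas u) (bas v) w = (\<Sum>x\<in>words k. \<Sum>y\<in>words k.
        cnj (bas u x) * bas v (y @ w) * (\<Prod>i<k. \<Gamma> (\<omega> (x ! i)) (\<omega> (y ! i))))"
      using True by (simp add: contract_def)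
    also have "\<dots> = (\<Sum>x\<in>words k. \<Sum>y\<in>words k.
        if y = take k v then if x = u then (if w = drop k v then contract_words \<Gamma> u y else 0) else 0 else 0)"
      using True assms
      by (intro sum.cong refl) (auto simp: bas_apply contract_words_prod append_eq_conv_conj)
    also have "\<dots> = (if w = drop k v then contract_words \<Gamma> u (take k v) else 0)"
      using assms by simp
    finally show ?thesis
      using words[OF assms(1), of v] by (simp add: bas_apply)
  next
    case False
    then have "w \<noteq> drop k v" using assms by auto
    then show ?thesis using False by (simp add: contract_def bas_apply)
  qed
qed

lemma contract_tpow: "contract \<Gamma> k s x y \<in> tpow (s - k)"
  by (simp add: contract_def tpow_def)

text \<open>The contraction is antilinear in its first argument and the conjugation is antilinear, so the Hodge
  operator depends on the conjugates of the matrix entries; these are the parameters.\<close>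

locale u1_contraction = qparam +
  fixes m :: real and \<Gamma> :: "tensor \<Rightarrow> tensor \<Rightarrow> complex" and \<alpha> \<beta> \<nu> \<epsilon> \<xi> \<gamma> :: complex
  assumes m: "m \<noteq> 0"
    and matrix: "\<Gamma> (\<omega> a) (\<omega> b) = cnj (u1_matrix \<alpha> \<beta> \<nu> \<epsilon> \<xi> \<gamma> a b)"
begin

lemma cnj_PR [simp]: "cnj P = P" "cnj R = R"
  unfolding P[symmetric] R[symmetric] by simp_all

text \<open>The Hodge operator before multiplication by the ratio of eigenvalues; unlike that ratio
  it is linear and makes sense beyond eigenforms.\<close>

definition hodge_form :: "nat \<Rightarrow> tensor \<Rightarrow> tensor" where
  "hodge_form k \<eta> = form_conj q (4 - k) (asym q (4 - k) (contract \<Gamma> k 4 \<eta> (asym_reps q k 4 (theta m))))"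

definition sgn_dagger :: "nat \<Rightarrow> complex" where
  "sgn_dagger k = (- 1) ^ (k * (k - 1) div 2 + k)"

text \<open>The imaginary scalar of \<open>theta\<close> leaves the antilinear conjugation as its
  complex conjugate, hence the minus sign. What remains is a combination of words to be
  straightened.\<close>

lemma hodge_form_eq:
  "hodge_form k \<eta> = - (\<i> * of_real m) *\<^sub>T sgn_dagger (4 - k) *\<^sub>T
    asym q (4 - k) (mirror (conj_coeffs (contract \<Gamma> k 4 \<eta> (asym_reps q k 4 (bas [Om, Op, O0, Oz])))))"
  by (simp only: hodge_form_def form_conj_asym[OF _ contract_tpow] dagger_eq[OF contract_tpow] diff_le_self)
    (simp add: theta_def sgn_dagger_def tlinear_simps[OF tlinear_asym_reps] contract_simps mult.commute)

text \<open>Two antilinear maps are composed: the contraction in its first argument and the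
  conjugation.\<close>

lemma tlinear_hodge_form: "tlinear (hodge_form k)"
  by (rule tlinearI) (simp_all add: hodge_form_eq contract_simps tensor.scale_right_distrib mult.commute mult.left_commute)

lemma hodge_form_inv_forms: "hodge_form k \<eta> \<in> inv_forms q (4 - k)"
proof -
  have "hodge_form k \<eta> = asym q (4 - k) (dagger (4 - k) (contract \<Gamma> k 4 \<eta> (asym_reps q k 4 (theta m))))"
    by (simp add: hodge_form_def form_conj_asym contract_tpow)
  then show ?thesis
    by (simp add: inv_forms_def contract_tpow dagger_tpow)
qed

lemmas asym_straighten = straighten_simps[OF ext_map_asym]

lemmas hodge_form_simps = hodge_form_eq asym_reps_theta[unfolded One_nat_def] asym_0 asym_1[simplified]
  contract_simps contract_bas matrix asym_straighten sgn_dagger_def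

lemma hodge_form_monomials_0:
  "hodge_form 0 (bas []) = - (\<i> * of_real m) *\<^sub>T (- asym q 4 (bas [Om, Op, O0, Oz]))"
  by (rule ext, (simp add: hodge_form_simps; simp add: algebra_simps))+

lemma hodge_form_monomials_1:
  "hodge_form 1 (bas [Om]) = - (\<i> * of_real m) *\<^sub>T ((- \<alpha>) *\<^sub>T asym q 3 (bas [Om, O0, Oz]))"
  "hodge_form 1 (bas [Op]) = - (\<i> * of_real m) *\<^sub>T ((\<beta>) *\<^sub>T asym q 3 (bas [Op, O0, Oz]))"
  "hodge_form 1 (bas [O0]) = - (\<i> * of_real m) *\<^sub>T ((- \<epsilon>) *\<^sub>T asym q 3 (bas [Om, Op, O0]) +
     (\<nu>) *\<^sub>T asym q 3 (bas [Om, Op, Oz]))"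
  "hodge_form 1 (bas [Oz]) = - (\<i> * of_real m) *\<^sub>T ((- \<gamma>) *\<^sub>T asym q 3 (bas [Om, Op, O0]) +
     (\<xi>) *\<^sub>T asym q 3 (bas [Om, Op, Oz]))"
  by (rule ext, (simp add: hodge_form_simps; simp add: algebra_simps))+

lemma hodge_form_monomials_2:
  "hodge_form 2 (asym q 2 (bas [Om, Op])) = - (\<i> * of_real m) *\<^sub>T ((- P * P * \<alpha> * \<beta> + 3 * P *
     \<alpha> * \<beta> + P * \<nu> * \<gamma> - 4 * \<alpha> * \<beta> - 2 * \<nu> * \<gamma> - \<epsilon> * \<xi> + 3
     * R * \<alpha> * \<beta> + R * \<nu> * \<gamma> - R * R * \<alpha> * \<beta>) *\<^sub>T asym q 2 (bas [Om, Op]) +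
     (P * \<alpha> * \<beta> - \<alpha> * \<beta> - \<nu> * \<gamma> + R * \<alpha> * \<beta>) *\<^sub>T asym q 2 (bas
     [O0, Oz]))"
  "hodge_form 2 (asym q 2 (bas [Om, O0])) = - (\<i> * of_real m) *\<^sub>T ((P * P * \<alpha> * \<epsilon> + P *
     \<alpha> * \<nu> + \<alpha> * \<nu>) *\<^sub>T asym q 2 (bas [Om, O0]) + (- \<alpha> * \<nu>) *\<^sub>T asym q 2
     (bas [Om, Oz]))"
  "hodge_form 2 (asym q 2 (bas [Om, Oz])) = - (\<i> * of_real m) *\<^sub>T ((- P * P * \<alpha> * \<epsilon> - P *
     \<alpha> * \<epsilon> + P * \<alpha> * \<xi> + P * \<alpha> * \<gamma> + \<alpha> * \<xi>) *\<^sub>T asym q 2 (bas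
     [Om, O0]) + (\<alpha> * \<nu> + R * \<alpha> * \<nu> - R * \<alpha> * \<xi>) *\<^sub>T asym q 2 (bas [Om, Oz]))"
  "hodge_form 2 (asym q 2 (bas [Op, O0])) = - (\<i> * of_real m) *\<^sub>T ((\<beta> * \<nu> + R * \<beta> * \<nu> - R *
     R * \<beta> * \<epsilon>) *\<^sub>T asym q 2 (bas [Op, O0]) + (\<beta> * \<nu>) *\<^sub>T asym q 2 (bas [Op, Oz]))"
  "hodge_form 2 (asym q 2 (bas [Op, Oz])) = - (\<i> * of_real m) *\<^sub>T ((\<beta> * \<xi> - R * \<beta> * \<epsilon>
     + R * \<beta> * \<xi> - R * \<beta> * \<gamma> - R * R * \<beta> * \<epsilon>) *\<^sub>T asym q 2 (bas [Op, O0]) +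
     (P * \<beta> * \<nu> + P * \<beta> * \<xi> + \<beta> * \<nu>) *\<^sub>T asym q 2 (bas [Op, Oz]))"
  "hodge_form 2 (asym q 2 (bas [O0, Oz])) = - (\<i> * of_real m) *\<^sub>T ((- P * \<nu> * \<gamma> + P * \<epsilon> *
     \<xi> + \<nu> * \<gamma> - \<epsilon> * \<xi> - R * \<nu> * \<gamma> + R * \<epsilon> * \<xi>) *\<^sub>T asym q 2
     (bas [Om, Op]) + (\<nu> * \<gamma> - \<epsilon> * \<xi>) *\<^sub>T asym q 2 (bas [O0, Oz]))"
  by (subst asym_monomials_2, rule ext, (simp add: hodge_form_simps; simp add: algebra_simps))+

lemma hodge_form_monomials_3:
  "hodge_form 3 (asym q 3 (bas [Om, Op, O0])) = - (\<i> * of_real m) *\<^sub>T ((- P * \<alpha> * \<beta> * \<nu> + P *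
     \<alpha> * \<beta> * \<epsilon> - \<alpha> * \<beta> * \<epsilon> - \<epsilon> * \<epsilon> * \<xi> + R * \<alpha>
     * \<beta> * \<nu> + R * \<alpha> * \<beta> * \<epsilon>) *\<^sub>T bas [O0] + (- \<alpha> * \<beta> * \<nu>)
     *\<^sub>T bas [Oz])"
  "hodge_form 3 (asym q 3 (bas [Om, Op, Oz])) = - (\<i> * of_real m) *\<^sub>T ((2 * P * \<alpha> * \<beta> * \<nu> + P
     * \<alpha> * \<beta> * \<xi> + P * \<alpha> * \<beta> * \<gamma> + 4 * \<alpha> * \<beta> * \<nu> - \<alpha> *
     \<beta> * \<gamma> - \<nu> * \<gamma> * \<gamma> + 2 * R * \<alpha> * \<beta> * \<nu> - R * \<alpha> * \<beta> *
     \<xi> + R * \<alpha> * \<beta> * \<gamma>) *\<^sub>T bas [O0] + (- \<alpha> * \<beta> * \<xi>) *\<^sub>T bas [Oz])"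
  "hodge_form 3 (asym q 3 (bas [Om, O0, Oz])) = - (\<i> * of_real m) *\<^sub>T ((- P * \<alpha> * \<nu> * \<gamma> + P *
     \<alpha> * \<epsilon> * \<xi>) *\<^sub>T bas [Om])"
  "hodge_form 3 (asym q 3 (bas [Op, O0, Oz])) = - (\<i> * of_real m) *\<^sub>T ((R * \<beta> * \<nu> * \<gamma> - R *
     \<beta> * \<epsilon> * \<xi>) *\<^sub>T bas [Op])"
  unfolding asym_monomials_3
  by (rule ext, (simp add: hodge_form_simps; simp add: algebra_simps))+

lemma hodge_form_monomials_4:
  "hodge_form 4 (asym q 4 (bas [Om, Op, O0, Oz])) = - (\<i> * of_real m) *\<^sub>T ((\<alpha> * \<beta> * \<nu> *
     \<gamma> - \<alpha> * \<beta> * \<epsilon> * \<xi>) *\<^sub>T bas [])"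
  unfolding asym_monomials_4
  by (rule ext, (simp add: hodge_form_simps; simp add: algebra_simps))+

end

section \<open>Spectrum of the antisymmetrisers and its behaviour under conjugation\<close>

context qparam
begin

lemma ext_map_comp:
  assumes "tlinear h" "ext_map q k f"
  shows "ext_map q k (\<lambda>x. h (f x))"
  using tlinear_comp[OF assms(1) ext_map_linear[OF assms(2)]] assms tlinear_simps(5)[OF assms(1)]
  by (simp add: ext_map_def)

lemma ext_map_scale:
  assumes "ext_map q k f"
  shows "ext_map q k (\<lambda>x. c *\<^sub>T f x)"
proof -
  have "tlinear (\<lambda>x. c *\<^sub>T x)"
    by (rule tlinearI) (simp_all only: tensor.scale_right_distrib tensor.scale_scale mult.commute)
  from ext_map_comp[OF this assms] show ?thesis .
qed

lemma ext_map_eqI: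
  assumes "ext_map q k f" "ext_map q k g" "x \<in> tpow k"
    and "\<And>S. S \<in> monomials k \<Longrightarrow> f (bas S) = g (bas S)"
  shows "f x = g x"
proof -
  obtain c where c: "\<And>f. ext_map q k f \<Longrightarrow> f x = f (lincomb k c)"
    using ext_map_span[OF assms(3)] by blast
  show ?thesis
    using assms(4) by (simp add: c[OF assms(1)] c[OF assms(2)] ext_map_lincomb[OF assms(1)] ext_map_lincomb[OF assms(2)])
qed

text \<open>The eigenvalue of the antisymmetriser on forms of degree 0, 1, 3 and 4; degree 2 has two
  eigenvalues and is treated apart.\<close>

definition form_eig :: "nat \<Rightarrow> complex" where
  "form_eig k = (if k = 3 then 2 * P + 2 + 2 * R
     else if k = 4 then 2 * (P * P) + 6 * P + 8 + 6 * R + 2 * (R * R) else 1)"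

lemma form_eig_neq_0: "form_eig k \<noteq> 0"
proof -
  define z where "z = (if k = 3 then 2 * q^2 + 2 + 2 * (1 / q^2)
     else if k = 4 then 2 * (q^2 * q^2) + 6 * q^2 + 8 + 6 * (1 / q^2) + 2 * (1 / q^2 * (1 / q^2)) else 1)"
  have "form_eig k = of_real z"
    unfolding form_eig_def z_def unfolding P[symmetric] R[symmetric]
    by (simp only: of_real_add of_real_mult of_real_numeral of_real_1 split: if_split) simp
  moreover have "0 < 2 * q^2 + 2 + 2 * (1 / q^2)"
    using q by (intro add_pos_pos) auto
  moreover have "0 < 2 * (q^2 * q^2) + 6 * q^2 + 8 + 6 * (1 / q^2) + 2 * (1 / q^2 * (1 / q^2))"
    using q by (intro add_pos_pos) auto
  ultimately show ?thesis
    by (auto simp: z_def simp del: of_real_add split: if_splits)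
qed

lemma asym_asym:
  assumes "k \<le> 4" "k \<noteq> 2" "x \<in> tpow k"
  shows "asym q k (asym q k x) = form_eig k *\<^sub>T asym q k x"
proof (rule ext_map_eqI[OF ext_map_comp[OF tlinear_asym ext_map_asym] ext_map_scale[OF ext_map_asym] assms(3)])
  fix S assume S: "S \<in> monomials k"
  consider "k = 0" | "k = 1" | "k = 3" | "k = 4"
    using assms(1,2) by linarith
  then show "asym q k (asym q k (bas S)) = form_eig k *\<^sub>T asym q k (bas S)"
  proof cases
    case 1
    then show ?thesis using S by (simp add: asym_0 form_eig_def monomials_def)
  next
    case 2
    have "bas S \<in> tpow 1" using S 2 by (simp add: monomials_def)
    then show ?thesis unfolding 2 by (simp only: asym_1) (simp add: form_eig_def)
  next
    case 3
    then show ?thesis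
      using S by (auto simp: monomials_eq ext_map_asym_monomials_3[OF ext_map_asym] form_eig_def;
        simp add: fun_eq_iff algebra_simps)
  next
    case 4
    then show ?thesis
      using S by (auto simp: monomials_eq ext_map_asym_monomials_4[OF ext_map_asym] form_eig_def;
        simp add: fun_eq_iff algebra_simps)
  qed
qed

text \<open>The quadratic equation with roots 1 + P and 1 + R, imposed on the image of the
  antisymmetriser. Sum and product of the roots agree because P R = 1.\<close>

lemma asym_2_cubic:
  assumes "x \<in> tpow 2"
  shows "asym q 2 (asym q 2 (asym q 2 x)) = (P + 2 + R) *\<^sub>T (asym q 2 (asym q 2 x) - asym q 2 x)"
proof (rule ext_map_eqI[where f = "\<lambda>x. asym q 2 (asym q 2 (asym q 2 x))"
      and g = "\<lambda>x. (P + 2 + R) *\<^sub>T (asym q 2 (asym q 2 x) - asym q 2 x)", OF _ _ assms])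
  show "ext_map q 2 (\<lambda>x. asym q 2 (asym q 2 (asym q 2 x)))"
    by (intro ext_map_comp[OF tlinear_asym] ext_map_asym)
  have "tlinear (\<lambda>x. asym q 2 x - x)"
    by (rule tlinearI) (simp_all add: tensor.scale_right_diff_distrib)
  then show "ext_map q 2 (\<lambda>x. (P + 2 + R) *\<^sub>T (asym q 2 (asym q 2 x) - asym q 2 x))"
    by (intro ext_map_scale ext_map_comp[of "\<lambda>x. asym q 2 x - x"] ext_map_asym)
  fix S assume "S \<in> monomials 2"
  then show "asym q 2 (asym q 2 (asym q 2 (bas S))) = (P + 2 + R) *\<^sub>T (asym q 2 (asym q 2 (bas S)) - asym q 2 (bas S))"
    by (auto simp: monomials_eq ext_map_asym_monomials_2[OF ext_map_asym];
      simp add: fun_eq_iff algebra_simps)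
qed

text \<open>\<open>mirror\<close> turns \<sigma> into its inverse and so exchanges its eigenvalues -
  P and - R on 2-forms. For A = 1 - \<sigma>, whose two eigenvalues add up to P + 2 + R, this means
  that A becomes P + 2 + R - A.\<close>

lemma asym_2_conj:
  assumes "x \<in> tpow 2"
  shows "asym q 2 (dagger 2 (asym q 2 x)) =
    (P + 2 + R) *\<^sub>T asym q 2 (dagger 2 x) - asym q 2 (asym q 2 (dagger 2 x))"
proof -
  have *: "f (mirror (asym q 2 y)) = (P + 2 + R) *\<^sub>T f (mirror y) - f (asym q 2 (mirror y))"
    if f: "ext_map q 2 f" and y: "y \<in> tpow 2" for f y
  proof (rule tlinear_eq_on_tpow[where f = "\<lambda>y. f (mirror (asym q 2 y))"
        and g = "\<lambda>y. (P + 2 + R) *\<^sub>T f (mirror y) - f (asym q 2 (mirror y))", OF _ _ _ y])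
    fix w :: "idx list" assume "length w = 2"
    then obtain a b where w: "w = [a, b]" by (rule words_2_cases)
    show "f (mirror (asym q 2 (bas w))) = (P + 2 + R) *\<^sub>T f (mirror (bas w)) - f (asym q 2 (mirror (bas w)))"
      unfolding w
      by (cases a; cases b; simp add: asym_2 straighten_simps[OF f] tlinear_simps[OF ext_map_linear[OF f]];
          simp add: fun_eq_iff algebra_simps)
  qed (rule tlinearI; simp add: tlinear_simps[OF ext_map_linear[OF f]] tensor.scale_right_distrib
      tensor.scale_right_diff_distrib mult.commute)+
  have c: "conj_coeffs (asym q 2 x) = asym q 2 (conj_coeffs x)"
    using assms by (simp add: asym_2 conj_coeffs_tpow braid_conj_coeffs)
  show ?thesis
    using assms *[OF ext_map_asym, of "conj_coeffs x"]
    by (simp add: dagger_eq asym_tpow c conj_coeffs_tpow mirror_tpow)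
qed

text \<open>The dagger is an involution up to sign. Consequently the conjugate of a nonzero form is
  nonzero, and its \<open>eigval\<close> is meaningful.\<close>

lemma asym_dagger_eq_0:
  assumes "k \<le> 4" "x \<in> tpow k" "asym q k (dagger k x) = 0"
  shows "asym q k x = 0"
proof -
  have "conj_coeffs (asym q k (mirror (conj_coeffs (dagger k x)))) = 0"
    by (rule ext_map_eq_0[OF assms(1) dagger_tpow[OF assms(2)] assms(3)
      ext_map_conj[OF ext_map_mirror[OF ext_map_asym]]])
  moreover have "mirror (mirror y) = y" "conj_coeffs (mirror y) = mirror (conj_coeffs y)" for y
    by (simp_all add: mirror_def conj_coeffs_def rev_map comp_def)
  ultimately have "(- 1) ^ (k * (k - 1) div 2 + k) *\<^sub>T conj_coeffs (asym q k x) = 0"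
    using assms(2) by (simp add: dagger_eq)
  then show ?thesis
    by (metis conj_coeffs_simps(2,7) neg_one_neq_zero power_eq_0_iff tensor.scale_eq_0_iff)
qed

lemma inv_formsE:
  assumes "\<eta> \<in> inv_forms q k"
  obtains x where "x \<in> tpow k" "\<eta> = asym q k x"
  using assms by (auto simp: inv_forms_def)

lemma inv_forms_subspace: "tensor.subspace (inv_forms q k)"
  unfolding inv_forms_def
  using tensors.linear_subspace_image[OF tlinear_asym tpow_subspace] .

lemma eigval_eq: "\<eta> \<noteq> 0 \<Longrightarrow> asym q k \<eta> = l *\<^sub>T \<eta> \<Longrightarrow> eigval q k \<eta> = l"
  unfolding eigval_def by (rule the_equality) (auto simp: tensor.scale_cancel_right)

lemma eig_2_cases:
  assumes "\<eta> \<in> inv_forms q 2" "\<eta> \<noteq> 0" "asym q 2 \<eta> = l *\<^sub>T \<eta>"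
  shows "l = 1 + P \<or> l = 1 + R"
proof -
  from assms(1) obtain x where "x \<in> tpow 2" "\<eta> = asym q 2 x" by (rule inv_formsE)
  then have "asym q 2 (asym q 2 \<eta>) = (P + 2 + R) *\<^sub>T (asym q 2 \<eta> - \<eta>)"
    using asym_2_cubic[of x] by simp
  then have "(l * l) *\<^sub>T \<eta> = (P + 2 + R) *\<^sub>T (l *\<^sub>T \<eta> - \<eta>)"
    by (simp add: assms(3))
  also have "\<dots> = ((P + 2 + R) * (l - 1)) *\<^sub>T \<eta>"
    by (simp add: tensor.scale_left_diff_distrib right_diff_distrib tensor.scale_right_diff_distrib)
  finally have "(l * l) *\<^sub>T \<eta> = ((P + 2 + R) * (l - 1)) *\<^sub>T \<eta>" .
  then have "l * l = (P + 2 + R) * (l - 1)"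
    using assms(2) by (simp add: tensor.scale_cancel_right)
  then have "(l - (1 + P)) * (l - (1 + R)) = 0"
    by (simp add: algebra_simps)
  then show ?thesis by auto
qed

lemma PR_neq: "P \<noteq> R" "P \<noteq> 1" "P + 1 \<noteq> 0" "R + 1 \<noteq> 0"
proof -
  have *: "q^2 < 1" "q^2 > 0" using q by (auto simp: power_less_one_iff)
  then have "1 < 1 / q^2" by simp
  with * have "q^2 < 1 / q^2" by linarith
  then show "P \<noteq> R"
    unfolding P[symmetric] R[symmetric] by (simp only: of_real_eq_iff)
  show "P \<noteq> 1"
    unfolding P[symmetric] of_real_eq_1_iff using * by linarith
  have "of_real (q^2 + 1) \<noteq> (0 :: complex)"
    unfolding of_real_eq_0_iff using * by linarith
  then show "P + 1 \<noteq> 0"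
    unfolding P[symmetric] by (simp only: of_real_add of_real_1 not_False_eq_True)
  moreover have "P * (R + 1) = P + 1"
    by (simp add: distrib_left)
  ultimately show "R + 1 \<noteq> 0"
    by fastforce
qed

end

section \<open>The Hodge operator in closed form\<close>

context u1_contraction
begin

text \<open>Candidate for the operator that \<open>hodge\<close> selects. On 2-forms the ratio of
  eigenvalues is replaced by a polynomial in the antisymmetriser, which avoids any reference to
  eigenforms.\<close>

definition hodge_op :: "nat \<Rightarrow> tensor \<Rightarrow> tensor" where
  "hodge_op k \<eta> = hodge_form k (if k = 2 then (P + 1 + R) *\<^sub>T \<eta> - asym q 2 \<eta> else \<eta>)"

lemma tlinear_hodge_op: "tlinear (hodge_op k)"
  by (rule tlinearI) (simp_all add: hodge_op_def tlinear_simps[OF tlinear_hodge_form]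
      tensor.scale_right_distrib tensor.scale_right_diff_distrib mult.commute)

lemma hodge_op_inv_forms: "hodge_op k \<eta> \<in> inv_forms q (4 - k)"
  by (simp add: hodge_op_def hodge_form_inv_forms)

text \<open>On 2-forms the conjugation exchanges the two eigenvalues. Their sum and product are both
  \<open>P + 2 + R\<close>, so the ratio of eigenvalues at \<open>l\<close> is \<open>P + 1 + R - l\<close>, which is linear in \<open>l\<close>.\<close>

lemma hodge_op_eigenform:
  assumes "k \<le> 4" "\<eta> \<in> inv_forms q k" "\<eta> \<noteq> 0" "asym q k \<eta> = l *\<^sub>T \<eta>"
  shows "(eigval q k (form_conj q k \<eta>) / l) *\<^sub>T hodge_form k \<eta> = hodge_op k \<eta>"
proof -
  from assms(2) obtain x where x: "x \<in> tpow k" "\<eta> = asym q k x" by (rule inv_formsE)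
  have conj: "form_conj q k \<eta> = asym q k (dagger k x)"
    using x assms(1) by (simp add: form_conj_asym)
  have neq: "asym q k (dagger k x) \<noteq> 0"
    using asym_dagger_eq_0[OF assms(1) x(1)] assms(3) x(2) by auto
  show ?thesis
  proof (cases "k = 2")
    case False
    have "l = form_eig k"
      using asym_asym[OF assms(1) False x(1)] assms(3,4) x(2) by (simp add: tensor.scale_cancel_right)
    moreover have "eigval q k (form_conj q k \<eta>) = form_eig k"
      unfolding conj
      by (rule eigval_eq[OF neq asym_asym[OF assms(1) False dagger_tpow[OF x(1)]]])
    ultimately show ?thesis
      using False form_eig_neq_0[of k] by (simp add: hodge_op_def)
  next
    case True
    have l: "l = 1 + P \<or> l = 1 + R"
      using eig_2_cases assms(2-4) True by blast
    then have "cnj l = l" by auto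
    then have "form_conj q 2 (asym q 2 (asym q 2 x)) = l *\<^sub>T asym q 2 (dagger 2 x)"
      using x True assms(4) form_conj_asym[of 2 "l *\<^sub>T x"]
        tensor.subspace_scale[OF tpow_subspace, of x 2 l] dagger_simps(3)[of x 2 x l] by simp
    then have "l *\<^sub>T asym q 2 (dagger 2 x) =
        (P + 2 + R) *\<^sub>T asym q 2 (dagger 2 x) - asym q 2 (asym q 2 (dagger 2 x))"
      using x True asym_2_conj[of x] form_conj_asym[of 2 "asym q 2 x"] asym_tpow[of x 2] by simp
    then have "asym q 2 (asym q 2 (dagger 2 x)) = (P + 2 + R - l) *\<^sub>T asym q 2 (dagger 2 x)"
      by (simp add: tensor.scale_left_diff_distrib algebra_simps)
    then have "eigval q k (form_conj q k \<eta>) = P + 2 + R - l"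
      using neq eigval_eq conj True by simp
    moreover have "(P + 2 + R - l) / l = P + 1 + R - l"
    proof -
      have "l \<noteq> 0" using l PR_neq(3,4) by (auto simp: add.commute)
      moreover have "P + 2 + R - l = (P + 1 + R - l) * l"
        using l by (auto simp: algebra_simps)
      ultimately show ?thesis by simp
    qed
    ultimately show ?thesis
      using True assms(4) by (simp add: hodge_op_def tlinear_simps[OF tlinear_hodge_form]
          tensor.scale_left_diff_distrib)
  qed
qed

lemma is_hodge_hodge_op: "k \<le> 4 \<Longrightarrow> is_hodge q m \<Gamma> k (hodge_op k)"
  unfolding is_hodge_def
  using hodge_op_eigenform by (auto simp: tlinear_simps[OF tlinear_hodge_op] hodge_form_def)

lemma is_hodge_unique:
  assumes "k \<le> 4" "is_hodge q m \<Gamma> k T" "\<eta> \<in> inv_forms q k"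
  shows "T \<eta> = hodge_op k \<eta>"
proof -
  have add: "T (x + y) = T x + T y" if "x \<in> inv_forms q k" "y \<in> inv_forms q k" for x y
    using assms(2) that by (simp add: is_hodge_def)
  have scale: "T (c *\<^sub>T x) = c *\<^sub>T T x" if "x \<in> inv_forms q k" for c x
    using assms(2) that by (simp add: is_hodge_def)
  have eig: "T \<zeta> = hodge_op k \<zeta>" if "\<zeta> \<in> inv_forms q k" "asym q k \<zeta> = l *\<^sub>T \<zeta>" for \<zeta> l
  proof (cases "\<zeta> = 0")
    case True
    then show ?thesis
      using scale[OF that(1), of 0] tlinear_simps(5)[OF tlinear_hodge_op] by simp
  next
    case False
    have "T \<zeta> = (eigval q k (form_conj q k \<zeta>) / l) *\<^sub>T hodge_form k \<zeta>"
      unfolding hodge_form_def using assms(2) that False unfolding is_hodge_def by blast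
    then show ?thesis
      using hodge_op_eigenform[OF assms(1) that(1) False that(2)] by simp
  qed
  from assms(3) obtain x where x: "x \<in> tpow k" "\<eta> = asym q k x" by (rule inv_formsE)
  show ?thesis
  proof (cases "k = 2")
    case False
    show ?thesis
      using eig[OF assms(3), of "form_eig k"] asym_asym[OF assms(1) False x(1)] x(2) by simp
  next
    case True
    let ?A = "asym q 2"
    \<comment> \<open>\<zeta> and \<zeta>' are the spectral components of \<eta> for 1 + P and 1 +
      R. These eigenvalues differ by P - R, which is nonzero because 0 < q < 1.\<close>
    define d where "d = 1 / (P - R)"
    define \<zeta> \<zeta>' where "\<zeta> = d *\<^sub>T (?A \<eta> - (1 + R) *\<^sub>T \<eta>)"
      and "\<zeta>' = d *\<^sub>T ((1 + P) *\<^sub>T \<eta> - ?A \<eta>)"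
    have "?A \<eta> \<in> inv_forms q k"
      using x asym_tpow[OF x(1)] True by (auto simp: inv_forms_def)
    then have forms: "\<zeta> \<in> inv_forms q k" "\<zeta>' \<in> inv_forms q k"
      unfolding \<zeta>_def \<zeta>'_def
      by (intro tensor.subspace_scale[OF inv_forms_subspace] tensor.subspace_diff[OF inv_forms_subspace] assms(3); simp)+
    have cubic: "?A (?A \<eta>) = (P + 2 + R) *\<^sub>T (?A \<eta> - \<eta>)"
      using asym_2_cubic[of x] x True by simp
    have "?A \<zeta> = (1 + P) *\<^sub>T \<zeta>" "?A \<zeta>' = (1 + R) *\<^sub>T \<zeta>'"
      by (simp_all add: \<zeta>_def \<zeta>'_def cubic) (simp_all add: fun_eq_iff algebra_simps)
    then have "T \<zeta> = hodge_op k \<zeta>" "T \<zeta>' = hodge_op k \<zeta>'"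
      using eig forms True by simp_all
    moreover have "\<eta> = \<zeta> + \<zeta>'"
    proof -
      have "\<eta> = (d * (P - R)) *\<^sub>T \<eta>"
        using PR_neq by (simp add: d_def)
      also have "\<dots> = \<zeta> + \<zeta>'"
        by (simp add: \<zeta>_def \<zeta>'_def fun_eq_iff algebra_simps)
      finally show ?thesis .
    qed
    ultimately show ?thesis
      using add[OF forms] by (simp add: tlinear_simps[OF tlinear_hodge_op])
  qed
qed

lemma hodge_eq: "k \<le> 4 \<Longrightarrow> \<eta> \<in> inv_forms q k \<Longrightarrow> hodge q m \<Gamma> k \<eta> = hodge_op k \<eta>"
  unfolding hodge_def
  by (rule is_hodge_unique[OF _ someI[where P = "is_hodge q m \<Gamma> k", OF is_hodge_hodge_op]])

lemma hodge_sq_eq: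
  "k \<le> 4 \<Longrightarrow> \<eta> \<in> inv_forms q k \<Longrightarrow> hodge_sq q m \<Gamma> k \<eta> = hodge_op (4 - k) (hodge_op k \<eta>)"
  unfolding hodge_sq_def by (simp add: hodge_eq hodge_op_inv_forms)

end

section \<open>Real and maximally hermitian contractions\<close>

context qparam
begin

lemma asym_bas_forms [simp]: "length w = k \<Longrightarrow> asym q k (bas w) \<in> inv_forms q k"
  by (simp add: inv_forms_def)

lemma bas_forms [simp]: "bas [] \<in> inv_forms q 0" "bas [a] \<in> inv_forms q 1" "bas [a] \<in> inv_forms q (Suc 0)"
  using asym_bas_forms[of "[]" 0] asym_bas_forms[of "[a]" 1] by (simp_all only: asym_0 asym_1 bas_tpow list.size) simp_all

lemma form_conj_lincomb:
  assumes "k \<le> 4" "\<eta> \<in> inv_forms q k" "\<zeta> \<in> inv_forms q k"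
  shows "form_conj q k (c *\<^sub>T \<eta> + d *\<^sub>T \<zeta>) = cnj c *\<^sub>T form_conj q k \<eta> + cnj d *\<^sub>T form_conj q k \<zeta>"
proof -
  obtain x y where *: "x \<in> tpow k" "\<eta> = asym q k x" "y \<in> tpow k" "\<zeta> = asym q k y"
    using assms(2,3) by (elim inv_formsE)
  have "form_conj q k (c *\<^sub>T \<eta> + d *\<^sub>T \<zeta>) = form_conj q k (asym q k (c *\<^sub>T x + d *\<^sub>T y))"
    using * by simp
  also have "\<dots> = asym q k (dagger k (c *\<^sub>T x + d *\<^sub>T y))"
    using * by (intro form_conj_asym[OF assms(1)] tensor.subspace_add[OF tpow_subspace] tensor.subspace_scale[OF tpow_subspace])
  also have "dagger k (c *\<^sub>T x + d *\<^sub>T y) = cnj c *\<^sub>T dagger k x + cnj d *\<^sub>T dagger k y"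
    using * tensor.subspace_scale[OF tpow_subspace]
    by (simp add: dagger_simps(1) dagger_simps(3)[where y = x] dagger_simps(3)[where y = y])
  also have "asym q k \<dots> = cnj c *\<^sub>T form_conj q k \<eta> + cnj d *\<^sub>T form_conj q k \<zeta>"
    using * by (simp add: form_conj_asym[OF assms(1)])
  finally show ?thesis .
qed

lemma form_conj_scale:
  "k \<le> 4 \<Longrightarrow> \<eta> \<in> inv_forms q k \<Longrightarrow> form_conj q k (c *\<^sub>T \<eta>) = cnj c *\<^sub>T form_conj q k \<eta>"
  using form_conj_lincomb[of k \<eta> \<eta> c 0] by simp

lemma form_conj_1: "form_conj q 1 (bas [a]) = - bas [bar a]"
  using form_conj_asym[of 1 "bas [a]"] by (simp add: dagger_eq asym_1[simplified])

lemma form_conj_3: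
  "form_conj q 3 (asym q 3 (bas [Om, Op, O0])) = asym q 3 (bas [Om, Op, O0])"
  "form_conj q 3 (asym q 3 (bas [Om, Op, Oz])) = asym q 3 (bas [Om, Op, Oz])"
  "form_conj q 3 (asym q 3 (bas [Om, O0, Oz])) = (- P) *\<^sub>T asym q 3 (bas [Op, O0, Oz])"
  "form_conj q 3 (asym q 3 (bas [Op, O0, Oz])) = (- R) *\<^sub>T asym q 3 (bas [Om, O0, Oz])"
  by (simp_all add: form_conj_asym dagger_eq straighten_simps[OF ext_map_asym])

lemma asym_3_coeffs:
  assumes "c1 *\<^sub>T asym q 3 (bas [Om, Op, O0]) + c2 *\<^sub>T asym q 3 (bas [Om, Op, Oz]) =
    d1 *\<^sub>T asym q 3 (bas [Om, Op, O0]) + d2 *\<^sub>T asym q 3 (bas [Om, Op, Oz])"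
  shows "c1 = d1" "c2 = d2"
  using fun_cong[OF assms, of "[Om, Op, O0]"] fun_cong[OF assms, of "[Om, Op, Oz]"]
  by (simp_all add: asym_monomials_3 bas_apply)

lemma asym_3_neq_0: "asym q 3 (bas [Om, O0, Oz]) \<noteq> 0" "asym q 3 (bas [Op, O0, Oz]) \<noteq> 0"
proof -
  have "asym q 3 (bas [Om, O0, Oz]) [Om, O0, Oz] \<noteq> 0" "asym q 3 (bas [Op, O0, Oz]) [Op, O0, Oz] \<noteq> 0"
    by (simp_all add: asym_monomials_3 bas_apply)
  then show "asym q 3 (bas [Om, O0, Oz]) \<noteq> 0" "asym q 3 (bas [Op, O0, Oz]) \<noteq> 0"
    by auto
qed

end

context u1_contraction
begin

lemmas hodge_form_linear = tlinear_simps[OF tlinear_hodge_form]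
lemmas hodge_op_linear = tlinear_simps[OF tlinear_hodge_op]

lemma hodge_op_eq:
  "hodge_op 0 = hodge_form 0" "hodge_op 1 = hodge_form 1" "hodge_op 3 = hodge_form 3" "hodge_op 4 = hodge_form 4"
  by (simp_all add: hodge_op_def fun_eq_iff)

lemma hodge_op_monomials:
  "hodge_op 0 (bas []) = - (\<i> * of_real m) *\<^sub>T (- asym q 4 (bas [Om, Op, O0, Oz]))"
  "hodge_op 1 (bas [Om]) = - (\<i> * of_real m) *\<^sub>T ((- \<alpha>) *\<^sub>T asym q 3 (bas [Om, O0, Oz]))"
  "hodge_op 1 (bas [Op]) = - (\<i> * of_real m) *\<^sub>T ((\<beta>) *\<^sub>T asym q 3 (bas [Op, O0, Oz]))"
  "hodge_op 1 (bas [O0]) = - (\<i> * of_real m) *\<^sub>T ((- \<epsilon>) *\<^sub>T asym q 3 (bas [Om, Op, O0]) +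
     (\<nu>) *\<^sub>T asym q 3 (bas [Om, Op, Oz]))"
  "hodge_op 1 (bas [Oz]) = - (\<i> * of_real m) *\<^sub>T ((- \<gamma>) *\<^sub>T asym q 3 (bas [Om, Op, O0]) + (\<xi>)
     *\<^sub>T asym q 3 (bas [Om, Op, Oz]))"
  "hodge_op 3 (asym q 3 (bas [Om, Op, O0])) = - (\<i> * of_real m) *\<^sub>T ((- P * \<alpha> * \<beta> * \<nu> + P *
     \<alpha> * \<beta> * \<epsilon> - \<alpha> * \<beta> * \<epsilon> - \<epsilon> * \<epsilon> * \<xi> + R * \<alpha>
     * \<beta> * \<nu> + R * \<alpha> * \<beta> * \<epsilon>) *\<^sub>T bas [O0] + (- \<alpha> * \<beta> * \<nu>)
     *\<^sub>T bas [Oz])"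
  "hodge_op 3 (asym q 3 (bas [Om, Op, Oz])) = - (\<i> * of_real m) *\<^sub>T ((2 * P * \<alpha> * \<beta> * \<nu> + P *
     \<alpha> * \<beta> * \<xi> + P * \<alpha> * \<beta> * \<gamma> + 4 * \<alpha> * \<beta> * \<nu> - \<alpha> *
     \<beta> * \<gamma> - \<nu> * \<gamma> * \<gamma> + 2 * R * \<alpha> * \<beta> * \<nu> - R * \<alpha> * \<beta> *
     \<xi> + R * \<alpha> * \<beta> * \<gamma>) *\<^sub>T bas [O0] + (- \<alpha> * \<beta> * \<xi>) *\<^sub>T bas [Oz])"
  "hodge_op 3 (asym q 3 (bas [Om, O0, Oz])) = - (\<i> * of_real m) *\<^sub>T ((- P * \<alpha> * \<nu> * \<gamma> + P *
     \<alpha> * \<epsilon> * \<xi>) *\<^sub>T bas [Om])"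
  "hodge_op 3 (asym q 3 (bas [Op, O0, Oz])) = - (\<i> * of_real m) *\<^sub>T ((R * \<beta> * \<nu> * \<gamma> - R *
     \<beta> * \<epsilon> * \<xi>) *\<^sub>T bas [Op])"
  "hodge_op 4 (asym q 4 (bas [Om, Op, O0, Oz])) = - (\<i> * of_real m) *\<^sub>T ((\<alpha> * \<beta> * \<nu> * \<gamma>
     - \<alpha> * \<beta> * \<epsilon> * \<xi>) *\<^sub>T bas [])"
  by (simp_all only: hodge_op_eq hodge_form_monomials_0 hodge_form_monomials_1 hodge_form_monomials_3
    hodge_form_monomials_4)

lemma hodge_op_monomials_2:
  "hodge_op 2 (asym q 2 (bas [Om, Op])) = - (\<i> * of_real m) *\<^sub>T ((- P * P * \<alpha> * \<beta> + 3 * P *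
     \<alpha> * \<beta> + P * \<epsilon> * \<xi> - 4 * \<alpha> * \<beta> - \<nu> * \<gamma> - 2 * \<epsilon> * \<xi> +
     3 * R * \<alpha> * \<beta> + R * \<epsilon> * \<xi> - R * R * \<alpha> * \<beta>) *\<^sub>T asym q 2 (bas [Om, Op])
     + (P * \<alpha> * \<beta> - \<alpha> * \<beta> - \<epsilon> * \<xi> + R * \<alpha> * \<beta>) *\<^sub>T asym q 2
     (bas [O0, Oz]))"
  "hodge_op 2 (asym q 2 (bas [Om, O0])) = - (\<i> * of_real m) *\<^sub>T ((P * \<alpha> * \<epsilon> + \<alpha> * \<nu>
     + R * \<alpha> * \<nu>) *\<^sub>T asym q 2 (bas [Om, O0]) + (- R * \<alpha> * \<nu>) *\<^sub>T asym q 2 (bas [Om,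
     Oz]))"
  "hodge_op 2 (asym q 2 (bas [Om, Oz])) = - (\<i> * of_real m) *\<^sub>T ((P * P * \<alpha> * \<nu> + P * P * \<alpha> *
     \<xi> + P * P * \<alpha> * \<gamma> + 2 * P * \<alpha> * \<nu> + P * \<alpha> * \<xi> + \<alpha> * \<nu>) *\<^sub>T
     asym q 2 (bas [Om, O0]) + (- \<alpha> * \<xi>) *\<^sub>T asym q 2 (bas [Om, Oz]))"
  "hodge_op 2 (asym q 2 (bas [Op, O0])) = - (\<i> * of_real m) *\<^sub>T ((P * \<beta> * \<nu> + \<beta> * \<nu> - R *
     \<beta> * \<epsilon>) *\<^sub>T asym q 2 (bas [Op, O0]) + (P * \<beta> * \<nu>) *\<^sub>T asym q 2 (bas [Op, Oz]))"
  "hodge_op 2 (asym q 2 (bas [Op, Oz])) = - (\<i> * of_real m) *\<^sub>T ((- \<beta> * \<nu> - 2 * R * \<beta> * \<nu> +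
     R * \<beta> * \<xi> - R * R * \<beta> * \<nu> + R * R * \<beta> * \<xi> - R * R * \<beta> * \<gamma>) *\<^sub>T
     asym q 2 (bas [Op, O0]) + (\<beta> * \<xi>) *\<^sub>T asym q 2 (bas [Op, Oz]))"
  "hodge_op 2 (asym q 2 (bas [O0, Oz])) = - (\<i> * of_real m) *\<^sub>T ((- P * P * P * \<alpha> * \<beta> + 5 * P * P
     * \<alpha> * \<beta> + P * P * \<epsilon> * \<xi> - 11 * P * \<alpha> * \<beta> - 2 * P * \<nu> * \<gamma> - 3 * P
     * \<epsilon> * \<xi> + 14 * \<alpha> * \<beta> + 3 * \<nu> * \<gamma> + 5 * \<epsilon> * \<xi> - 11 * R * \<alpha>
     * \<beta> - 2 * R * \<nu> * \<gamma> - 3 * R * \<epsilon> * \<xi> + 5 * R * R * \<alpha> * \<beta> + R * R *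
     \<epsilon> * \<xi> - R * R * R * \<alpha> * \<beta>) *\<^sub>T asym q 2 (bas [Om, Op]) + (P * P * \<alpha> *
     \<beta> - 3 * P * \<alpha> * \<beta> - P * \<epsilon> * \<xi> + 4 * \<alpha> * \<beta> + \<nu> * \<gamma> +
     \<epsilon> * \<xi> - 3 * R * \<alpha> * \<beta> - R * \<epsilon> * \<xi> + R * R * \<alpha> * \<beta>) *\<^sub>T
     asym q 2 (bas [O0, Oz]))"
  by (rule ext, (simp add: hodge_op_def hodge_form_linear hodge_form_monomials_2
    ext_map_asym_monomials_2[OF ext_map_asym]; simp add: algebra_simps))+

lemma invertible_iff: "invertible_contraction q m \<Gamma> \<longleftrightarrow> \<alpha> * \<beta> * (\<nu> * \<gamma> - \<epsilon> * \<xi>) \<noteq> 0"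
proof -
  have "hodge q m \<Gamma> 4 (mu q m) = hodge_op 4 (mu q m)"
    by (rule hodge_eq) (simp_all add: mu_def theta_def inv_forms_subspace tensor.subspace_scale)
  also have "\<dots> = (of_real m * of_real m * (\<alpha> * \<beta> * (\<nu> * \<gamma> - \<epsilon> * \<xi>))) *\<^sub>T bas []"
    by (rule ext) (simp add: mu_def theta_def hodge_op_linear hodge_op_monomials algebra_simps)
  finally have eq: "hodge q m \<Gamma> 4 (mu q m) = \<dots>" .
  have "bas [] [] \<noteq> 0" by (simp add: bas_apply)
  then have "bas [] \<noteq> 0" by (metis zero_fun_apply)
  then show ?thesis
    using m by (simp add: invertible_contraction_def eq)
qed

lemma hodge_op_1:
  "hodge_op 1 (\<omega> Om) = (\<i> * of_real m * \<alpha>) *\<^sub>T asym q 3 (bas [Om, O0, Oz])"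
  "hodge_op 1 (\<omega> Op) = - (\<i> * of_real m * \<beta>) *\<^sub>T asym q 3 (bas [Op, O0, Oz])"
  "hodge_op 1 (\<omega> O0) = (\<i> * of_real m * \<epsilon>) *\<^sub>T asym q 3 (bas [Om, Op, O0]) +
    (- (\<i> * of_real m * \<nu>)) *\<^sub>T asym q 3 (bas [Om, Op, Oz])"
  "hodge_op 1 (\<omega> Oz) = (\<i> * of_real m * \<gamma>) *\<^sub>T asym q 3 (bas [Om, Op, O0]) +
    (- (\<i> * of_real m * \<xi>)) *\<^sub>T asym q 3 (bas [Om, Op, Oz])"
  by (simp_all add: hodge_op_monomials[unfolded One_nat_def] fun_eq_iff algebra_simps)

lemma idx_all: "(\<forall>a. Q a) \<longleftrightarrow> Q Om \<and> Q Op \<and> Q O0 \<and> Q Oz"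
  by (metis idx.exhaust)

section \<open>Reality and hermiticity as equations between the parameters\<close>

lemma real_iff:
  "real_contraction q m \<Gamma> \<longleftrightarrow> \<beta> = P * cnj \<alpha> \<and> cnj \<nu> = \<nu> \<and> cnj \<epsilon> = \<epsilon> \<and> cnj \<xi> = \<xi> \<and> cnj \<gamma> = \<gamma>"
proof -
  let ?i = "\<i> * of_real m"
  have i: "?i \<noteq> 0" using m by simp
  have lhs: "hodge q m \<Gamma> 1 (form_conj q 1 (\<omega> a)) = - hodge_op 1 (\<omega> (bar a))" for a
    using hodge_eq[of 1 "- \<omega> (bar a)"] tensor.subspace_neg[OF inv_forms_subspace]
    by (simp add: form_conj_1[simplified] hodge_op_linear)
  have rhs: "hodge q m \<Gamma> 1 (\<omega> a) = hodge_op 1 (\<omega> a)" for a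
    using hodge_eq[of 1 "\<omega> a"] by simp
  have "- hodge_op 1 (\<omega> (bar Om)) = form_conj q 3 (hodge_op 1 (\<omega> Om)) \<longleftrightarrow>
      (?i * \<beta>) *\<^sub>T asym q 3 (bas [Op, O0, Oz]) = (?i * (P * cnj \<alpha>)) *\<^sub>T asym q 3 (bas [Op, O0, Oz])"
    unfolding hodge_op_1 bar.simps by (simp add: form_conj_scale form_conj_3 mult.commute mult.left_commute)
  then have Om: "- hodge_op 1 (\<omega> (bar Om)) = form_conj q 3 (hodge_op 1 (\<omega> Om)) \<longleftrightarrow> \<beta> = P * cnj \<alpha>"
    using asym_3_neq_0 i by (simp add: tensor.scale_cancel_right)
  have "form_conj q 3 (- (?i * \<beta>) *\<^sub>T asym q 3 (bas [Op, O0, Oz])) =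
      cnj (- (?i * \<beta>)) *\<^sub>T form_conj q 3 (asym q 3 (bas [Op, O0, Oz]))"
    by (rule form_conj_scale) simp_all
  then have "- hodge_op 1 (\<omega> (bar Op)) = form_conj q 3 (hodge_op 1 (\<omega> Op)) \<longleftrightarrow>
      (?i * \<alpha>) *\<^sub>T asym q 3 (bas [Om, O0, Oz]) = (?i * (R * cnj \<beta>)) *\<^sub>T asym q 3 (bas [Om, O0, Oz])"
    unfolding hodge_op_1 bar.simps by (simp add: form_conj_3 mult.commute mult.left_commute)
  then have Op: "- hodge_op 1 (\<omega> (bar Op)) = form_conj q 3 (hodge_op 1 (\<omega> Op)) \<longleftrightarrow> \<alpha> = R * cnj \<beta>"
    using asym_3_neq_0 i by (simp add: tensor.scale_cancel_right)
  \<comment> \<open>Both 3-forms are self-conjugate and conjugation reverses the imaginary factor.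
    The minus sign from the star on 1-forms makes up for this, so the condition says that the
    coefficients are real.\<close>
  have two: "- ((?i * x) *\<^sub>T asym q 3 (bas [Om, Op, O0]) + (- (?i * y)) *\<^sub>T asym q 3 (bas [Om, Op, Oz])) =
     form_conj q 3 ((?i * x) *\<^sub>T asym q 3 (bas [Om, Op, O0]) + (- (?i * y)) *\<^sub>T asym q 3 (bas [Om, Op, Oz]))
     \<longleftrightarrow> cnj x = x \<and> cnj y = y" for x y
  proof -
    have "form_conj q 3 ((?i * x) *\<^sub>T asym q 3 (bas [Om, Op, O0]) + (- (?i * y)) *\<^sub>T asym q 3 (bas [Om, Op, Oz])) =
      (- (?i * cnj x)) *\<^sub>T asym q 3 (bas [Om, Op, O0]) + (?i * cnj y) *\<^sub>T asym q 3 (bas [Om, Op, Oz])"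
      by (subst form_conj_lincomb) (simp_all add: form_conj_3)
    moreover have "- ((?i * x) *\<^sub>T asym q 3 (bas [Om, Op, O0]) + (- (?i * y)) *\<^sub>T asym q 3 (bas [Om, Op, Oz])) =
      (- (?i * x)) *\<^sub>T asym q 3 (bas [Om, Op, O0]) + (?i * y) *\<^sub>T asym q 3 (bas [Om, Op, Oz])"
      by simp
    ultimately show ?thesis
      using asym_3_coeffs[of "- (?i * x)" "?i * y" "- (?i * cnj x)" "?i * cnj y"] i by auto
  qed
  \<comment> \<open>The condition at \<open>Op\<close> follows from the one at \<open>Om\<close>,
    since \<open>P\<close> is real with inverse \<open>R\<close>.\<close>
  have "\<beta> = P * cnj \<alpha> \<Longrightarrow> \<alpha> = R * cnj \<beta>" by simp
  then show ?thesis
    unfolding real_contraction_def lhs rhs idx_all Om Op unfolding bar.simps hodge_op_1 two by auto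
qed

lemma hodge_op_sq_1:
  "hodge_op 3 (hodge_op 1 (\<omega> Om)) = (of_real m * of_real m) *\<^sub>T ((P * \<alpha> * \<alpha> * (\<epsilon> *
     \<xi> - \<nu> * \<gamma>)) *\<^sub>T \<omega> Om)"
  "hodge_op 3 (hodge_op 1 (\<omega> Op)) = (of_real m * of_real m) *\<^sub>T ((R * \<beta> * \<beta> * (\<epsilon> *
     \<xi> - \<nu> * \<gamma>)) *\<^sub>T \<omega> Op)"
  "hodge_op 3 (hodge_op 1 (\<omega> O0)) = (of_real m * of_real m) *\<^sub>T (
     (\<epsilon> * (P * \<alpha> * \<beta> * (\<epsilon> - \<nu>) - \<alpha> * \<beta> * \<epsilon> - \<epsilon> * \<epsilon> * \<xi> + R * \<alpha> * \<beta> * (\<nu> + \<epsilon>))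
      - \<nu> * (P * \<alpha> * \<beta> * (2 * \<nu> + \<xi> + \<gamma>) + \<alpha> * \<beta> * (4 * \<nu> - \<gamma>) - \<nu> * \<gamma> * \<gamma> + R * \<alpha> * \<beta> * (2 * \<nu> - \<xi> + \<gamma>))) *\<^sub>T \<omega> O0
     + (\<alpha> * \<beta> * \<nu> * (\<xi> - \<epsilon>)) *\<^sub>T \<omega> Oz)"
  "hodge_op 3 (hodge_op 1 (\<omega> Oz)) = (of_real m * of_real m) *\<^sub>T (
     (\<gamma> * (P * \<alpha> * \<beta> * (\<epsilon> - \<nu>) - \<alpha> * \<beta> * \<epsilon> - \<epsilon> * \<epsilon> * \<xi> + R * \<alpha> * \<beta> * (\<nu> + \<epsilon>))
      - \<xi> * (P * \<alpha> * \<beta> * (2 * \<nu> + \<xi> + \<gamma>) + \<alpha> * \<beta> * (4 * \<nu> - \<gamma>) - \<nu> * \<gamma> * \<gamma> + R * \<alpha> * \<beta> * (2 * \<nu> - \<xi> + \<gamma>))) *\<^sub>T \<omega> O0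
     + (\<alpha> * \<beta> * (\<xi> * \<xi> - \<nu> * \<gamma>)) *\<^sub>T \<omega> Oz)"
  unfolding hodge_op_1
  by (simp_all add: hodge_op_linear hodge_op_monomials fun_eq_iff algebra_simps)

lemma hodge_op_sq_0:
  "hodge_op 4 (hodge_op 0 (bas [])) = (of_real m * of_real m * (\<alpha> * \<beta> * (\<nu> * \<gamma> - \<epsilon> *
     \<xi>))) *\<^sub>T bas []"
  by (simp add: hodge_op_linear hodge_op_monomials fun_eq_iff algebra_simps)

lemma hermitian_iff:
  "hermitian_contraction q m \<Gamma> \<longleftrightarrow> (\<forall>a. hodge_op 3 (hodge_op 1 (\<omega> a)) =
    (of_real m * of_real m) *\<^sub>T ((\<alpha> * \<beta> * (\<epsilon> * \<xi> - \<nu> * \<gamma>)) *\<^sub>T \<omega> a))"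
proof -
  have "scalar (hodge_sq q m \<Gamma> 0 (bas [])) = of_real m * of_real m * (\<alpha> * \<beta> * (\<nu> * \<gamma> - \<epsilon> * \<xi>))"
    using hodge_sq_eq[of 0 "bas []"] by (simp add: hodge_op_sq_0 scalar_def bas_apply)
  moreover have "hodge_sq q m \<Gamma> 1 (\<omega> a) = hodge_op 3 (hodge_op 1 (\<omega> a))" for a
    using hodge_sq_eq[of 1 "\<omega> a"] by simp
  ultimately show ?thesis
    unfolding hermitian_contraction_def
    by (simp only: tensor.scale_scale) (simp add: algebra_simps)
qed

lemma hermitian_coeffs:
  assumes "hermitian_contraction q m \<Gamma>" "\<alpha> * \<beta> * (\<nu> * \<gamma> - \<epsilon> * \<xi>) \<noteq> 0"
  shows "\<beta> = P * \<alpha>" "\<xi> = \<epsilon>"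
    "\<epsilon> * (P * \<alpha> * \<beta> * (\<epsilon> - \<nu>) - \<alpha> * \<beta> * \<epsilon> - \<epsilon> * \<epsilon> * \<xi> + R * \<alpha> * \<beta> * (\<nu> + \<epsilon>))
      - \<nu> * (P * \<alpha> * \<beta> * (2 * \<nu> + \<xi> + \<gamma>) + \<alpha> * \<beta> * (4 * \<nu> - \<gamma>) - \<nu> * \<gamma> * \<gamma> + R * \<alpha> * \<beta> * (2 * \<nu> - \<xi> + \<gamma>))
      = \<alpha> * \<beta> * (\<epsilon> * \<xi> - \<nu> * \<gamma>)"
    "\<gamma> * (P * \<alpha> * \<beta> * (\<epsilon> - \<nu>) - \<alpha> * \<beta> * \<epsilon> - \<epsilon> * \<epsilon> * \<xi> + R * \<alpha> * \<beta> * (\<nu> + \<epsilon>))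
      - \<xi> * (P * \<alpha> * \<beta> * (2 * \<nu> + \<xi> + \<gamma>) + \<alpha> * \<beta> * (4 * \<nu> - \<gamma>) - \<nu> * \<gamma> * \<gamma> + R * \<alpha> * \<beta> * (2 * \<nu> - \<xi> + \<gamma>))
      = 0"
proof -
  have herm: "hodge_op 3 (hodge_op 1 (\<omega> a)) w =
    ((of_real m * of_real m) *\<^sub>T ((\<alpha> * \<beta> * (\<epsilon> * \<xi> - \<nu> * \<gamma>)) *\<^sub>T \<omega> a)) w" for a w
    using assms(1) unfolding hermitian_iff by simp
  have ne: "\<alpha> \<noteq> 0" "\<beta> \<noteq> 0" "\<epsilon> * \<xi> - \<nu> * \<gamma> \<noteq> 0" using assms(2) by auto
  have "P * \<alpha> * \<alpha> * (\<epsilon> * \<xi> - \<nu> * \<gamma>) = \<alpha> * \<beta> * (\<epsilon> * \<xi> - \<nu> * \<gamma>)"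
    using herm[of Om "[Om]"] m unfolding hodge_op_sq_1 by (simp add: bas_apply)
  then show "\<beta> = P * \<alpha>" using ne by auto
  have "\<alpha> * \<beta> * \<nu> * (\<xi> - \<epsilon>) = 0"
    using herm[of O0 "[Oz]"] m unfolding hodge_op_sq_1 by (simp add: bas_apply)
  moreover have "\<alpha> * \<beta> * (\<xi> * \<xi> - \<nu> * \<gamma>) = \<alpha> * \<beta> * (\<epsilon> * \<xi> - \<nu> * \<gamma>)"
    using herm[of Oz "[Oz]"] m unfolding hodge_op_sq_1 by (simp add: bas_apply)
  \<comment> \<open>Both equations contain the factor \<xi> - \<epsilon>, with cofactors \<nu> and
    \<xi>. These do not vanish together, as \<epsilon> \<xi> - \<nu> \<gamma> is nonzero.\<close>
  ultimately show "\<xi> = \<epsilon>" using ne by auto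
  show "\<epsilon> * (P * \<alpha> * \<beta> * (\<epsilon> - \<nu>) - \<alpha> * \<beta> * \<epsilon> - \<epsilon> * \<epsilon> * \<xi> + R * \<alpha> * \<beta> * (\<nu> + \<epsilon>))
      - \<nu> * (P * \<alpha> * \<beta> * (2 * \<nu> + \<xi> + \<gamma>) + \<alpha> * \<beta> * (4 * \<nu> - \<gamma>) - \<nu> * \<gamma> * \<gamma> + R * \<alpha> * \<beta> * (2 * \<nu> - \<xi> + \<gamma>))
      = \<alpha> * \<beta> * (\<epsilon> * \<xi> - \<nu> * \<gamma>)"
    using herm[of O0 "[O0]"] m unfolding hodge_op_sq_1
    by (simp only: tscale_apply plus_fun_apply bas_apply) simp
  show "\<gamma> * (P * \<alpha> * \<beta> * (\<epsilon> - \<nu>) - \<alpha> * \<beta> * \<epsilon> - \<epsilon> * \<epsilon> * \<xi> + R * \<alpha> * \<beta> * (\<nu> + \<epsilon>))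
      - \<xi> * (P * \<alpha> * \<beta> * (2 * \<nu> + \<xi> + \<gamma>) + \<alpha> * \<beta> * (4 * \<nu> - \<gamma>) - \<nu> * \<gamma> * \<gamma> + R * \<alpha> * \<beta> * (2 * \<nu> - \<xi> + \<gamma>))
      = 0"
    using herm[of Oz "[O0]"] m unfolding hodge_op_sq_1
    by (simp only: tscale_apply plus_fun_apply bas_apply) simp
qed

lemma max_hermitian_coeffs:
  assumes "real_max_hermitian q m \<Gamma>" "\<alpha> \<noteq> 0" "\<beta> \<noteq> 0"
  shows "\<nu> * (\<xi> - P * \<epsilon> - \<nu> - R * \<nu>) = 0" "\<nu> * (\<xi> + P * \<nu> + \<nu> - R * \<epsilon>) = 0"
proof -
  have const: "\<exists>c. hodge_op 2 (hodge_op 2 \<eta>) = c *\<^sub>T \<eta>" if eig: "\<eta> \<in> inv_forms q 2" "asym q 2 \<eta> = l *\<^sub>T \<eta>" for \<eta> l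
  proof -
    have "\<exists>c. \<forall>\<eta>\<in>inv_forms q 2. asym q 2 \<eta> = l *\<^sub>T \<eta> \<longrightarrow> hodge_sq q m \<Gamma> 2 \<eta> = c *\<^sub>T \<eta>"
      using assms(1) by (simp add: real_max_hermitian_def)
    then obtain c where "hodge_sq q m \<Gamma> 2 \<eta> = c *\<^sub>T \<eta>"
      using eig by blast
    then have "hodge_op 2 (hodge_op 2 \<eta>) = c *\<^sub>T \<eta>"
      using eig(1) hodge_sq_eq[of 2 \<eta>] by simp
    then show ?thesis ..
  qed
  let ?m = "asym q 2 (bas [Om, O0])" and ?p = "asym q 2 (bas [Op, O0])"
  obtain c where c: "hodge_op 2 (hodge_op 2 ?m) = c *\<^sub>T ?m"
    using const[of ?m "1 + P"] by (auto simp: ext_map_asym_monomials_2[OF ext_map_asym] add.commute)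
  \<comment> \<open>Among the antisymmetrised increasing words only that of \<open>[Om, Oz]\<close>
    has a coefficient at this word, which therefore measures how far the square leaves the line of
    \<open>?m\<close>.\<close>
  have "hodge_op 2 (hodge_op 2 ?m) [Om, Oz] = - (of_real m * of_real m) * (R * \<alpha> * \<alpha> * (\<nu> * (\<xi> - P * \<epsilon> - \<nu> - R * \<nu>)))"
    by (simp add: hodge_op_linear hodge_op_monomials_2) (simp add: asym_monomials_2 bas_apply algebra_simps)
  then have "of_real m * of_real m * (R * \<alpha> * \<alpha> * (\<nu> * (\<xi> - P * \<epsilon> - \<nu> - R * \<nu>))) = 0"
    unfolding c by (simp add: asym_monomials_2 bas_apply)
  then show "\<nu> * (\<xi> - P * \<epsilon> - \<nu> - R * \<nu>) = 0"
    using m assms by auto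
  obtain d where d: "hodge_op 2 (hodge_op 2 ?p) = d *\<^sub>T ?p"
    using const[of ?p "1 + R"] by (auto simp: ext_map_asym_monomials_2[OF ext_map_asym] add.commute)
  have "hodge_op 2 (hodge_op 2 ?p) [Op, Oz] = - (of_real m * of_real m) * (P * \<beta> * \<beta> * (\<nu> * (\<xi> + P * \<nu> + \<nu> - R * \<epsilon>)))"
    by (simp add: hodge_op_linear hodge_op_monomials_2) (simp add: asym_monomials_2 bas_apply algebra_simps)
  then have "of_real m * of_real m * (P * \<beta> * \<beta> * (\<nu> * (\<xi> + P * \<nu> + \<nu> - R * \<epsilon>))) = 0"
    unfolding d by (simp add: asym_monomials_2 bas_apply)
  then show "\<nu> * (\<xi> + P * \<nu> + \<nu> - R * \<epsilon>) = 0"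
    using m assms by auto
qed

lemma real_max_hermitian_imp:
  assumes "real_max_hermitian q m \<Gamma>" "invertible_contraction q m \<Gamma>"
  shows "cnj \<alpha> = \<alpha>" "cnj \<epsilon> = \<epsilon>" "cnj \<gamma> = \<gamma>" "\<alpha> \<noteq> 0" "\<epsilon> \<noteq> 0" "\<gamma> \<noteq> 0"
    "\<beta> = P * \<alpha>" "\<nu> = 0" "\<xi> = \<epsilon>" "\<epsilon> * \<epsilon> = (P - 2 + R) * \<alpha> * \<beta>" "(P + 1) * \<epsilon> + (P - 1) * \<gamma> = 0"
proof -
  have inv: "\<alpha> * \<beta> * (\<nu> * \<gamma> - \<epsilon> * \<xi>) \<noteq> 0"
    using assms(2) by (simp add: invertible_iff)
  then have ne: "\<alpha> \<noteq> 0" "\<beta> \<noteq> 0" by auto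
  have herm: "hermitian_contraction q m \<Gamma>" and real: "real_contraction q m \<Gamma>"
    using assms(1) by (auto simp: real_max_hermitian_def)
  note h = hermitian_coeffs[OF herm inv]
  show \<beta>: "\<beta> = P * \<alpha>" and \<xi>: "\<xi> = \<epsilon>" by (rule h)+
  show "cnj \<epsilon> = \<epsilon>" "cnj \<gamma> = \<gamma>" using real by (simp_all add: real_iff)
  have "P * \<alpha> = P * cnj \<alpha>" using real \<beta> by (simp add: real_iff)
  then show "cnj \<alpha> = \<alpha>" by simp
  show \<nu>: "\<nu> = 0"
  proof (rule ccontr)
    assume "\<nu> \<noteq> 0"
    then have "\<epsilon> - P * \<epsilon> - \<nu> - R * \<nu> = 0" "\<epsilon> + P * \<nu> + \<nu> - R * \<epsilon> = 0"
      using max_hermitian_coeffs[OF assms(1) ne] \<xi> by auto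
    then have *: "\<epsilon> * (1 - P) = \<nu> * (1 + R)" "\<epsilon> * (R - 1) = \<nu> * (1 + P)"
      by (simp_all add: algebra_simps)
    then have \<epsilon>: "\<epsilon> \<noteq> 0" using \<open>\<nu> \<noteq> 0\<close> PR_neq(3) by (auto simp: add.commute)
    \<comment> \<open>Eliminates \<nu> from the two equations, using P (1 + R) = 1 + P and R - 1 = R
      (1 - P).\<close>
    have "P * (\<epsilon> * (1 - P)) = \<nu> * (1 + P)"
      unfolding *(1) by (simp add: algebra_simps)
    also have "\<dots> = R * (\<epsilon> * (1 - P))"
      unfolding *(2)[symmetric] by (simp add: algebra_simps)
    finally show False
      using \<epsilon> PR_neq by simp
  qed
  show "\<alpha> \<noteq> 0" by (rule ne)
  show \<epsilon>: "\<epsilon> \<noteq> 0" using inv \<nu> by auto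
  \<comment> \<open>The hermiticity condition at \<open>O0\<close> for \<nu> = 0 and \<xi> =
    \<epsilon>; the constant arises from (P - 2 + R) P = (P - 1)^2.\<close>
  have "\<epsilon> * \<epsilon> * (\<epsilon> * \<epsilon>) = \<epsilon> * \<epsilon> * (\<alpha> * \<alpha> * (P - 1) * (P - 1))"
    using h(3) unfolding \<nu> \<xi> \<beta> by (simp add: algebra_simps)
  then have sq: "\<epsilon> * \<epsilon> = \<alpha> * \<alpha> * (P - 1) * (P - 1)"
    using \<epsilon> by simp
  then show "\<epsilon> * \<epsilon> = (P - 2 + R) * \<alpha> * \<beta>"
    unfolding \<beta> by (simp add: algebra_simps)
  \<comment> \<open>In the condition at \<open>Oz\<close> the terms with (P - 1 + R) \<alpha>
    \<beta> \<gamma> \<epsilon> cancel. This leaves \<gamma> \<epsilon> = (R - P) \<alpha> \<beta>,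
    where (R - P) P = 1 - P^2.\<close>
  have "\<epsilon> * (\<epsilon> * (\<gamma> * \<epsilon>)) = \<epsilon> * (\<epsilon> * (\<alpha> * \<alpha> * (1 - P) * (1 + P)))"
    using h(4) unfolding \<nu> \<xi> \<beta> by (simp add: algebra_simps)
  then have \<gamma>: "\<gamma> * \<epsilon> = \<alpha> * \<alpha> * (1 - P) * (1 + P)"
    using \<epsilon> by simp
  then show "\<gamma> \<noteq> 0"
    using ne PR_neq by (auto simp: add.commute)
  \<comment> \<open>Eliminating \<alpha>^2 between the two quadratic equations makes the remaining
    condition linear.\<close>
  have "\<epsilon> * ((1 - P) * \<gamma>) = (1 - P) * (\<gamma> * \<epsilon>)"
    by simp
  also have "\<dots> = (\<alpha> * \<alpha> * (P - 1) * (P - 1)) * (1 + P)"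
    unfolding \<gamma> by (simp add: algebra_simps)
  also have "\<dots> = \<epsilon> * (\<epsilon> * (1 + P))"
    unfolding sq[symmetric] by simp
  finally have "(1 - P) * \<gamma> = \<epsilon> * (1 + P)"
    using \<epsilon> by simp
  then show "(P + 1) * \<epsilon> + (P - 1) * \<gamma> = 0"
    by (simp add: algebra_simps)
qed

text \<open>Composed with the antisymmetriser, both sides respect the relations, so it suffices to
  compare them on increasing words.\<close>

lemma hodge_sq_eqI:
  assumes "k \<le> 4" "tlinear h" "\<eta> \<in> inv_forms q k"
    and "\<And>S. S \<in> monomials k \<Longrightarrow> hodge_op (4 - k) (hodge_op k (asym q k (bas S))) = h (asym q k (bas S))"
  shows "hodge_sq q m \<Gamma> k \<eta> = h \<eta>"
proof -
  from assms(3) obtain x where x: "x \<in> tpow k" "\<eta> = asym q k x" by (rule inv_formsE)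
  have "hodge_op (4 - k) (hodge_op k (asym q k x)) = h (asym q k x)"
    by (rule ext_map_eqI[where f = "\<lambda>x. hodge_op (4 - k) (hodge_op k (asym q k x))" and g = "\<lambda>x. h (asym q k x)",
          OF _ _ x(1) assms(4)])
      (intro ext_map_comp[OF tlinear_hodge_op] ext_map_comp[OF assms(2)] ext_map_asym)+
  then show ?thesis
    using assms(1,3) by (simp add: hodge_sq_eq x(2))
qed

text \<open>The solutions are parametrised by \<open>\<alpha>\<close> and a sign \<open>\<delta>\<close>.\<close>

lemma real_max_hermitianI:
  assumes "cnj \<alpha> = \<alpha>" "cnj \<epsilon> = \<epsilon>" "cnj \<gamma> = \<gamma>" "\<alpha> \<noteq> 0"
    "\<beta> = P * \<alpha>" "\<nu> = 0" "\<xi> = \<epsilon>" "\<epsilon> * \<epsilon> = (P - 2 + R) * \<alpha> * \<beta>" "(P + 1) * \<epsilon> + (P - 1) * \<gamma> = 0"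
  shows "real_max_hermitian q m \<Gamma>"
proof -
  \<comment> \<open>\<delta> is a sign because \<epsilon>^2 = (1 - P)^2 \<alpha>^2. All parameters
    become polynomials in \<delta>, P and \<alpha>, and \<delta>^2 = 1 can serve as a rewrite
    rule.\<close>
  define \<delta> where "\<delta> = \<epsilon> / ((1 - P) * \<alpha>)"
  have "1 - P \<noteq> 0" using PR_neq by simp
  then have \<epsilon>: "\<epsilon> = \<delta> * (1 - P) * \<alpha>"
    using assms(4) by (simp add: \<delta>_def)
  have "\<delta> * \<delta> = (\<epsilon> * \<epsilon>) / ((1 - P) * (1 - P) * \<alpha> * \<alpha>)"
    by (simp add: \<delta>_def)
  also have "\<epsilon> * \<epsilon> = (1 - P) * (1 - P) * \<alpha> * \<alpha>"
    unfolding assms(8) assms(5) by (simp add: algebra_simps)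
  finally have \<delta>: "\<delta> * \<delta> = 1" "\<delta> * (\<delta> * x) = x" for x
    using assms(4) \<open>1 - P \<noteq> 0\<close> by (simp_all add: mult.assoc[symmetric])
  have "(1 - P) * \<gamma> = (1 - P) * (\<delta> * (1 + P) * \<alpha>)"
    using assms(9) unfolding \<epsilon> by (simp add: algebra_simps)
  then have \<gamma>: "\<gamma> = \<delta> * (1 + P) * \<alpha>"
    using \<open>1 - P \<noteq> 0\<close> by simp
  note params = assms(5-7) \<epsilon> \<gamma>
  \<comment> \<open>The value of the squared Hodge operator on 1-forms; it recurs on 3-forms and
    changes sign on 0-forms and 4-forms.\<close>
  let ?c = "of_real m * of_real m * (P * \<alpha> * \<alpha> * \<epsilon> * \<epsilon>)"
  have real: "real_contraction q m \<Gamma>"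
    using assms by (simp add: real_iff)
  have sq1: "hodge_op 3 (hodge_op 1 (\<omega> a)) = ?c *\<^sub>T \<omega> a" for a
    by (cases a) (simp_all only: hodge_op_sq_1, simp_all add: params fun_eq_iff algebra_simps \<delta>)
  have herm: "hermitian_contraction q m \<Gamma>"
    unfolding hermitian_iff sq1 by (simp add: params fun_eq_iff algebra_simps)
  have const: "hodge_sq q m \<Gamma> k \<eta> = (if odd k then ?c else - ?c) *\<^sub>T \<eta>"
    if k: "k \<le> 4" "k \<noteq> 2" and \<eta>: "\<eta> \<in> inv_forms q k" for k \<eta>
  proof (rule hodge_sq_eqI[OF k(1) _ \<eta>])
    show "tlinear (\<lambda>\<eta>. (if odd k then ?c else - ?c) *\<^sub>T \<eta>)"
      by (rule tlinearI) (simp_all only: tensor.scale_right_distrib tensor.scale_scale mult.commute)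
    fix S assume S: "S \<in> monomials k"
    consider "k = 0" | "k = 1" | "k = 3" | "k = 4"
      using k by linarith
    then show "hodge_op (4 - k) (hodge_op k (asym q k (bas S))) = (if odd k then ?c else - ?c) *\<^sub>T asym q k (bas S)"
    proof cases
      case 1
      then show ?thesis
        using S by (simp add: monomials_eq asym_0 hodge_op_sq_0) (simp add: params fun_eq_iff algebra_simps)
    next
      case 2
      then obtain a where "S = [a]"
        using S by (auto simp: monomials_def length_Suc_conv)
      then show ?thesis
        using sq1[of a] 2 asym_1[of "bas [a]"] by simp
    next
      case 3
      then show ?thesis
        using S by (auto simp: monomials_eq hodge_op_linear hodge_op_monomials[unfolded One_nat_def];
            simp add: params fun_eq_iff algebra_simps \<delta>)
    next
      case 4
      then show ?thesis
        using S by (simp add: monomials_eq hodge_op_linear hodge_op_monomials; simp add: params fun_eq_iff algebra_simps \<delta>)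
    qed
  qed
  \<comment> \<open>On 2-forms the square is not scalar but a polynomial in the antisymmetriser,
    hence the constant - ?c (l - 1) on the eigenspace of l.\<close>
  let ?h = "\<lambda>\<eta>. (- ?c) *\<^sub>T (asym q 2 \<eta> - \<eta>)"
  have two: "hodge_sq q m \<Gamma> 2 \<eta> = ?h \<eta>" if "\<eta> \<in> inv_forms q 2" for \<eta>
  proof (rule hodge_sq_eqI[OF _ _ that])
    show "tlinear ?h"
      by (rule tlinearI) (simp_all add: fun_eq_iff algebra_simps)
    fix S assume S: "S \<in> monomials 2"
    show "hodge_op (4 - 2) (hodge_op 2 (asym q 2 (bas S))) = ?h (asym q 2 (bas S))"
      using S by (auto simp: monomials_eq hodge_op_linear hodge_op_monomials_2 ext_map_asym_monomials_2[OF ext_map_asym];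
          simp add: params fun_eq_iff algebra_simps \<delta>)
  qed simp
  have "\<exists>c. \<forall>\<eta>\<in>inv_forms q k. asym q k \<eta> = l *\<^sub>T \<eta> \<longrightarrow> hodge_sq q m \<Gamma> k \<eta> = c *\<^sub>T \<eta>" if "k \<le> 4" for k l
  proof (cases "k = 2")
    case False
    then show ?thesis using const[OF that False] by blast
  next
    case True
    have "hodge_sq q m \<Gamma> 2 \<eta> = (- ?c * (l - 1)) *\<^sub>T \<eta>"
      if "\<eta> \<in> inv_forms q 2" "asym q 2 \<eta> = l *\<^sub>T \<eta>" for \<eta>
      unfolding two[OF that(1)] that(2) by (simp add: fun_eq_iff algebra_simps)
    then show ?thesis using True by blast
  qed
  then show ?thesis
    using real herm by (simp add: real_max_hermitian_def)
qed

text \<open>In the expansion of \<open>asym_monomials_4\<close> only \<open>[Om, Op, O0, Oz]\<close>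
  and \<open>[Om, Op, Oz, O0]\<close>, with coefficients 1 and -1, pair with the first argument. The
  complex conjugate reflects the convention for the parameters.\<close>

lemma qdet_eq: "qdet q \<Gamma> = cnj (\<alpha> * \<beta> * (\<nu> * \<gamma> - \<epsilon> * \<xi>))"
  by (simp add: qdet_def scalar_def contract_simps asym_monomials_4 contract_bas matrix)
    (simp add: bas_apply algebra_simps)

end

theorem mainTheorem2:
  fixes q m :: real
    and \<Gamma> :: "tensor \<Rightarrow> tensor \<Rightarrow> complex"
    and \<alpha> \<beta> \<nu> \<epsilon> \<xi> \<gamma> :: complex
  assumes "0 < q" and "q < 1" and "m \<noteq> 0"
    and "contraction \<Gamma>"
    and "\<And>a b. \<Gamma> (\<omega> a) (\<omega> b) = u1_matrix \<alpha> \<beta> \<nu> \<epsilon> \<xi> \<gamma> a b"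
    and "invertible_contraction q m \<Gamma>"
  shows "(real_max_hermitian q m \<Gamma> \<longleftrightarrow>
            {\<alpha>, \<beta>, \<nu>, \<gamma>, \<epsilon>, \<xi>} \<subseteq> \<real> \<and> \<alpha> \<noteq> 0 \<and> \<gamma> \<noteq> 0 \<and> \<epsilon> \<noteq> 0 \<and>
            \<beta> = of_real (q^2) * \<alpha> \<and> \<nu> = 0 \<and> \<xi> = \<epsilon> \<and>
            \<epsilon>^2 = of_real ((q - 1 / q)^2) * \<alpha> * \<beta> \<and>
            of_real (q + 1 / q) * \<epsilon> + of_real (q - 1 / q) * \<gamma> = 0) \<and>
         (real_max_hermitian q m \<Gamma> \<longrightarrow>
            qdet q \<Gamma> = - of_real (q^2 * (1 - q^2)^2) * \<alpha>^4 \<and> qsgn q \<Gamma> = -1)"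
proof -
  define P R :: complex where "P = of_real (q^2)" and "R = of_real (1 / q^2)"
  interpret u1_contraction q P R m \<Gamma> "cnj \<alpha>" "cnj \<beta>" "cnj \<nu>" "cnj \<epsilon>" "cnj \<xi>" "cnj \<gamma>"
  proof
    show "\<Gamma> (\<omega> a) (\<omega> b) = cnj (u1_matrix (cnj \<alpha>) (cnj \<beta>) (cnj \<nu>) (cnj \<epsilon>) (cnj \<xi>) (cnj \<gamma>) a b)" for a b
      unfolding assms(5) by (cases a; cases b) simp_all
  qed (use assms in \<open>simp_all add: P_def R_def\<close>)
  have coeff: "of_real ((q - 1 / q)^2) = P - 2 + R" by (rule coeffs)
  have linear: "of_real (q + 1 / q) * \<epsilon> + of_real (q - 1 / q) * \<gamma> = 0 \<longleftrightarrow> (P + 1) * \<epsilon> + (P - 1) * \<gamma> = 0"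
  proof -
    \<comment> \<open>Multiplication by q turns q + 1/q and q - 1/q into q^2 + 1 and q^2 -
      1.\<close>
    have "(P + 1) * \<epsilon> + (P - 1) * \<gamma> = of_real q * (of_real (q + 1 / q) * \<epsilon> + of_real (q - 1 / q) * \<gamma>)"
      using assms(1) by (simp add: P_def field_simps power2_eq_square)
    then show ?thesis using assms(1) by simp
  qed
  let ?C = "{\<alpha>, \<beta>, \<nu>, \<gamma>, \<epsilon>, \<xi>} \<subseteq> \<real> \<and> \<alpha> \<noteq> 0 \<and> \<gamma> \<noteq> 0 \<and> \<epsilon> \<noteq> 0 \<and>
     \<beta> = P * \<alpha> \<and> \<nu> = 0 \<and> \<xi> = \<epsilon> \<and> \<epsilon>^2 = (P - 2 + R) * \<alpha> * \<beta> \<and> (P + 1) * \<epsilon> + (P - 1) * \<gamma> = 0"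
  have iff: "real_max_hermitian q m \<Gamma> \<longleftrightarrow> ?C"
  proof
    assume *: "real_max_hermitian q m \<Gamma>"
    note h = real_max_hermitian_imp[OF * assms(6), unfolded complex_cnj_cnj]
    have real: "cnj \<alpha> = \<alpha>" "cnj \<epsilon> = \<epsilon>" "cnj \<gamma> = \<gamma>"
      using h(1-3) by simp_all
    have "cnj \<beta> = P * \<alpha>" "cnj \<nu> = 0" "cnj \<xi> = \<epsilon>"
      using h(7-9) by (simp_all add: real)
    then have eqs: "\<beta> = P * \<alpha>" "\<nu> = 0" "\<xi> = \<epsilon>"
      using real by (metis cnj_PR(1) complex_cnj_cnj complex_cnj_mult complex_cnj_zero)+
    show ?C
      using h(4-6,10,11) by (auto simp: eqs real power2_eq_square Reals_cnj_iff)
  next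
    assume *: ?C
    then have real: "cnj \<alpha> = \<alpha>" "cnj \<epsilon> = \<epsilon>" "cnj \<gamma> = \<gamma>"
      by (simp_all add: Reals_cnj_iff)
    show "real_max_hermitian q m \<Gamma>"
      using * by (intro real_max_hermitianI) (simp_all add: real power2_eq_square)
  qed
  have det: "qdet q \<Gamma> = - of_real (q^2 * (1 - q^2)^2) * \<alpha>^4" "qsgn q \<Gamma> = -1" if C: ?C
  proof -
    have "qdet q \<Gamma> = - (P * \<alpha> * \<alpha> * \<epsilon>^2)"
      using C by (simp add: qdet_eq power2_eq_square)
    also have "\<epsilon>^2 = (P - 2 + R) * \<alpha> * (P * \<alpha>)"
      using C by simp
    also have "- (P * \<alpha> * \<alpha> * ((P - 2 + R) * \<alpha> * (P * \<alpha>))) = - (P * (1 - P)^2 * \<alpha>^4)"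
      by (simp add: power2_eq_square power4_eq_xxxx algebra_simps)
    also have "P * (1 - P)^2 = of_real (q^2 * (1 - q^2)^2)"
      by (simp add: P_def)
    finally show det: "qdet q \<Gamma> = - of_real (q^2 * (1 - q^2)^2) * \<alpha>^4" by simp
    obtain r where r: "\<alpha> = of_real r" using C by (auto elim: Reals_cases)
    define s where "s = q^2 * (1 - q^2)^2 * r^4"
    have "s > 0"
      using assms(1,2) C r power_less_one_iff[of q 2] by (auto simp: s_def zero_less_power_eq)
    moreover have "qdet q \<Gamma> = - of_real s"
      unfolding det r s_def by simp
    ultimately show "qsgn q \<Gamma> = -1"
      by (simp add: qsgn_def)
  qed
  show ?thesis
    unfolding linear coeff P_def[symmetric] using iff det by blast
qed

end
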